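(* For every $\varepsilon>0$, $$\mathcal{E}\ll_{\varepsilon} T^{\varepsilon}\,|\Pi|\,(XZ)^{1-\delta}\left[\frac{\mathcal{Q}^4}{X^{1/4}}+\frac{1}{Q_0^{1/2}}+\frac{\mathcal{Q}^{1/2}}{Z^{1/4}}\right].$$
   Context: Fix an integer $\mathcal{A}\ge1$; $\Gamma_{\mathcal{A}}$ is the semigroup of all products of even length of the matrices $\begin{pmatrix}a&1\\1&0\end{pmatrix}$, $1\le a\le \mathcal{A}$, and $\delta=\delta_{\mathcal{A}}$ is the Hausdorff dimension of the set of $[0;a_1,a_2,\dots]$ with all $a_j\le\mathcal{A}$. $\|g\|=\sqrt{\mathrm{tr}(g\,{}^tg)}$, $B_X=\{g:\|g\|<X\}$, ${}^t$ is transpose, and $\mathfrak f(\varphi)=a^2+b^2+c^2+d^2$ for $\varphi=\begin{pmatrix}a&b\\c&d\end{pmatrix}$. Parameters: $N$ large, $X,Y,Z\ge1$ with $XYZ=N$, $T\asymp N^4$, and $1\le Q_0<\mathcal{Q}$. $\aleph$ is a nonempty subset of $\{\gamma\in\Gamma_2:\|\gamma\|<Y\}$ (chosen with an equidistribution property mod $q$, not needed for this statement). $\Omega_X\subset\Gamma_{\mathcal{A}}\cap B_X$ is a subset all of whose elements have the same word length, with $\#\Omega_X\gg X^{2\delta}/\log X$; similarly $\Omega_Z$; $\Pi=\Omega_X\cdot\aleph\cdot\Omega_Z$. For a prime $p$, $\rho(p)=|\mathrm{SL}_2(\mathbb{F}_p)|^{-1}\#\{\gamma\in\mathrm{SL}_2(\mathbb{F}_p):\mathfrak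 f(\gamma)\equiv2\bmod p\}$, extended multiplicatively to square-free integers; $\Xi(p;n)=\mathbf 1_{\{n\equiv0\bmod p\}}-\rho(p)$, and $\Xi(q;n)=\prod_{p\mid q}\Xi(p;n)$ for square-free $q$. For square-free $\mathfrak q$, $$r(\mathfrak q)=\sum_{\substack{q\mid\mathfrak q\\ q>Q_0}}\ \sum_{\substack{t\bmod q\\ t^2\equiv4\bmod q}}\ \sum_{\varphi\in\Pi}\Xi\big(q;\mathfrak f(\varphi)-t\big)\sum_{\substack{\tau\bmod\mathfrak q\\ \tau^2\equiv 4\bmod\mathfrak q,\ \tau\equiv t\bmod q}}\rho(\mathfrak q/q),$$ and $\mathcal{E}=\sum_{\mathfrak q<\mathcal{Q},\ \mathfrak q\text{ square-free}}|r(\mathfrak q)|$. Implied constants may depend on $\mathcal{A}$ and $\varepsilon$. *)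

theory Defs
  imports
    "HOL-Analysis.Analysis"
    "HOL-Number_Theory.Number_Theory"
    "HOL-Computational_Algebra.Computational_Algebra"
begin

type_synonym imat = "int^2^2"

definition mnorm :: "imat \<Rightarrow> real" where
  "mnorm g = sqrt (real_of_int (trace (g ** transpose g)))"

definition norm_ball :: "real \<Rightarrow> imat set" where
  "norm_ball X = {g. mnorm g < X}"

definition ff :: "imat \<Rightarrow> int" where
  "ff g = (g $ 1 $ 1)\<^sup>2 + (g $ 1 $ 2)\<^sup>2 + (g $ 2 $ 1)\<^sup>2 + (g $ 2 $ 2)\<^sup>2"

definition cf_gen :: "nat \<Rightarrow> imat" where
  "cf_gen a = vector [vector [int a, 1], vector [1, 0]]"

definition word_mat :: "nat list \<Rightarrow> imat" where
  "word_mat ws = foldr (\<lambda>a g. cf_gen a ** g) ws (mat 1)"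

definition has_word_length :: "nat \<Rightarrow> nat \<Rightarrow> imat \<Rightarrow> bool" where
  "has_word_length A l g \<longleftrightarrow> (\<exists>ws. length ws = l \<and> set ws \<subseteq> {1..A} \<and> g = word_mat ws)"

(* A semigroup, not a monoid: the empty word is excluded. *)
definition Gamma_sg :: "nat \<Rightarrow> imat set" where
  "Gamma_sg A = {g. \<exists>l. even l \<and> l > 0 \<and> has_word_length A l g}"

definition same_word_length :: "nat \<Rightarrow> imat set \<Rightarrow> bool" where
  "same_word_length A S \<longleftrightarrow> (\<exists>l. \<forall>g\<in>S. has_word_length A l g)"

(* cf_trunc a n = [0; a 0, ..., a (n-1)]; the partial quotients are indexed from 0. *)
fun cf_trunc :: "(nat \<Rightarrow> nat) \<Rightarrow> nat \<Rightarrow> real" where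
  "cf_trunc a 0 = 0"
| "cf_trunc a (Suc n) = 1 / (real (a 0) + cf_trunc (\<lambda>i. a (Suc i)) n)"

definition cf_set :: "nat \<Rightarrow> real set" where
  "cf_set A = {x. \<exists>a. (\<forall>i. 1 \<le> a i \<and> a i \<le> A) \<and> cf_trunc a \<longlonglongrightarrow> x}"

definition hausdorff_content :: "real \<Rightarrow> real \<Rightarrow> 'a::metric_space set \<Rightarrow> ennreal" where
  "hausdorff_content s r S =
     (INF U \<in> {U :: nat \<Rightarrow> 'a set. S \<subseteq> (\<Union>i. U i) \<and> (\<forall>i. bounded (U i) \<and> diameter (U i) \<le> r)}.
        (\<Sum>i. ennreal (diameter (U i) powr s)))"

definition hausdorff_measure :: "real \<Rightarrow> 'a::metric_space set \<Rightarrow> ennreal" where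
  "hausdorff_measure s S = (SUP r \<in> {0<..}. hausdorff_content s r S)"

(* Only exponents s > 0 are used: the convention 0 powr 0 = 0 makes the case s = 0
   of hausdorff_measure differ from counting measure, and leaving it out does not
   change the infimum. *)
definition hausdorff_dim :: "real set \<Rightarrow> real" where
  "hausdorff_dim S = Inf {s. 0 < s \<and> hausdorff_measure s S = 0}"

definition delta :: "nat \<Rightarrow> real" where
  "delta A = hausdorff_dim (cf_set A)"

(* SL_2(F_p), with entries represented by the residues 0, ..., p - 1. *)
definition SL2_mod :: "nat \<Rightarrow> imat set" where
  "SL2_mod p = {g. (\<forall>i j. g $ i $ j \<in> {0..<int p}) \<and> [det g = 1] (mod int p)}"

definition rho_prime :: "nat \<Rightarrow> real" where
  "rho_prime p = real (card {g \<in> SL2_mod p. [ff g = 2] (mod int p)}) / real (card (SL2_mod p))"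

definition rho :: "nat \<Rightarrow> real" where
  "rho q = (\<Prod>p\<in>prime_factors q. rho_prime p)"

definition Xi_prime :: "nat \<Rightarrow> int \<Rightarrow> real" where
  "Xi_prime p n = (if [n = 0] (mod int p) then 1 else 0) - rho_prime p"

definition Xi :: "nat \<Rightarrow> int \<Rightarrow> real" where
  "Xi q n = (\<Prod>p\<in>prime_factors q. Xi_prime p n)"

definition sqrt4_mod :: "nat \<Rightarrow> int set" where
  "sqrt4_mod q = {t \<in> {0..<int q}. [t\<^sup>2 = 4] (mod int q)}"

definition err_r :: "imat set \<Rightarrow> real \<Rightarrow> nat \<Rightarrow> real" where
  "err_r P Q0 k =
     (\<Sum>q\<in>{q. q dvd k \<and> Q0 < real q}.
        \<Sum>t\<in>sqrt4_mod q.
          \<Sum>\<phi>\<in>P.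
            Xi q (ff \<phi> - t) *
              (\<Sum>\<tau>\<in>{\<tau> \<in> sqrt4_mod k. [\<tau> = t] (mod int q)}. rho (k div q)))"

definition err_total :: "imat set \<Rightarrow> real \<Rightarrow> real \<Rightarrow> real" where
  "err_total P Q0 Q = (\<Sum>k\<in>{k::nat. squarefree k \<and> real k < Q}. \<bar>err_r P Q0 k\<bar>)"

definition prod3 :: "imat set \<Rightarrow> imat set \<Rightarrow> imat set \<Rightarrow> imat set" where
  "prod3 R S U = {x ** y ** z | x y z. x \<in> R \<and> y \<in> S \<and> z \<in> U}"

end

theory Submission
  imports Defs
begin

text \<open>
  Writing \<open>\<phi> = x w\<close> with \<open>x \<in> \<Omega>\<^sub>X\<close> and \<open>w \<in> W = \<aleph> \<Omega>\<^sub>Z\<close>, the Cauchy--Schwarz inequality in \<open>x\<close> reduces the claim to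
  correlations of \<open>\<Xi>(q; ff(x w) - t)\<close> and \<open>\<Xi>(q'; ff(x w') - t')\<close>, summed over a majorant of \<open>\<Omega>\<^sub>X\<close>. Cutting words into
  three pieces gives the majorant \<open>x = x\<^sub>1 x\<^sub>2 x\<^sub>3\<close> with each \<open>x\<^sub>i\<close> free in a ball of \<open>SL\<^sub>2(Z)\<close> of radius about \<open>X\<^bsup>1/3\<^esup>\<close>.
  Elementary counting bounds the \<open>L\<^sup>2\<close> norms of the three distributions modulo \<open>m = lcm(q, q')\<close> by their expected size, and
  then only the norms of the operators \<open>\<nu> \<mapsto> (y \<mapsto> \<Sum>\<^sub>x\<^sub>,\<^sub>z F(x y z) \<nu>(x, z))\<close> over \<open>SL\<^sub>2(Z/m)\<close> matter. These are
  multiplicative over the primes dividing \<open>m\<close>. At a prime dividing exactly one of \<open>q, q'\<close> the level sets of \<open>ff\<close> are unions of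
  incidence conditions on the projective line, whose two-transitivity yields square root cancellation (no spectral gap is needed);
  at a prime dividing both, a Schur test suffices, with a loss only if the prime divides \<open>ff(w\<^sup>-\<^sup>1 w')\<^sup>2 - 4\<close>. When
  \<open>\<Q>\<^bsup>16\<^esup> \<ge> X\<close> the bracket exceeds one and the divisor bound is enough.
\<close>

text \<open>Otherwise every matrix entry \<open>x $ i $ j\<close> is ambiguous with a coefficient of a power series.\<close>

no_notation fps_nth (infixl "$" 75)

section \<open>The divisor function\<close>

text \<open>Why three pieces: with two factors \<open>x y\<close> an incidence condition depends
  only on a line \<open>l x\<close> and a point \<open>y v\<close>, and incidence matches lines and
  points bijectively, so the operator keeps its trivial norm. Moving the line by \<open>x\<close>
  and the point by \<open>z\<close> on the two sides of \<open>y\<close> makes most pairs of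
  conditions on \<open>y\<close> transversal, hence nearly independent; this saves one factor p in
  the squared norm, p^6 against p^7 from the Schur test. Numerology: let g and m be the gcd and lcm
  of q and q', and a the gcd of g with ff(w^-1 w')^2 - 4. Up to divisor functions the squared norm
  is g^5 a^2 (m/g)^6, and each piece has about R^4/m^3 pairs congruent modulo m, with R about
  X^(1/3). So the correlation is at most R^6 a / sqrt(g m^3) = X^2 a sqrt(g/m) / (q q'), because g m
  = q q'. As q and q' exceed Q0, sqrt(g/m) is at most g/Q0, which is where the term in Q0 comes
  from. The count R^4/m^3 needs m^3 <= R^2; as m < Q^2, this forces Q to be small against X. The
  term in Z comes from the pairs with ff(w^-1 w')^2 = 4, where w^-1 w' is an integral
  rotation.\<close>

definition divcount :: "nat \<Rightarrow> nat" where "divcount n = card {d. d dvd n}"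

lemma divcount_mult_le:
  assumes "a > 0" "b > 0"
  shows "divcount (a * b) \<le> divcount a * divcount b"
proof -
  have "{d. d dvd a * b} \<subseteq> (\<lambda>(x, y). x * y) ` ({d. d dvd a} \<times> {d. d dvd b})"
    by (force dest: dvd_productE elim: dvd_productE)
  moreover have "finite ({d. d dvd a} \<times> {d. d dvd b})"
    using assms by simp
  ultimately have "card {d. d dvd a * b} \<le> card ({d. d dvd a} \<times> {d. d dvd b})"
    by (rule surj_card_le[rotated])
  then show ?thesis by (simp add: divcount_def card_cartesian_product)
qed

lemma divcount_prime_power:
  assumes "prime p"
  shows "divcount (p ^ e) \<le> e + 1"
proof -
  have "{d. d dvd p ^ e} \<subseteq> (\<lambda>i. p ^ i) ` {..e}"
    using assms by (auto simp: divides_primepow_nat)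
  then have "card {d. d dvd p ^ e} \<le> card {..e}"
    by (rule surj_card_le[rotated]) simp
  then show ?thesis by (simp add: divcount_def)
qed

text \<open>Every prime factor p satisfies p^\<epsilon> \<ge> 2, so each one pays for the doubling
  of the divisor count that it can cause.\<close>

lemma divcount_rough:
  assumes "\<epsilon> > 0" and B: "real B \<ge> 2 powr (1 / \<epsilon>)"
  shows "n > 0 \<Longrightarrow> (\<And>p. prime p \<Longrightarrow> p dvd n \<Longrightarrow> p \<ge> B) \<Longrightarrow> real (divcount n) \<le> real n powr \<epsilon>"
proof (induction n rule: less_induct)
  case (less n)
  show ?case
  proof (cases "n = 1")
    case True then show ?thesis by (simp add: divcount_def)
  next
    case False
    then obtain p where p: "prime p" "p dvd n" using prime_factor_nat by blast
    obtain k where k: "n = p * k" using p by blast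
    have k0: "k > 0" "k < n" using less.prems k p prime_gt_1_nat[of p] by auto
    have 1: "real (divcount k) \<le> real k powr \<epsilon>"
      by (rule less.IH) (use k0 k less.prems in auto)
    have pB: "real p \<ge> 2 powr (1 / \<epsilon>)" using less.prems(2)[OF p] B by linarith
    have "2 = (2 powr (1 / \<epsilon>)) powr \<epsilon>" using assms by (simp add: powr_powr)
    also have "\<dots> \<le> real p powr \<epsilon>" using pB assms by (intro powr_mono2) auto
    finally have 2: "2 \<le> real p powr \<epsilon>" .
    have "divcount n \<le> divcount p * divcount k" unfolding k using k0 p by (intro divcount_mult_le) (auto simp: prime_gt_0_nat)
    also have "\<dots> \<le> 2 * divcount k" using divcount_prime_power[OF p(1), of 1] by simp
    finally have "real (divcount n) \<le> 2 * real (divcount k)" by linarith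
    also have "\<dots> \<le> real p powr \<epsilon> * real k powr \<epsilon>" using 1 2 by (intro mult_mono) auto
    also have "\<dots> = real n powr \<epsilon>" unfolding k by (simp add: powr_mult)
    finally show ?thesis .
  qed
qed

lemma divcount_bound_aux:
  assumes e: "\<epsilon> > 0"
  shows "\<exists>C\<ge>1. \<forall>n>0. (\<forall>p. prime p \<longrightarrow> p dvd n \<longrightarrow> B0 \<le> p + k) \<longrightarrow> real B0 \<ge> 2 powr (1 / \<epsilon>) \<longrightarrow>
     real (divcount n) \<le> C * real n powr \<epsilon>"
proof (induction k)
  case 0
  then show ?case using divcount_rough[OF e] by (intro exI[of _ 1]) auto
next
  case (Suc k)
  then obtain C where C: "C \<ge> 1" and IH: "\<And>n. n > 0 \<Longrightarrow> (\<And>p. prime p \<Longrightarrow> p dvd n \<Longrightarrow> B0 \<le> p + k) \<Longrightarrow>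
     real B0 \<ge> 2 powr (1 / \<epsilon>) \<Longrightarrow> real (divcount n) \<le> C * real n powr \<epsilon>" by blast
  \<comment> \<open>Chosen so that e + 1 \<le> M 2^(e \<epsilon>) for all e, by 1 + x \<le> exp x:
    this absorbs the e + 1 divisors of a prime power.\<close>
  define M where "M = max 1 (1 / (\<epsilon> * ln 2))"
  have M: "real e + 1 \<le> M * (2 powr (real e * \<epsilon>))" for e
  proof -
    have "1 + real e * (\<epsilon> * ln 2) \<le> exp (real e * (\<epsilon> * ln 2))" by (rule exp_ge_add_one_self)
    also have "\<dots> = 2 powr (real e * \<epsilon>)" by (simp add: powr_def mult.assoc)
    finally have 1: "1 + real e * (\<epsilon> * ln 2) \<le> 2 powr (real e * \<epsilon>)" .
    have M1: "M \<ge> 1" "M * (\<epsilon> * ln 2) \<ge> 1"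
    proof -
      show "M \<ge> 1" by (simp add: M_def)
      have pos: "\<epsilon> * ln 2 > 0" using e by simp
      have "1 / (\<epsilon> * ln 2) \<le> M" by (simp add: M_def)
      then show "M * (\<epsilon> * ln 2) \<ge> 1" using pos by (simp only: pos_divide_le_eq)
    qed
    have "real e * 1 \<le> real e * (M * (\<epsilon> * ln 2))" using M1 by (intro mult_left_mono) auto
    then have "real e + 1 \<le> M * (1 + real e * (\<epsilon> * ln 2))" using M1 by (simp add: algebra_simps)
    also have "\<dots> \<le> M * (2 powr (real e * \<epsilon>))" using 1 M1 by (intro mult_left_mono) auto
    finally show ?thesis .
  qed
  show ?case
  proof (intro exI[of _ "C * M"] conjI allI impI)
    have "M \<ge> 1" by (simp add: M_def)
    then show CM: "1 \<le> C * M" using C by (metis mult_le_one mult_mono mult_1 zero_le_one order_trans)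
    fix n :: nat
    assume n: "n > 0" and sm: "\<forall>p. prime p \<longrightarrow> p dvd n \<longrightarrow> B0 \<le> p + Suc k" and B0: "2 powr (1 / \<epsilon>) \<le> real B0"
    show "real (divcount n) \<le> C * M * real n powr \<epsilon>"
    proof (cases "\<exists>p. prime p \<and> p dvd n \<and> B0 = p + Suc k")
      case False
      then have "B0 \<le> p + k" if "prime p" "p dvd n" for p using sm that by (metis add_Suc_right le_SucE)
      then have "real (divcount n) \<le> C * real n powr \<epsilon>" using IH n B0 by blast
      also have "\<dots> \<le> C * M * real n powr \<epsilon>" using \<open>M \<ge> 1\<close> C by (intro mult_right_mono) auto
      finally show ?thesis .
    next
      case True
      then obtain p where p: "prime p" "p dvd n" "B0 = p + Suc k" by blast
      define e where "e = multiplicity p n"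
      obtain m where m: "n = p ^ e * m" "\<not> p dvd m"
        using multiplicity_decompose'[of n p] n p(1) unfolding e_def
        by (metis not_prime_unit gr_implies_not0)
      have m0: "m > 0" using m n by (cases m) auto
      have "B0 \<le> r + k" if r: "prime r" "r dvd m" for r
      proof -
        have "r \<noteq> p" using r m by auto
        moreover have "B0 \<le> r + Suc k" using sm r m by auto
        ultimately show ?thesis using p by linarith
      qed
      then have 1: "real (divcount m) \<le> C * real m powr \<epsilon>" using IH m0 B0 by blast
      have "real (divcount (p ^ e)) \<le> real e + 1" using divcount_prime_power[OF p(1), of e] by linarith
      also have "\<dots> \<le> M * (2 powr (real e * \<epsilon>))" by (rule M)
      also have "\<dots> \<le> M * (real p powr (real e * \<epsilon>))"
        using e prime_ge_2_nat[OF p(1)] \<open>M \<ge> 1\<close> by (intro mult_left_mono powr_mono2) auto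
      also have "\<dots> = M * real (p ^ e) powr \<epsilon>"
        using prime_gt_0_nat[OF p(1)] by (simp add: powr_powr flip: powr_realpow)
      finally have 2: "real (divcount (p ^ e)) \<le> M * real (p ^ e) powr \<epsilon>" .
      have "divcount n \<le> divcount (p ^ e) * divcount m" unfolding m(1) using m0 p by (intro divcount_mult_le) (auto simp: prime_gt_0_nat)
      then have "real (divcount n) \<le> real (divcount (p ^ e)) * real (divcount m)" by (metis of_nat_le_iff of_nat_mult)
      also have "\<dots> \<le> (M * real (p ^ e) powr \<epsilon>) * (C * real m powr \<epsilon>)"
        using 1 2 \<open>M \<ge> 1\<close> by (intro mult_mono) auto
      also have "\<dots> = C * M * real n powr \<epsilon>" unfolding m(1) by (simp add: powr_mult)
      finally show ?thesis .
    qed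
  qed
qed

lemma divcount_bound:
  assumes "\<epsilon> > 0"
  shows "\<exists>C\<ge>1. \<forall>n>0. real (divcount n) \<le> C * real n powr \<epsilon>"
proof -
  define B where "B = nat \<lceil>2 powr (1 / \<epsilon>)\<rceil>"
  have B: "real B \<ge> 2 powr (1 / \<epsilon>)" unfolding B_def by linarith
  \<comment> \<open>With \<open>k = B\<close> the condition \<open>B \<le> p + B\<close> holds for
    every prime.\<close>
  show ?thesis using divcount_bound_aux[OF assms, of B B] B by auto
qed

lemma sum_inverse_bound:
  assumes "\<epsilon> > 0"
  shows "\<exists>C\<ge>1. \<forall>Q\<ge>1. (\<Sum>k\<in>{k::nat. 1 \<le> k \<and> real k < Q}. 1 / real k) \<le> C * Q powr \<epsilon>"
proof -
  have fin: "finite {k::nat. 1 \<le> k \<and> real k < Q}" for Q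
    by (rule finite_subset[of _ "{..nat \<lceil>Q\<rceil>}"]) (auto simp: le_nat_iff, linarith)
  show ?thesis
  proof (intro exI[of _ "1 + 1 / \<epsilon>"] conjI allI impI)
    show "1 \<le> 1 + 1 / \<epsilon>" using assms by simp
    fix Q :: real assume Q: "1 \<le> Q"
    define n where "n = nat \<lfloor>Q\<rfloor>"
    have n1: "n \<ge> 1" "real n \<le> Q" using Q unfolding n_def by (auto simp: le_nat_floor)
    have "(\<Sum>k\<in>{k::nat. 1 \<le> k \<and> real k < Q}. 1 / real k) \<le> (\<Sum>k=1..n. 1 / real k)"
      by (intro sum_mono2) (auto simp: n_def le_nat_floor)
    also have "\<dots> \<le> 1 + ln (real n)"
      using n1(1)
    proof (induction n rule: dec_induct)
      case (step n)
      have "ln (real n / real (Suc n)) \<le> real n / real (Suc n) - 1" using step by (intro ln_le_minus_one) auto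
      then have "1 / real (Suc n) \<le> ln (real (Suc n)) - ln (real n)"
        using step by (simp add: ln_div field_simps)
      then show ?case using step by simp
    qed simp
    also have "\<dots> \<le> 1 + ln Q" using n1 by simp
    also have "ln Q \<le> Q powr \<epsilon> / \<epsilon>"
    proof -
      have "\<epsilon> * ln Q \<le> exp (\<epsilon> * ln Q)" using exp_ge_add_one_self[of "\<epsilon> * ln Q"] by linarith
      then show ?thesis using assms Q by (simp add: powr_def field_simps)
    qed
    also have "1 + Q powr \<epsilon> / \<epsilon> \<le> (1 + 1 / \<epsilon>) * Q powr \<epsilon>"
      using Q assms by (simp add: field_simps ge_one_powr_ge_zero)
    finally show "(\<Sum>k\<in>{k::nat. 1 \<le> k \<and> real k < Q}. 1 / real k) \<le> (1 + 1 / \<epsilon>) * Q powr \<epsilon>" by simp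
  qed
qed

section \<open>The Hausdorff dimension is at most one\<close>

lemma cf_trunc_bounds: "(\<And>i. 1 \<le> a i) \<Longrightarrow> cf_trunc a n \<in> {0..1}"
proof (induction n arbitrary: a)
  case (Suc n)
  have "cf_trunc (\<lambda>i. a (Suc i)) n \<in> {0..1}" using Suc by auto
  moreover have "real (a 0) \<ge> 1" using Suc.prems[of 0] by simp
  ultimately show ?case by (simp add: field_simps)
qed simp

lemma cf_set_subset: "cf_set A \<subseteq> {0..1}"
proof
  fix x assume "x \<in> cf_set A"
  then obtain a where a: "\<And>i. 1 \<le> a i" "cf_trunc a \<longlonglongrightarrow> x" by (auto simp: cf_set_def)
  then show "x \<in> {0..1}" using closed_sequentially[of "{0..1}" "cf_trunc a" x] cf_trunc_bounds[OF a(1)] by auto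
qed

text \<open>Covering by n intervals of length 1/n gives the sum n^(1-s), which tends to 0 for s >
  1.\<close>

lemma hausdorff_content_unit:
  fixes S :: "real set"
  assumes S: "S \<subseteq> {0..1}" and s: "s > 1" and r: "r > 0"
  shows "hausdorff_content s r S = 0"
proof -
  have le: "hausdorff_content s r S \<le> ennreal (real n powr (1 - s))" if n: "n > 0" "1 / real n \<le> r" for n :: nat
  proof -
    define U where "U i = (if i < n then {real i / real n .. (real i + 1) / real n} else {})" for i
    have d: "diameter (U i) = (if i < n then 1 / real n else 0)" for i
      using n by (auto simp: U_def diameter_closed_interval divide_right_mono add_divide_distrib)
    have cov: "S \<subseteq> (\<Union>i. U i)"
    proof
      fix x assume "x \<in> S"
      then have x: "0 \<le> x" "x \<le> 1" using S by auto
      show "x \<in> (\<Union>i. U i)"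
      proof (cases "x = 1")
        case True
        \<comment> \<open>The floor would give the index n here, one too many; the right endpoint
          belongs to the last interval.\<close>
        then have "x \<in> U (n - 1)" using n by (auto simp: U_def of_nat_diff)
        then show ?thesis by blast
      next
        case False
        define i where "i = nat \<lfloor>x * real n\<rfloor>"
        have "real i \<le> x * real n" "x * real n < real i + 1" using x n unfolding i_def by auto
        moreover have "x * real n < real n" using x n False by simp
        ultimately have "i < n" by linarith
        with \<open>real i \<le> x * real n\<close> \<open>x * real n < real i + 1\<close> have "x \<in> U i" using n by (simp add: U_def field_simps)
        then show ?thesis by blast
      qed
    qed
    have "bounded (U i) \<and> diameter (U i) \<le> r" for i
    proof
      show "bounded (U i)" by (simp add: U_def)
      show "diameter (U i) \<le> r" unfolding d using n r by simp
    qed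
    then have "hausdorff_content s r S \<le> (\<Sum>i. ennreal (diameter (U i) powr s))"
      unfolding hausdorff_content_def using cov by (intro INF_lower) auto
    also have "\<dots> = (\<Sum>i<n. ennreal (diameter (U i) powr s))"
      by (intro suminf_finite) (auto simp: d)
    also have "\<dots> = ennreal (\<Sum>i<n. (1 / real n) powr s)"
      by (subst sum_ennreal[symmetric]) (auto simp: d intro!: sum.cong)
    also have "(\<Sum>i<n. (1 / real n) powr s) = real n powr (1 - s)"
      using n by (simp add: powr_diff powr_divide)
    finally show ?thesis .
  qed
  have "hausdorff_content s r S \<le> ennreal e" if e: "e > 0" for e
  proof -
    have "((\<lambda>n. real n powr (1 - s)) \<longlongrightarrow> 0) at_top"
      using s by (intro tendsto_neg_powr filterlim_real_sequentially) auto
    then have "eventually (\<lambda>n. real n powr (1 - s) < e) at_top" using e by (rule order_tendstoD)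
    moreover have "eventually (\<lambda>n. 1 / real n < r) at_top"
      using r by (intro order_tendstoD[OF lim_1_over_n]) auto
    ultimately have "eventually (\<lambda>n. real n powr (1 - s) < e \<and> 1 / real n < r \<and> n > 0) at_top"
      using eventually_gt_at_top[of 0] by eventually_elim auto
    then obtain n where "real n powr (1 - s) < e" "1 / real n < r" "n > 0"
      by (metis (mono_tags, lifting) eventually_sequentially order_refl)
    then have "hausdorff_content s r S \<le> ennreal (real n powr (1 - s))" using le[of n] by auto
    also have "\<dots> \<le> ennreal e" using \<open>real n powr (1 - s) < e\<close> by (intro ennreal_leI) auto
    finally show ?thesis .
  qed
  then have "hausdorff_content s r S \<le> 0 + ennreal e" if "e > 0" for e
    using that by (simp only: add_0)
  then have "hausdorff_content s r S \<le> 0" by (rule ennreal_le_epsilon)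
  then show ?thesis by simp
qed

text \<open>Makes the exponent \<open>1 - delta A\<close> nonnegative, so that the factor
  \<open>(X * Z) powr (1 - delta A)\<close> is at least 1 and can be inserted into any upper
  bound.\<close>

lemma delta_le_1: "delta A \<le> 1"
proof -
  define T where "T = {s. 0 < s \<and> hausdorff_measure s (cf_set A) = 0}"
  have "s \<in> T" if "s > 1" for s
    using that hausdorff_content_unit[OF cf_set_subset that]
    by (auto simp: T_def hausdorff_measure_def SUP_eq_const)
  moreover have "bdd_below T" by (rule bdd_belowI[of _ 0]) (auto simp: T_def)
  ultimately have "Inf T \<le> s" if "s > 1" for s using that by (intro cInf_lower) auto
  then have "Inf T \<le> 1" by (rule dense_ge)
  then show ?thesis by (simp add: delta_def hausdorff_dim_def T_def)
qed

section \<open>Continued fraction matrices\<close>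

lemma mm_entry [simp]:
  fixes x y :: imat
  shows "(x ** y) $ i $ j = x $ i $ 1 * y $ 1 $ j + x $ i $ 2 * y $ 2 $ j"
  by (simp add: matrix_matrix_mult_def sum_2)

lemma mat1_entry [simp]:
  "(mat 1 :: imat) $ 1 $ 1 = 1" "(mat 1 :: imat) $ 1 $ 2 = 0"
  "(mat 1 :: imat) $ 2 $ 1 = 0" "(mat 1 :: imat) $ 2 $ 2 = 1"
  by (simp_all add: mat_def)

lemma imat_eq_iff:
  fixes x y :: imat
  shows "x = y \<longleftrightarrow> x $ 1 $ 1 = y $ 1 $ 1 \<and> x $ 1 $ 2 = y $ 1 $ 2 \<and> x $ 2 $ 1 = y $ 2 $ 1 \<and> x $ 2 $ 2 = y $ 2 $ 2"
  by (simp add: vec_eq_iff forall_2)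

definition mat2 :: "int \<Rightarrow> int \<Rightarrow> int \<Rightarrow> int \<Rightarrow> imat" where
  "mat2 a b c d = vector [vector [a, b], vector [c, d]]"

lemma mat2_entry [simp]: "mat2 a b c d $ 1 $ 1 = a" "mat2 a b c d $ 1 $ 2 = b" "mat2 a b c d $ 2 $ 1 = c" "mat2 a b c d $ 2 $ 2 = d"
  by (simp_all add: mat2_def)

text \<open>The adjugate: an integral inverse when the determinant is 1, with entries of the same
  size.\<close>

definition adj :: "imat \<Rightarrow> imat" where "adj y = mat2 (y$2$2) (- y$1$2) (- y$2$1) (y$1$1)"

lemma adj_entry [simp]: "adj y$1$1 = y$2$2" "adj y$1$2 = - y$1$2" "adj y$2$1 = - y$2$1" "adj y$2$2 = y$1$1"
  by (simp_all add: adj_def)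

lemma mnorm_eq: "mnorm g = sqrt (real_of_int (ff g))"
  by (simp add: mnorm_def trace_def sum_2 transpose_def ff_def power2_eq_square)

lemma entry_le_mnorm: "\<bar>real_of_int (g $ i $ j)\<bar> \<le> mnorm g"
proof -
  have "(g $ i $ j)\<^sup>2 \<le> ff g"
    using exhaust_2[of i] exhaust_2[of j] by (auto simp: ff_def)
  then have "(real_of_int (g $ i $ j))\<^sup>2 \<le> real_of_int (ff g)"
    by (metis of_int_le_iff of_int_power)
  then show ?thesis unfolding mnorm_eq by (intro real_le_rsqrt) simp
qed

lemma finite_bounded_imat: "finite {g::imat. \<forall>i j. \<bar>g $ i $ j\<bar> \<le> B}"
proof -
  have "{g::imat. \<forall>i j. \<bar>g $ i $ j\<bar> \<le> B} \<subseteq>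
    (\<lambda>(a, b, c, d). mat2 a b c d) ` ({-B..B} \<times> {-B..B} \<times> {-B..B} \<times> {-B..B})"
  proof
    fix g :: imat assume "g \<in> {g. \<forall>i j. \<bar>g $ i $ j\<bar> \<le> B}"
    then have b: "\<bar>g $ i $ j\<bar> \<le> B" for i j by simp
    have "g = mat2 (g$1$1) (g$1$2) (g$2$1) (g$2$2)"
      by (simp add: imat_eq_iff)
    then have "g = (case (g$1$1, g$1$2, g$2$1, g$2$2) of (a, b, c, d) \<Rightarrow> mat2 a b c d)" by simp
    moreover have "g $ i $ j \<in> {-B..B}" for i j using b[of i j] by auto
    ultimately show "g \<in> (\<lambda>(a, b, c, d). mat2 a b c d) ` ({-B..B} \<times> {-B..B} \<times> {-B..B} \<times> {-B..B})"
      unfolding image_iff by (intro bexI[of _ "(g$1$1, g$1$2, g$2$1, g$2$2)"]) blast+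
  qed
  then show ?thesis by (rule finite_subset) auto
qed

lemma finite_norm_ball: "finite (norm_ball X)"
proof (rule finite_subset[OF _ finite_bounded_imat[of "\<lceil>X\<rceil>"]], safe)
  fix g :: imat and i j assume "g \<in> norm_ball X"
  then have "\<bar>real_of_int (g $ i $ j)\<bar> \<le> X" using entry_le_mnorm[of g i j] by (simp add: norm_ball_def)
  then show "\<bar>g $ i $ j\<bar> \<le> \<lceil>X\<rceil>" by linarith
qed

section \<open>Words as matrices, and their unique factorization\<close>

lemma word_mat_Nil [simp]: "word_mat [] = mat 1"
  and word_mat_Cons [simp]: "word_mat (a # ws) = cf_gen a ** word_mat ws"
  by (simp_all add: word_mat_def)

lemma cf_gen_entry [simp]: "cf_gen a $ 1 $ 1 = int a" "cf_gen a $ 1 $ 2 = 1" "cf_gen a $ 2 $ 1 = 1" "cf_gen a $ 2 $ 2 = 0"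
  by (simp_all add: cf_gen_def)

lemma word_mat_append: "word_mat (u @ v) = word_mat u ** word_mat v"
proof (induction u)
  case (Cons a u)
  then show ?case by (simp add: matrix_mul_assoc del: mm_entry)
qed simp

lemma det_word_mat: "det (word_mat ws) = (-1) ^ length ws"
proof (induction ws)
  case (Cons a ws)
  have "det (cf_gen a) = -1" by (simp add: det_2)
  then show ?case using Cons by (simp add: det_mul)
qed simp

text \<open>Prepending a letter moves the first row down and puts a larger row on top. The upper
  left entry (the corner) therefore dominates and serves as the size of a word from here on.\<close>

lemma word_mat_shape:
  assumes "set ws \<subseteq> {1..}" "ws \<noteq> []"
  defines "M \<equiv> word_mat ws"
  shows "1 \<le> M $ 1 $ 2" "M $ 1 $ 2 \<le> M $ 1 $ 1" "M $ 2 $ 1 \<le> M $ 1 $ 1" "M $ 2 $ 2 \<le> M $ 2 $ 1" "M $ 2 $ 2 \<le> M $ 1 $ 2"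
    "0 \<le> M $ 2 $ 2" "1 \<le> M $ 2 $ 1"
proof -
  have "1 \<le> M $ 1 $ 2 \<and> M $ 1 $ 2 \<le> M $ 1 $ 1 \<and> M $ 2 $ 1 \<le> M $ 1 $ 1 \<and> M $ 2 $ 2 \<le> M $ 2 $ 1 \<and> M $ 2 $ 2 \<le> M $ 1 $ 2
    \<and> 0 \<le> M $ 2 $ 2 \<and> 1 \<le> M $ 2 $ 1"
    using assms(1,2) unfolding M_def
  proof (induction ws)
    case (Cons a ws)
    show ?case
    proof (cases "ws = []")
      case True
      then show ?thesis using Cons.prems by simp
    next
      case False
      define N where "N = word_mat ws"
      have IH: "1 \<le> N $ 1 $ 2 \<and> N $ 1 $ 2 \<le> N $ 1 $ 1 \<and> N $ 2 $ 1 \<le> N $ 1 $ 1 \<and> N $ 2 $ 2 \<le> N $ 2 $ 1 \<and> N $ 2 $ 2 \<le> N $ 1 $ 2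
    \<and> 0 \<le> N $ 2 $ 2 \<and> 1 \<le> N $ 2 $ 1" using Cons.IH Cons.prems False unfolding N_def by simp
      have a: "int a \<ge> 1" using Cons.prems by simp
      have 1: "N$1$1 \<le> int a * N$1$1" "N$1$2 \<le> int a * N$1$2"
        using mult_right_mono[OF a, of "N$1$1"] mult_right_mono[OF a, of "N$1$2"] IH by linarith+
      have 2: "int a * N$1$2 \<le> int a * N$1$1" using IH a by (auto intro: mult_left_mono)
      have 3: "word_mat (a # ws) $ 1 $ 1 = int a * N$1$1 + N$2$1" "word_mat (a # ws) $ 1 $ 2 = int a * N$1$2 + N$2$2"
        "word_mat (a # ws) $ 2 $ 1 = N$1$1" "word_mat (a # ws) $ 2 $ 2 = N$1$2" by (simp_all add: N_def)
      show ?thesis unfolding 3 using IH 1 2 by (intro conjI; linarith)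
    qed
  qed simp
  then show "1 \<le> M $ 1 $ 2" "M $ 1 $ 2 \<le> M $ 1 $ 1" "M $ 2 $ 1 \<le> M $ 1 $ 1" "M $ 2 $ 2 \<le> M $ 2 $ 1" "M $ 2 $ 2 \<le> M $ 1 $ 2"
    "0 \<le> M $ 2 $ 2" "1 \<le> M $ 2 $ 1" by auto
qed

lemma word_mat_nonneg:
  assumes "set ws \<subseteq> {1..}"
  shows "1 \<le> word_mat ws $ 1 $ 1" "0 \<le> word_mat ws $ 1 $ 2" "0 \<le> word_mat ws $ 2 $ 1" "0 \<le> word_mat ws $ 2 $ 2"
    "word_mat ws $ 1 $ 2 \<le> word_mat ws $ 1 $ 1" "word_mat ws $ 2 $ 1 \<le> word_mat ws $ 1 $ 1"
    "word_mat ws $ 2 $ 2 \<le> word_mat ws $ 1 $ 1"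
  by (cases "ws = []"; use word_mat_shape[OF assms] in force)+

text \<open>Equality would force the second row of \<open>word_mat u\<close> to be at least its
  first row plus the second row of \<open>word_mat v\<close>. As the first row dominates the second,
  the second row of \<open>word_mat v\<close> would vanish, against determinant
  \<plusminus>1.\<close>

lemma word_mat_neq:
  assumes "set u \<subseteq> {1..}" "set v \<subseteq> {1..}" "a < b"
  shows "cf_gen a ** word_mat u \<noteq> cf_gen b ** word_mat v"
proof
  define M N where "M = word_mat u" and "N = word_mat v"
  assume "cf_gen a ** word_mat u = cf_gen b ** word_mat v"
  then have e: "M$1$1 = N$1$1" "M$1$2 = N$1$2" "int a * M$1$1 + M$2$1 = int b * M$1$1 + N$2$1"
    "int a * M$1$2 + M$2$2 = int b * M$1$2 + N$2$2"
    unfolding imat_eq_iff M_def N_def by auto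
  have "M$2$1 = (int b - int a) * M$1$1 + N$2$1" "M$2$2 = (int b - int a) * M$1$2 + N$2$2"
    using e by (auto simp: algebra_simps)
  moreover have "1 * M$1$1 \<le> (int b - int a) * M$1$1" "1 * M$1$2 \<le> (int b - int a) * M$1$2"
    using assms word_mat_nonneg[OF assms(1)] unfolding M_def by (auto intro!: mult_right_mono simp del: mult_1)
  ultimately have g: "M$2$1 \<ge> M$1$1 + N$2$1" "M$2$2 \<ge> M$1$2 + N$2$2" by auto
  show False
  proof (cases "u = []")
    case True
    then show False using g word_mat_nonneg[OF assms(2)] by (simp add: M_def N_def)
  next
    case False
    have "N$2$1 = 0" "N$2$2 = 0"
      using g word_mat_shape[OF assms(1) False] word_mat_nonneg[OF assms(2)] unfolding M_def N_def by linarith+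
    then have "det N = 0" by (simp add: det_2)
    then show False by (simp add: N_def det_word_mat)
  qed
qed

text \<open>Freeness: \<open>word_mat_neq\<close> recovers the first letter, and
  \<open>cf_gen a\<close> can be cancelled because it only combines rows invertibly.\<close>

lemma word_mat_inj:
  assumes "set u \<subseteq> {1..}" "set v \<subseteq> {1..}" "word_mat u = word_mat v"
  shows "u = v"
  using assms
proof (induction u arbitrary: v)
  case Nil
  show ?case
  proof (cases v)
    case (Cons b v')
    then have "word_mat v' $ 1 $ 1 = 0" using Nil.prems by (simp add: imat_eq_iff)
    then show ?thesis using word_mat_nonneg(1)[of v'] Nil.prems Cons by simp
  qed simp
next
  case (Cons a u)
  show ?case
  proof (cases v)
    case Nil
    then have "word_mat u $ 1 $ 1 = 0" using Cons.prems by (simp add: imat_eq_iff)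
    then show ?thesis using word_mat_nonneg(1)[of u] Cons.prems by simp
  next
    case v: (Cons b v')
    have eq: "cf_gen a ** word_mat u = cf_gen b ** word_mat v'" using Cons.prems v by simp
    have su: "set u \<subseteq> {1..}" "set v' \<subseteq> {1..}" using Cons.prems v by auto
    have ab: "a = b"
      using word_mat_neq[OF su, of a b] word_mat_neq[OF su(2,1), of b a] eq by (metis linorder_neqE_nat)
    have "word_mat u = word_mat v'" using eq unfolding ab imat_eq_iff by auto
    then show ?thesis using Cons.IH su ab v by blast
  qed
qed

text \<open>The majorant: it keeps from an even word only determinant 1, the signs and the dominance
  of the corner, and forgets the bound on the partial quotients. What remains is a piece of a ball
  in SL_2(Z), where counting modulo m is elementary.\<close>

definition Ybox :: "real \<Rightarrow> imat set" where
  "Ybox R = {y. det y = 1 \<and> 0 \<le> y$1$2 \<and> y$1$2 \<le> y$1$1 \<and> 0 \<le> y$2$1 \<and> y$2$1 \<le> y$1$1 \<and>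
     0 \<le> y$2$2 \<and> y$2$2 \<le> y$1$1 \<and> real_of_int (y$1$1) \<le> R}"

lemma word_in_Ybox:
  assumes "set ws \<subseteq> {1..}" "even (length ws)" "real_of_int (word_mat ws $ 1 $ 1) \<le> R"
  shows "word_mat ws \<in> Ybox R"
  using assms word_mat_nonneg[OF assms(1)] by (simp add: Ybox_def det_word_mat)

text \<open>\<open>v\<close> is the longest prefix of even length with corner at most
  \<open>L\<close>. Two more letters multiply the corner by at most (A + 1)^2 and pass
  \<open>L\<close>, so the corner of \<open>v\<close> is at least L / (A + 1)^2 unless
  \<open>w\<close> is empty; corners are supermultiplicative because all entries are nonnegative.
  Even lengths keep both determinants equal to 1.\<close>

lemma word_split:
  assumes s: "set u \<subseteq> {1..A}" and ev: "even (length u)" and L: "L \<ge> (1::real)"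
  shows "\<exists>v w. u = v @ w \<and> even (length v) \<and> even (length w) \<and> real_of_int (word_mat v $ 1 $ 1) \<le> L
    \<and> (w = [] \<or> real_of_int (word_mat w $ 1 $ 1) * L \<le> (real A + 1)\<^sup>2 * real_of_int (word_mat u $ 1 $ 1))"
proof -
  define S where "S = {n. even n \<and> n \<le> length u \<and> real_of_int (word_mat (take n u) $ 1 $ 1) \<le> L}"
  have fin: "finite S" unfolding S_def by (rule finite_subset[of _ "{..length u}"]) auto
  have "0 \<in> S" using L by (simp add: S_def)
  define n where "n = Max S"
  have nS: "n \<in> S" unfolding n_def using fin \<open>0 \<in> S\<close> by (intro Max_in) auto
  have n: "even n" "n \<le> length u" "real_of_int (word_mat (take n u) $ 1 $ 1) \<le> L" using nS by (auto simp: S_def)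
  define v w where "v = take n u" and "w = drop n u"
  have uvw: "u = v @ w" by (simp add: v_def w_def)
  have sv: "set v \<subseteq> {1..}" "set w \<subseteq> {1..}" "set w \<subseteq> {1..A}" using s uvw by auto
  have "real_of_int (word_mat w $ 1 $ 1) * L \<le> (real A + 1)\<^sup>2 * real_of_int (word_mat u $ 1 $ 1)" if "w \<noteq> []"
  proof -
    have "even (length w)" using ev n by (simp add: w_def)
    with that obtain a b w' where w: "w = a # b # w'"
      by (cases w; cases "tl w") auto
    \<comment> \<open>Maximality of \<open>n\<close> among even lengths, hence the step of two
      letters.\<close>
    have "n + 2 \<notin> S" using Max_ge[OF fin, of "n + 2"] unfolding n_def by fastforce
    moreover have len: "length u = n + 2 + length w'" using n(2) w unfolding w_def
      by (metis (no_types) add.assoc add_2_eq_Suc le_add_diff_inverse length_Cons length_drop)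
    moreover have tk: "take (n + 2) u = v @ [a, b]"
      unfolding take_add using w by (simp add: v_def w_def[symmetric])
    ultimately have big: "L < real_of_int (word_mat (v @ [a, b]) $ 1 $ 1)"
      using n(1) unfolding S_def by auto
    define M where "M = word_mat v"
    have ab: "a \<le> A" "b \<le> A" using sv w by auto
    have M: "1 \<le> M$1$1" "0 \<le> M$1$2" "M$1$2 \<le> M$1$1" using word_mat_nonneg[OF sv(1)] by (auto simp: M_def)
    have "word_mat (v @ [a, b]) $ 1 $ 1 = M$1$1 * (int a * int b + 1) + M$1$2 * int b"
      by (simp add: word_mat_append M_def algebra_simps)
    also have "\<dots> \<le> M$1$1 * (int A * int A + 1) + M$1$1 * int A"
      using M ab by (intro add_mono mult_mono) auto
    also have "\<dots> \<le> M$1$1 * (int A + 1)\<^sup>2" using M by (simp add: power2_eq_square algebra_simps)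
    finally have "real_of_int (word_mat (v @ [a, b]) $ 1 $ 1) \<le> real_of_int (M$1$1 * (int A + 1)\<^sup>2)"
      by linarith
    then have 1: "L \<le> real_of_int (M$1$1) * (real A + 1)\<^sup>2" using big by simp
    have "M$1$1 * word_mat w $ 1 $ 1 \<le> word_mat u $ 1 $ 1"
      using M word_mat_nonneg[OF sv(2)] unfolding uvw by (simp add: word_mat_append M_def)
    then have 2: "real_of_int (M$1$1) * real_of_int (word_mat w $ 1 $ 1) \<le> real_of_int (word_mat u $ 1 $ 1)"
      by (metis of_int_le_iff of_int_mult)
    have "real_of_int (word_mat w $ 1 $ 1) * L \<le> real_of_int (word_mat w $ 1 $ 1) * (real_of_int (M$1$1) * (real A + 1)\<^sup>2)"
      using 1 word_mat_nonneg(1)[OF sv(2)] by (intro mult_left_mono) auto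
    also have "\<dots> = (real A + 1)\<^sup>2 * (real_of_int (M$1$1) * real_of_int (word_mat w $ 1 $ 1))" by (simp add: mult_ac)
    also have "\<dots> \<le> (real A + 1)\<^sup>2 * real_of_int (word_mat u $ 1 $ 1)" using 2 by (intro mult_left_mono) auto
    finally show ?thesis .
  qed
  moreover have "even (length v)" "even (length w)" using n ev by (simp_all add: v_def w_def)
  moreover have "real_of_int (word_mat v $ 1 $ 1) \<le> L" using n by (simp add: v_def)
  ultimately show ?thesis using uvw by blast
qed

text \<open>Splitting twice at L = X^(1/3) leaves a third piece of size at most (A + 1)^4 X / L^2;
  this is the origin of the constant in \<open>R\<close>.\<close>

lemma Gamma_split3:
  assumes x: "x \<in> Gamma_sg A" "x \<in> norm_ball X" and X: "X \<ge> 1"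
  defines "R \<equiv> (real A + 1) ^ 4 * X powr (1 / 3)"
  shows "\<exists>a\<in>Ybox R. \<exists>b\<in>Ybox R. \<exists>c\<in>Ybox R. x = a ** b ** c"
proof -
  obtain u where u: "even (length u)" "set u \<subseteq> {1..A}" "x = word_mat u"
    using x by (auto simp: Gamma_sg_def has_word_length_def)
  have ux: "real_of_int (word_mat u $ 1 $ 1) \<le> X"
    using entry_le_mnorm[of x 1 1] x unfolding u(3) norm_ball_def by auto
  define L where "L = X powr (1 / 3)"
  have L1: "L \<ge> 1" unfolding L_def using X by (simp add: ge_one_powr_ge_zero)
  have L3: "L * L * L = X" unfolding L_def using X by (simp flip: powr_add)
  define K where "K = (real A + 1)\<^sup>2"
  have K1: "K \<ge> 1" unfolding K_def by simp
  have R: "R = K * K * L" unfolding R_def K_def L_def by (simp add: power2_eq_square power4_eq_xxxx mult_ac)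
  have KL: "L \<le> R" 
  proof -
    have "1 * 1 \<le> K * K" using K1 by (intro mult_mono) auto
    then have "1 * L \<le> K * K * L" using L1 by (intro mult_right_mono) auto
    then show ?thesis by (simp add: R)
  qed
  obtain v w where vw: "u = v @ w" "even (length v)" "even (length w)" "real_of_int (word_mat v $ 1 $ 1) \<le> L"
    "w = [] \<or> real_of_int (word_mat w $ 1 $ 1) * L \<le> K * real_of_int (word_mat u $ 1 $ 1)"
    using word_split[OF u(2,1) L1] unfolding K_def by blast
  have sw: "set v \<subseteq> {1..A}" "set w \<subseteq> {1..A}" using u vw by auto
  obtain y z where yz: "w = y @ z" "even (length y)" "even (length z)" "real_of_int (word_mat y $ 1 $ 1) \<le> L"
    "z = [] \<or> real_of_int (word_mat z $ 1 $ 1) * L \<le> K * real_of_int (word_mat w $ 1 $ 1)"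
    using word_split[OF sw(2) vw(3) L1] unfolding K_def by blast
  have sz: "set y \<subseteq> {1..A}" "set z \<subseteq> {1..A}" using sw yz by auto
  have zR: "real_of_int (word_mat z $ 1 $ 1) \<le> R"
  proof (cases "z = []")
    case True then show ?thesis using L1 KL by simp
  next
    case False
    then have 1: "real_of_int (word_mat z $ 1 $ 1) * L \<le> K * real_of_int (word_mat w $ 1 $ 1)"
      and 2: "real_of_int (word_mat w $ 1 $ 1) * L \<le> K * real_of_int (word_mat u $ 1 $ 1)" using vw yz by auto
    have "real_of_int (word_mat z $ 1 $ 1) * L * L \<le> K * real_of_int (word_mat w $ 1 $ 1) * L"
      using 1 L1 by (intro mult_right_mono) auto
    also have "\<dots> \<le> K * (K * real_of_int (word_mat u $ 1 $ 1))" using 2 K1 by (simp add: mult.assoc)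
    also have "\<dots> \<le> K * (K * X)" using ux K1 by (intro mult_left_mono) auto
    also have "\<dots> = R * L * L" unfolding R L3[symmetric] by (simp add: mult_ac)
    finally show ?thesis using L1 by simp
  qed
  have "x = word_mat v ** word_mat y ** word_mat z"
    unfolding u(3) vw(1) yz(1) by (simp add: word_mat_append matrix_mul_assoc)
  moreover have "word_mat v \<in> Ybox R" "word_mat y \<in> Ybox R" "word_mat z \<in> Ybox R"
    using vw yz sw sz KL zR by (auto intro!: word_in_Ybox)
  ultimately show ?thesis by blast
qed

section \<open>Pairs of matrices congruent modulo \<open>m\<close>\<close>

definition mat_cong :: "nat \<Rightarrow> imat \<Rightarrow> imat \<Rightarrow> bool" where
  "mat_cong m x y \<longleftrightarrow> (\<forall>i j. [x $ i $ j = y $ i $ j] (mod int m))"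

lemma YboxD:
  assumes "y \<in> Ybox R"
  shows "y$1$1 * y$2$2 - y$1$2 * y$2$1 = 1" "1 \<le> y$1$1" "0 \<le> y$1$2" "y$1$2 \<le> y$1$1" "0 \<le> y$2$1" "y$2$1 \<le> y$1$1"
    "0 \<le> y$2$2" "y$2$2 \<le> y$1$1" "real_of_int (y$1$1) \<le> R"
proof -
  show d: "y$1$1 * y$2$2 - y$1$2 * y$2$1 = 1" and e: "0 \<le> y$1$2" "y$1$2 \<le> y$1$1" "0 \<le> y$2$1" "y$2$1 \<le> y$1$1"
    "0 \<le> y$2$2" "y$2$2 \<le> y$1$1" "real_of_int (y$1$1) \<le> R"
    using assms by (auto simp: Ybox_def det_2)
  show "1 \<le> y$1$1"
  proof (rule ccontr)
    assume "\<not> 1 \<le> y$1$1"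
    then have "y$1$1 = 0" "y$1$2 = 0" using e by linarith+
    then show False using d by simp
  qed
qed

lemma Ybox_entry: "y \<in> Ybox R \<Longrightarrow> 0 \<le> y$i$j \<and> real_of_int (y$i$j) \<le> R"
  using YboxD[of y R] exhaust_2[of i] exhaust_2[of j] by fastforce

lemma finite_Ybox: "finite (Ybox R)"
proof (rule finite_subset[OF _ finite_bounded_imat[of "\<lceil>R\<rceil>"]], safe)
  fix y i j assume "y \<in> Ybox R"
  then show "\<bar>y $ i $ j\<bar> \<le> \<lceil>R\<rceil>" using Ybox_entry[of y R i j] by linarith
qed

lemma int_eq_of_dvd_diff:
  fixes a b n :: int
  assumes "n dvd a - b" "\<bar>a - b\<bar> < n"
  shows "a = b"
  using assms zdvd_imp_le[of n "\<bar>a - b\<bar>"] by fastforce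

lemma det_bound:
  fixes A B a b :: int and R :: real
  assumes "0 \<le> A" "A \<le> R" "0 \<le> B" "B \<le> R" "0 \<le> a" "a \<le> R" "0 \<le> b" "b \<le> R"
  shows "real_of_int \<bar>A * b - a * B\<bar> \<le> R\<^sup>2"
proof -
  have "real_of_int A * b \<le> R * R" "real_of_int a * B \<le> R * R" "real_of_int A * b \<ge> 0" "real_of_int a * B \<ge> 0"
    using assms by (auto intro!: mult_mono)
  then show ?thesis by (simp add: power2_eq_square abs_if)
qed

text \<open>Fix \<open>z\<close> in \<open>V\<close> with the largest corner and let
  \<open>h y\<close> be the determinant of the first rows of \<open>z\<close> and \<open>y\<close>.
  The first row of \<open>z\<close> is primitive, so \<open>h y\<close> fixes the first row of
  \<open>y\<close> up to multiples of it, and the corner, lying between 1 and that of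
  \<open>z\<close>, removes this freedom. The second row is then fixed modulo the first, up to one
  Boolean. The bound for \<open>\<bar>h\<bar> * \<bar>w$i$j\<bar>\<close> is Cramer's rule:
  \<open>h y\<close> times an entry of \<open>w\<close> is a determinant made of entries of
  \<open>z\<close>, \<open>y\<close>, \<open>z ** w\<close> and \<open>y ** w\<close>, all at most
  \<open>R\<close>. So a large \<open>w\<close> admits few \<open>y\<close>, about R^2 /
  |w|.\<close>

lemma strip_count:
  assumes V: "V \<subseteq> Ybox R" "\<And>y. y \<in> V \<Longrightarrow> y ** w \<in> Ybox R"
  shows "card V \<le> 2 * card {h::int. real_of_int \<bar>h\<bar> \<le> R\<^sup>2 \<and> (\<forall>i j. real_of_int (\<bar>h\<bar> * \<bar>w$i$j\<bar>) \<le> R\<^sup>2)}"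
    (is "_ \<le> 2 * card ?H")
proof (cases "V = {}")
  case False
  have finV: "finite V" using V(1) finite_Ybox finite_subset by blast
  obtain z where z: "z \<in> V" "\<And>y. y \<in> V \<Longrightarrow> y$1$1 \<le> z$1$1"
  proof -
    have "Max ((\<lambda>y. y$1$1) ` V) \<in> (\<lambda>y. y$1$1) ` V" using finV False by (intro Max_in) auto
    then obtain z where "z \<in> V" "z$1$1 = Max ((\<lambda>y. y$1$1) ` V)" by auto
    then show ?thesis using finV by (intro that[of z]) auto
  qed
  define h where "h y = z$1$1 * y$1$2 - y$1$1 * z$1$2" for y :: imat
  define g where "g y = (h y, y$2$1 = y$1$1)" for y :: imat
  have zY: "z \<in> Ybox R" using z V by auto
  have finH: "finite ?H"
    by (rule finite_subset[of _ "{-\<lceil>R\<^sup>2\<rceil>..\<lceil>R\<^sup>2\<rceil>}"]) (auto, linarith+)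
  have hH: "h y \<in> ?H" if y: "y \<in> V" for y
  proof -
    have yY: "y \<in> Ybox R" using y V by auto
    have 1: "real_of_int \<bar>h y\<bar> \<le> R\<^sup>2" unfolding h_def
      using Ybox_entry[OF zY] Ybox_entry[OF yY] by (intro det_bound) auto
    have "real_of_int (\<bar>h y\<bar> * \<bar>w$i$j\<bar>) \<le> R\<^sup>2" for i j
    proof -
      define e f where "e = (z ** w)$1$j" and "f = (y ** w)$1$j"
      have ef: "0 \<le> e" "e \<le> R" "0 \<le> f" "f \<le> R"
        using Ybox_entry[OF V(2)[OF y], of 1 j] Ybox_entry[OF V(2)[OF z(1)], of 1 j] by (auto simp: e_def f_def)
      have "h y * w$2$j = z$1$1 * f - y$1$1 * e" "h y * w$1$j = e * y$1$2 - f * z$1$2"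
        by (simp_all add: h_def e_def f_def algebra_simps)
      moreover have "real_of_int \<bar>z$1$1 * f - y$1$1 * e\<bar> \<le> R\<^sup>2" "real_of_int \<bar>e * y$1$2 - f * z$1$2\<bar> \<le> R\<^sup>2"
        using ef Ybox_entry[OF zY] Ybox_entry[OF yY] by (intro det_bound; auto)+
      ultimately have "real_of_int \<bar>h y * w$2$j\<bar> \<le> R\<^sup>2" "real_of_int \<bar>h y * w$1$j\<bar> \<le> R\<^sup>2" by auto
      then show ?thesis using exhaust_2[of i] by (auto simp: abs_mult)
    qed
    then show ?thesis using 1 by simp
  qed
  have "inj_on g V"
  proof (rule inj_onI)
    fix x y assume x: "x \<in> V" and y: "y \<in> V" and gxy: "g x = g y"
    have xY: "x \<in> Ybox R" and yY: "y \<in> Ybox R" using x y V by auto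
    have k: "(x$1$1 - y$1$1) * z$1$2 = z$1$1 * (x$1$2 - y$1$2)"
      using gxy by (simp add: g_def h_def algebra_simps)
    \<comment> \<open>Inserting det z = 1 turns primitivity of the first row of \<open>z\<close>
      into divisibility by its corner.\<close>
    have "x$1$1 - y$1$1 = (z$1$1 * z$2$2 - z$1$2 * z$2$1) * (x$1$1 - y$1$1)"
      unfolding YboxD(1)[OF zY] by simp
    also have "\<dots> = z$1$1 * z$2$2 * (x$1$1 - y$1$1) - z$2$1 * ((x$1$1 - y$1$1) * z$1$2)"
      by (simp add: algebra_simps)
    also have "\<dots> = z$1$1 * (z$2$2 * (x$1$1 - y$1$1) - z$2$1 * (x$1$2 - y$1$2))"
      unfolding k by (simp add: algebra_simps)
    finally have "x$1$1 - y$1$1 = z$1$1 * (z$2$2 * (x$1$1 - y$1$1) - z$2$1 * (x$1$2 - y$1$2))" .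
    then have "z$1$1 dvd x$1$1 - y$1$1" by (metis dvd_triv_left)
    moreover have "\<bar>x$1$1 - y$1$1\<bar> < z$1$1"
      using z(2)[OF x] z(2)[OF y] YboxD(2)[OF xY] YboxD(2)[OF yY] by linarith
    ultimately have a: "x$1$1 = y$1$1" by (rule int_eq_of_dvd_diff)
    have b: "x$1$2 = y$1$2" using gxy a YboxD(2)[OF zY] by (simp add: g_def h_def)
    have k: "x$1$2 * (x$2$1 - y$2$1) = x$1$1 * (x$2$2 - y$2$2)"
      using YboxD(1)[OF xY] YboxD(1)[OF yY] a b by (simp add: algebra_simps)
    have "x$2$1 - y$2$1 = (x$1$1 * x$2$2 - x$1$2 * x$2$1) * (x$2$1 - y$2$1)"
      unfolding YboxD(1)[OF xY] by simp
    also have "\<dots> = x$1$1 * x$2$2 * (x$2$1 - y$2$1) - x$2$1 * (x$1$2 * (x$2$1 - y$2$1))"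
      by (simp add: algebra_simps)
    also have "\<dots> = x$1$1 * (x$2$2 * (x$2$1 - y$2$1) - x$2$1 * (x$2$2 - y$2$2))"
      unfolding k by (simp add: algebra_simps)
    finally have "x$2$1 - y$2$1 = x$1$1 * (x$2$2 * (x$2$1 - y$2$1) - x$2$1 * (x$2$2 - y$2$2))" .
    then have dv: "x$1$1 dvd x$2$1 - y$2$1" by (metis dvd_triv_left)
    have c: "x$2$1 = y$2$1"
    \<comment> \<open>In the closed range from 0 to the corner only the two endpoints share a
      residue; the Boolean component of \<open>g\<close> tells them apart.\<close>
    proof (cases "x$2$1 = x$1$1")
      case True
      then show ?thesis using gxy a by (simp add: g_def)
    next
      case False
      then have "y$2$1 \<noteq> y$1$1" using gxy by (simp add: g_def)
      then have "\<bar>x$2$1 - y$2$1\<bar> < x$1$1"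
        using False YboxD[OF xY] YboxD[OF yY] a by linarith
      then show ?thesis using dv int_eq_of_dvd_diff by blast
    qed
    have "x$1$1 * x$2$2 = x$1$1 * y$2$2" using YboxD(1)[OF xY] YboxD(1)[OF yY] unfolding a b c by linarith
    then have "x$2$2 = y$2$2" using YboxD(2)[OF xY] by simp
    then show "x = y" using a b c by (simp add: imat_eq_iff)
  qed
  moreover have "g ` V \<subseteq> ?H \<times> UNIV" using hH by (auto simp: g_def)
  ultimately have "card V \<le> card (?H \<times> (UNIV :: bool set))"
    using finH by (intro card_inj_on_le[of g]) auto
  also have "\<dots> = 2 * card ?H" by (simp add: card_cartesian_product)
  finally show ?thesis .
qed simp

section \<open>Matrices of determinant 1 congruent to the identity\<close>

lemma card_int_cong_le:
  fixes B :: real and M :: nat and r :: int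
  assumes "B \<ge> 0" "M \<ge> 1"
  shows "finite {x::int. \<bar>x\<bar> \<le> B \<and> [x = r] (mod int M)}"
    "real (card {x::int. \<bar>x\<bar> \<le> B \<and> [x = r] (mod int M)}) \<le> 2 * B / real M + 1"
proof -
  define S where "S = {x::int. \<bar>x\<bar> \<le> B \<and> [x = r] (mod int M)}"
  define lo hi where "lo = \<lceil>(- B - r) / real M\<rceil>" and "hi = \<lfloor>(B - r) / real M\<rfloor>"
  have sub: "S \<subseteq> (\<lambda>k. r + int M * k) ` {lo..hi}"
  proof
    fix x assume "x \<in> S"
    then have "int M dvd x - r" and x: "- B \<le> x" "x \<le> B" by (auto simp: S_def cong_iff_dvd_diff)
    then obtain k where "x - r = int M * k" by blast
    then have k: "x = r + int M * k" by simp
    have "(- B - r) / real M \<le> real_of_int k" "real_of_int k \<le> (B - r) / real M"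
      using x assms unfolding k by (auto simp: field_simps)
    then have "k \<in> {lo..hi}" unfolding lo_def hi_def by (auto simp: ceiling_le_iff le_floor_iff)
    then show "x \<in> (\<lambda>k. r + int M * k) ` {lo..hi}" using k by auto
  qed
  then show "finite {x::int. \<bar>x\<bar> \<le> B \<and> [x = r] (mod int M)}"
    using finite_subset unfolding S_def by blast
  have "real (card S) \<le> real (card {lo..hi})"
    using surj_card_le[OF _ sub] by simp
  also have "\<dots> \<le> max 0 (real_of_int (hi - lo + 1))" by simp
  also have "\<dots> \<le> 2 * B / real M + 1"
  proof -
    have "real_of_int hi - real_of_int lo \<le> (B - r) / real M - (- B - r) / real M"
      unfolding lo_def hi_def by linarith
    also have "\<dots> = 2 * B / real M" unfolding diff_divide_distrib[symmetric] by simp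
    finally show ?thesis using assms by simp
  qed
  finally show "real (card {x::int. \<bar>x\<bar> \<le> B \<and> [x = r] (mod int M)}) \<le> 2 * B / real M + 1" by (simp add: S_def)
qed

lemma card_int_divisors:
  fixes n :: int
  assumes "n \<noteq> 0"
  shows "finite {b. b dvd n}" "card {b. b dvd n} \<le> 2 * divcount (nat \<bar>n\<bar>)"
proof -
  show fin: "finite {b. b dvd n}" using assms by simp
  have "{b. b dvd n} \<subseteq> (\<lambda>(s, d). s * int d) ` ({1, -1} \<times> {d. d dvd nat \<bar>n\<bar>})"
  proof
    fix b assume "b \<in> {b. b dvd n}"
    then have "nat \<bar>b\<bar> dvd nat \<bar>n\<bar>" by (simp add: nat_dvd_iff)
    moreover have "b = (if b \<ge> 0 then 1 else -1) * int (nat \<bar>b\<bar>)" by simp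
    ultimately show "b \<in> (\<lambda>(s, d). s * int d) ` ({1, -1} \<times> {d. d dvd nat \<bar>n\<bar>})"
      by (intro image_eqI[of _ _ "(if b \<ge> 0 then 1 else -1, nat \<bar>b\<bar>)"]) auto
  qed
  then have "card {b. b dvd n} \<le> card ({1, -1 :: int} \<times> {d. d dvd nat \<bar>n\<bar>})"
    using assms by (intro surj_card_le finite_cartesian_product finite_divisors_nat) auto
  then show "card {b. b dvd n} \<le> 2 * divcount (nat \<bar>n\<bar>)"
    by (simp add: card_cartesian_product divcount_def)
qed

definition cong_id_box :: "nat \<Rightarrow> real \<Rightarrow> imat set" where
  "cong_id_box m V = {w. det w = 1 \<and> mat_cong m w (mat 1) \<and> (\<forall>i j. real_of_int \<bar>w$i$j\<bar> \<le> V)}"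

lemma finite_cong_id_box: "finite (cong_id_box m V)"
proof (rule finite_subset[OF _ finite_bounded_imat[of "\<lceil>V\<rceil>"]], safe)
  fix w i j assume "w \<in> cong_id_box m V"
  then have "real_of_int \<bar>w $ i $ j\<bar> \<le> V" by (simp add: cong_id_box_def)
  then show "\<bar>w $ i $ j\<bar> \<le> \<lceil>V\<rceil>" by linarith
qed

lemma mat_cong_idD:
  assumes "mat_cong m w (mat 1)"
  shows "[w$1$1 = 1] (mod int m)" "[w$1$2 = 0] (mod int m)" "[w$2$1 = 0] (mod int m)" "[w$2$2 = 1] (mod int m)"
  using assms unfolding mat_cong_def by (metis mat1_entry)+

text \<open>Since \<open>det (I + m n) = 1\<close> forces \<open>tr n = - m det n\<close>, the trace is fixed modulo \<open>m\<^sup>2\<close>.\<close>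

lemma cong_id_trace:
  assumes "det w = 1" "mat_cong m w (mat 1)"
  shows "[w$1$1 + w$2$2 = 2] (mod int (m\<^sup>2))"
proof -
  obtain a b c d where e: "w$1$1 = 1 + int m * a" "w$1$2 = int m * b" "w$2$1 = int m * c" "w$2$2 = 1 + int m * d"
  proof -
    show ?thesis using that mat_cong_idD[OF assms(2)]
      by (metis add.commute add_0 cong_iff_lin cong_sym_eq)
  qed
  have "(1 + int m * a) * (1 + int m * d) - (int m * b) * (int m * c) = 1" using assms(1) e by (simp add: det_2)
  then have "int m * a + int m * d = (int m)\<^sup>2 * (b * c - a * d)" by (simp add: algebra_simps power2_eq_square)
  then have "w$1$1 + w$2$2 - 2 = int (m\<^sup>2) * (b * c - a * d)" unfolding e by simp
  then show ?thesis by (metis cong_iff_dvd_diff dvd_triv_left)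
qed

text \<open>The trace is fixed modulo m^2 and the corner modulo m, leaving O(V/m^2 + 1) and O(V/m +
  1) choices. They fix the product of the off-diagonal entries, which is then split by the divisor
  bound. If that product vanishes, the diagonal is \<plusminus>1 and one entry is free modulo m. In
  the constant, 48 = 6 * 8: six from merging both cases, eight from expanding the product.\<close>

lemma card_cong_id_box:
  assumes m: "m \<ge> 1" and V: "V \<ge> 1" and \<epsilon>: "\<epsilon> > 0"
    and C: "C \<ge> 1" "\<And>n. n > 0 \<Longrightarrow> real (divcount n) \<le> C * real n powr \<epsilon>"
  shows "real (card (cong_id_box m V)) \<le> 48 * C * V powr (2 * \<epsilon>) * (V\<^sup>2 / real m ^ 3 + V / real m + 1)"
proof -
  define TT where "TT = {x::int. \<bar>x\<bar> \<le> 2 * V \<and> [x = 2] (mod int (m\<^sup>2))}"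
  define AA where "AA = {x::int. \<bar>x\<bar> \<le> V \<and> [x = 1] (mod int m)}"
  define BB where "BB = {x::int. \<bar>x\<bar> \<le> V \<and> [x = 0] (mod int m)}"
  have TT: "finite TT" "real (card TT) \<le> 4 * V / (real m)\<^sup>2 + 1"
    using card_int_cong_le[of "2 * V" "m\<^sup>2" 2] V m by (auto simp: TT_def)
  have AA: "finite AA" "real (card AA) \<le> 2 * V / real m + 1"
    using card_int_cong_le[of V m 1] V m by (auto simp: AA_def)
  have BB: "finite BB" "real (card BB) \<le> 2 * V / real m + 1"
    using card_int_cong_le[of V m 0] V m by (auto simp: BB_def)
  define n where "n = (\<lambda>(\<tau>::int, a). a * (\<tau> - a) - 1)"
  \<comment> \<open>\<open>n p\<close> is the product of the off-diagonal entries, a d - 1. The side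
    conditions make \<open>D p\<close> empty outside the relevant range, so that finiteness and the
    divisor bound hold for every \<open>p\<close>.\<close>
  define D where "D p = {b. n p \<noteq> 0 \<and> real_of_int \<bar>n p\<bar> \<le> V\<^sup>2 \<and> b dvd n p}" for p
  define W where "W = cong_id_box m V"
  define W1 where "W1 = {w \<in> W. w$1$2 * w$2$1 \<noteq> 0}"
  define W2 where "W2 = {w \<in> W. w$1$2 * w$2$1 = 0}"
  have W: "w$1$1 * w$2$2 - w$1$2 * w$2$1 = 1" "[w$1$1 + w$2$2 = 2] (mod int (m\<^sup>2))"
    "[w$1$1 = 1] (mod int m)" "[w$1$2 = 0] (mod int m)" "[w$2$1 = 0] (mod int m)"
    "real_of_int \<bar>w$i$j\<bar> \<le> V" if "w \<in> W" for w i j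
    using that cong_id_trace[of w m] mat_cong_idD[of m w] unfolding W_def cong_id_box_def by (auto simp: det_2)
  have Dcard: "finite (D p)" "real (card (D p)) \<le> 2 * C * V powr (2 * \<epsilon>)" for p
  proof -
    show "finite (D p)" by (cases "n p = 0") (auto simp: D_def)
    show "real (card (D p)) \<le> 2 * C * V powr (2 * \<epsilon>)"
    proof (cases "n p \<noteq> 0 \<and> real_of_int \<bar>n p\<bar> \<le> V\<^sup>2")
      case True
      then have "D p = {b. b dvd n p}" by (auto simp: D_def)
      then have "real (card (D p)) \<le> 2 * real (divcount (nat \<bar>n p\<bar>))"
        using card_int_divisors(2)[of "n p"] True by (simp flip: of_nat_le_iff)
      also have "\<dots> \<le> 2 * (C * real (nat \<bar>n p\<bar>) powr \<epsilon>)" using C(2)[of "nat \<bar>n p\<bar>"] True by simp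
      also have "\<dots> \<le> 2 * (C * (V\<^sup>2) powr \<epsilon>)" using True C \<epsilon> by (intro mult_left_mono powr_mono2) auto
      also have "(V\<^sup>2) powr \<epsilon> = V powr (2 * \<epsilon>)" using V by (simp add: powr_powr flip: powr_numeral)
      finally show ?thesis by simp
    next
      case False
      then have "D p = {}" by (auto simp: D_def)
      then show ?thesis using C by simp
    qed
  qed
  have "card W1 \<le> card (SIGMA p:TT \<times> AA. D p)"
  proof (rule card_inj_on_le)
    show "inj_on (\<lambda>w::imat. ((w$1$1 + w$2$2, w$1$1), w$1$2)) W1"
    proof (rule inj_onI)
      fix x y :: imat assume x: "x \<in> W1" and y: "y \<in> W1"
        and e: "((x$1$1 + x$2$2, x$1$1), x$1$2) = ((y$1$1 + y$2$2, y$1$1), y$1$2)"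
      have xy: "x$1$1 = y$1$1" "x$1$2 = y$1$2" "x$2$2 = y$2$2" using e by auto
      have "x \<in> W" "y \<in> W" using x y by (auto simp: W1_def)
      then have "x$1$2 * x$2$1 = x$1$2 * y$2$1"
        using W(1)[of x] W(1)[of y] unfolding xy by linarith
      then have "x$2$1 = y$2$1" using x by (auto simp: W1_def)
      then show "x = y" using e by (auto simp: imat_eq_iff)
    qed
    show "(\<lambda>w::imat. ((w$1$1 + w$2$2, w$1$1), w$1$2)) ` W1 \<subseteq> (SIGMA p:TT \<times> AA. D p)"
    proof safe
      fix w :: imat assume "w \<in> W1"
      then have w: "w \<in> W" "w$1$2 * w$2$1 \<noteq> 0" by (auto simp: W1_def)
      note b = W[OF w(1)]
      have "real_of_int \<bar>w$1$1 + w$2$2\<bar> \<le> 2 * V" using b(6)[of 1 1] b(6)[of 2 2] by linarith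
      then show "w$1$1 + w$2$2 \<in> TT" using b(2) by (simp add: TT_def)
      show "w$1$1 \<in> AA" using b(3) b(6)[of 1 1] by (simp add: AA_def)
      have nw: "n (w$1$1 + w$2$2, w$1$1) = w$1$2 * w$2$1" using b(1) by (simp add: n_def)
      have "real_of_int \<bar>w$1$2\<bar> * real_of_int \<bar>w$2$1\<bar> \<le> V * V" using b(6) V by (intro mult_mono) auto
      then show "w$1$2 \<in> D (w$1$1 + w$2$2, w$1$1)" using w(2)
        by (simp add: D_def nw abs_mult power2_eq_square)
    qed
    show "finite (SIGMA p:TT \<times> AA. D p)" using TT AA Dcard by auto
  qed
  also have "\<dots> = (\<Sum>p\<in>TT \<times> AA. card (D p))" using TT AA Dcard by (intro card_SigmaI) auto
  finally have "real (card W1) \<le> (\<Sum>p\<in>TT \<times> AA. real (card (D p)))" by (simp flip: of_nat_sum)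
  also have "\<dots> \<le> (\<Sum>p\<in>TT \<times> AA. 2 * C * V powr (2 * \<epsilon>))" by (intro sum_mono Dcard)
  also have "\<dots> = real (card TT) * real (card AA) * (2 * C * V powr (2 * \<epsilon>))" by (simp add: card_cartesian_product)
  finally have c1: "real (card W1) \<le> real (card TT) * real (card AA) * (2 * C * V powr (2 * \<epsilon>))" .
  \<comment> \<open>One off-diagonal entry is zero: their sum together with the information which
    one vanishes recovers both, and the corner \<plusminus>1 fixes the other diagonal entry.\<close>
  have "card W2 \<le> card ({1, -1 :: int} \<times> (UNIV :: bool set) \<times> BB)"
  proof (rule card_inj_on_le)
    show "inj_on (\<lambda>w::imat. (w$1$1, w$1$2 = 0, w$1$2 + w$2$1)) W2"
    proof (rule inj_onI)
      fix x y :: imat assume x: "x \<in> W2" and y: "y \<in> W2"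
        and e: "(x$1$1, x$1$2 = 0, x$1$2 + x$2$1) = (y$1$1, y$1$2 = 0, y$1$2 + y$2$1)"
      have "x$1$1 * x$2$2 = 1" "y$1$1 * y$2$2 = 1" using W(1)[of x] W(1)[of y] x y by (auto simp: W2_def)
      then have "x$2$2 = y$2$2" using e by (metis Pair_inject mult_cancel_left mult_zero_left zero_neq_one)
      then show "x = y" using e x y by (auto simp: imat_eq_iff W2_def)
    qed
    show "(\<lambda>w::imat. (w$1$1, w$1$2 = 0, w$1$2 + w$2$1)) ` W2 \<subseteq> {1, -1} \<times> UNIV \<times> BB"
    proof safe
      fix w :: imat assume "w \<in> W2"
      then have w: "w \<in> W" "w$1$2 * w$2$1 = 0" by (auto simp: W2_def)
      note b = W[OF w(1)]
      have "w$1$1 * w$2$2 = 1" using b(1) w(2) by simp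
      then show "w$1$1 = - 1" if "w$1$1 \<noteq> 1" using that zmult_eq_1_iff by auto
      show "w$1$2 + w$2$1 \<in> BB" using w(2) b(4,5) b(6)[of 1 2] b(6)[of 2 1] by (auto simp: BB_def)
    qed simp
    show "finite ({1, -1 :: int} \<times> (UNIV :: bool set) \<times> BB)" using BB by auto
  qed
  then have c2: "real (card W2) \<le> 4 * real (card BB)" by (simp add: card_cartesian_product)
  have "W = W1 \<union> W2" by (auto simp: W1_def W2_def)
  then have "real (card W) \<le> real (card W1) + real (card W2)" by (metis card_Un_le of_nat_add of_nat_le_iff)
  also have "\<dots> \<le> (4 * V / (real m)\<^sup>2 + 1) * (2 * V / real m + 1) * (2 * C * V powr (2 * \<epsilon>)) + 4 * (2 * V / real m + 1)"
  proof (intro add_mono order_trans[OF c1] order_trans[OF c2] mult_right_mono mult_mono)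
  qed (use TT AA BB C V in \<open>auto intro!: add_nonneg_nonneg\<close>)
  also have "4 * (2 * V / real m + 1) \<le> (4 * V / (real m)\<^sup>2 + 1) * (2 * V / real m + 1) * (4 * C * V powr (2 * \<epsilon>))"
  proof -
    have "1 * 1 \<le> C * V powr (2 * \<epsilon>)" using C V \<epsilon> by (intro mult_mono ge_one_powr_ge_zero) auto
    then have "1 * (2 * V / real m + 1) * 4 \<le> (4 * V / (real m)\<^sup>2 + 1) * (2 * V / real m + 1) * (4 * C * V powr (2 * \<epsilon>))"
      using V m by (intro mult_mono) (auto intro!: mult_nonneg_nonneg add_nonneg_nonneg)
    then show ?thesis by simp
  qed
  also have "(4 * V / (real m)\<^sup>2 + 1) * (2 * V / real m + 1) * (2 * C * V powr (2 * \<epsilon>)) + \<dots>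
    = 6 * C * V powr (2 * \<epsilon>) * ((4 * V / (real m)\<^sup>2 + 1) * (2 * V / real m + 1))"
  proof -
    have "a * (2 * C * v) + a * (4 * C * v) = 6 * C * v * a" for a v :: real by (simp add: algebra_simps)
    then show ?thesis .
  qed
  also have "(4 * V / (real m)\<^sup>2 + 1) * (2 * V / real m + 1) \<le> 8 * (V\<^sup>2 / real m ^ 3 + V / real m + 1)"
  proof -
    have "V / (real m)\<^sup>2 \<le> V / real m"
      using V m by (intro divide_left_mono) (auto simp: power2_eq_square)
    moreover have "(4 * V / (real m)\<^sup>2 + 1) * (2 * V / real m + 1)
        = 8 * (V / (real m)\<^sup>2 * (V / real m)) + 4 * (V / (real m)\<^sup>2) + 2 * (V / real m) + 1"
    proof -
      have "(4 * a + 1) * (2 * b + 1) = 8 * (a * b) + 4 * a + 2 * b + 1" for a b :: real by (simp add: algebra_simps)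
      from this[of "V / (real m)\<^sup>2" "V / real m"] show ?thesis by simp
    qed
    moreover have "V / (real m)\<^sup>2 * (V / real m) = V\<^sup>2 / real m ^ 3"
      by (simp add: power2_eq_square power3_eq_cube)
    moreover have "0 \<le> V\<^sup>2 / real m ^ 3" "0 \<le> V / real m" using V by auto
    ultimately show ?thesis by argo
  qed
  finally show ?thesis using C V by (simp add: W_def mult_left_mono algebra_simps)
qed


text \<open>Writing z = y w turns the congruence into w being the identity modulo m, with entries at
  most 2 R^2. For each \<open>w\<close> the number of \<open>y\<close> is bounded by
  \<open>strip_count\<close>, and exchanging the sums leaves, for each \<open>h\<close>, the
  \<open>w\<close> of size at most R^2 / |h|.\<close>

lemma Ybox_pairs_le:
  assumes "R \<ge> 1"
  defines "H \<equiv> {h::int. real_of_int \<bar>h\<bar> \<le> R\<^sup>2}"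
  shows "card {(y, z) \<in> Ybox R \<times> Ybox R. mat_cong m y z}
    \<le> 2 * (\<Sum>h\<in>H. card {w \<in> cong_id_box m (2 * R\<^sup>2). \<forall>i j. real_of_int (\<bar>h\<bar> * \<bar>w$i$j\<bar>) \<le> R\<^sup>2})"
proof -
  define W where "W = cong_id_box m (2 * R\<^sup>2)"
  have finH: "finite H" unfolding H_def
    by (rule finite_subset[of _ "{-\<lceil>R\<^sup>2\<rceil>..\<lceil>R\<^sup>2\<rceil>}"]) (auto, linarith+)
  define V where "V w = {y \<in> Ybox R. y ** w \<in> Ybox R}" for w
  have finV: "finite (V w)" for w unfolding V_def using finite_Ybox by simp
  have inv: "y ** (adj y ** z) = z" if "y \<in> Ybox R" for y z
  proof -
    have "y ** adj y = mat 1" using YboxD(1)[OF that] by (simp add: imat_eq_iff algebra_simps)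
    then show ?thesis by (simp add: matrix_mul_assoc del: mm_entry)
  qed
  have "card {(y, z) \<in> Ybox R \<times> Ybox R. mat_cong m y z} \<le> card (SIGMA w:W. V w)"
  proof (rule card_inj_on_le)
    show "inj_on (\<lambda>(y, z). (adj y ** z, y)) {(y, z) \<in> Ybox R \<times> Ybox R. mat_cong m y z}"
    proof (rule inj_onI)
      fix p q
      assume p: "p \<in> {(y, z) \<in> Ybox R \<times> Ybox R. mat_cong m y z}"
        and e: "(case p of (y, z) \<Rightarrow> (adj y ** z, y)) = (case q of (y, z) \<Rightarrow> (adj y ** z, y))"
      obtain y z y' z' where pq: "p = (y, z)" "q = (y', z')" by (cases p; cases q)
      have y: "y = y'" "adj y ** z = adj y ** z'" "y \<in> Ybox R" using e p unfolding pq by auto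
      then have "z = z'" by (metis inv)
      then show "p = q" using y pq by simp
    qed
    show "(\<lambda>(y, z). (adj y ** z, y)) ` {(y, z) \<in> Ybox R \<times> Ybox R. mat_cong m y z} \<subseteq> (SIGMA w:W. V w)"
    proof
      fix p assume "p \<in> (\<lambda>(y, z). (adj y ** z, y)) ` {(y, z) \<in> Ybox R \<times> Ybox R. mat_cong m y z}"
      then obtain y z where p: "p = (adj y ** z, y)" and y: "y \<in> Ybox R" and z: "z \<in> Ybox R" and c: "mat_cong m y z"
        by auto
      define w where "w = adj y ** z"
      have "det w = det (adj y) * det z" by (simp add: w_def det_mul)
      moreover have "det (adj y) = 1" using YboxD(1)[OF y] by (simp add: det_2 mult.commute)
      moreover have "det z = 1" using YboxD(1)[OF z] by (simp add: det_2)
      ultimately have 1: "det w = 1" by simp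
      have zy: "[z$i$j = y$i$j] (mod int m)" for i j using c by (auto simp: mat_cong_def cong_sym_eq)
      have "[w$i$j = (adj y ** y)$i$j] (mod int m)" for i j
        unfolding w_def mm_entry by (intro cong_add cong_mult zy cong_refl)
      moreover have "adj y ** y = mat 1" using YboxD(1)[OF y] by (simp add: imat_eq_iff algebra_simps)
      ultimately have 2: "mat_cong m w (mat 1)" by (simp add: mat_cong_def)
      have ay: "real_of_int \<bar>adj y$i$j\<bar> \<le> R" for i j
        using Ybox_entry[OF y] exhaust_2[of i] exhaust_2[of j] by auto
      have az: "real_of_int \<bar>z$i$j\<bar> \<le> R" for i j using Ybox_entry[OF z, of i j] by auto
      have 3: "real_of_int \<bar>w$i$j\<bar> \<le> 2 * R\<^sup>2" for i j
      proof -
        have p: "real_of_int \<bar>adj y$i$k * z$k$j\<bar> \<le> R\<^sup>2" for k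
          using ay[of i k] az[of k j] mult_mono[of "\<bar>real_of_int (adj y$i$k)\<bar>" R "\<bar>real_of_int (z$k$j)\<bar>" R] assms(1)
          by (simp add: abs_mult power2_eq_square)
        show ?thesis unfolding w_def mm_entry using p[of 1] p[of 2] by linarith
      qed
      show "p \<in> (SIGMA w:W. V w)" unfolding p
        using 1 2 3 y z inv[OF y, of z] by (auto simp: W_def V_def cong_id_box_def w_def simp del: mm_entry)
    qed
    show "finite (SIGMA w:W. V w)" using finV finite_cong_id_box by (auto simp: W_def)
  qed
  also have "\<dots> = (\<Sum>w\<in>W. card (V w))" using finV finite_cong_id_box by (simp add: W_def card_SigmaI)
  also have "\<dots> \<le> (\<Sum>w\<in>W. 2 * card {h\<in>H. \<forall>i j. real_of_int (\<bar>h\<bar> * \<bar>w$i$j\<bar>) \<le> R\<^sup>2})"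
  proof (rule sum_mono)
    fix w
    show "card (V w) \<le> 2 * card {h\<in>H. \<forall>i j. real_of_int (\<bar>h\<bar> * \<bar>w$i$j\<bar>) \<le> R\<^sup>2}"
      unfolding H_def mem_Collect_eq by (rule strip_count) (auto simp: V_def simp del: mm_entry)
  qed
  also have "\<dots> = 2 * (\<Sum>h\<in>H. card {w\<in>W. \<forall>i j. real_of_int (\<bar>h\<bar> * \<bar>w$i$j\<bar>) \<le> R\<^sup>2})"
  proof -
    have c: "card {x\<in>S. P x} = (\<Sum>x\<in>S. if P x then 1 else 0)" if "finite S" for S :: "int set" and P
      using that by (simp add: sum.If_cases Int_def)
    have d: "card {x\<in>S. P x} = (\<Sum>x\<in>S. if P x then 1 else 0)" if "finite S" for S :: "imat set" and P
      using that by (simp add: sum.If_cases Int_def)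
    have finW: "finite W" by (simp add: W_def finite_cong_id_box)
    show ?thesis
      unfolding sum_distrib_left[symmetric] c[OF finH] d[OF finW] by (subst sum.swap) (rule refl)
  qed
  finally show ?thesis by (simp add: W_def)
qed

text \<open>Up to R^\<epsilon>, this is the expected number (R^2)^2 / m^3 of congruent pairs plus
  the diagonal R^2. Each nonzero \<open>h\<close> contributes at most this total divided by |h|, so
  the sum over \<open>h\<close> costs only a logarithm.\<close>

lemma Ybox_pairs_bound:
  assumes "\<epsilon> > 0"
  shows "\<exists>C\<ge>1. \<forall>R\<ge>1. \<forall>m\<ge>1. real (card {(y, z) \<in> Ybox R \<times> Ybox R. mat_cong m y z})
    \<le> C * R powr \<epsilon> * (R ^ 4 / real m ^ 3 + R\<^sup>2)"
proof -
  \<comment> \<open>The divisor bound and the harmonic sum together cost (2 S)^(4 e), and S = R^2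
    makes this R^(8 e) up to a constant.\<close>
  define e where "e = \<epsilon> / 8"
  have e: "e > 0" using assms by (simp add: e_def)
  obtain C0 where C0: "C0 \<ge> 1" "\<And>n. n > 0 \<Longrightarrow> real (divcount n) \<le> C0 * real n powr e"
    using divcount_bound[OF e] by blast
  obtain C1 where C1: "C1 \<ge> 1" "\<And>Q. Q \<ge> 1 \<Longrightarrow> (\<Sum>k\<in>{k::nat. 1 \<le> k \<and> real k < Q}. 1 / real k) \<le> C1 * Q powr e"
    using sum_inverse_bound[OF e] by blast
  show ?thesis
  \<comment> \<open>\<open>10 ^ 4\<close> rounds up 26 * 48, with 48 from
    \<open>card_cong_id_box\<close> and 26 = 2 * (7 + 3 * 2) from the terms h = 0 and h \<noteq>
    0.\<close>
  proof (intro exI[of _ "10 ^ 4 * C0 * C1 * 2 powr (4 * e)"] conjI allI impI)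
    have "1 * 1 * 1 * 1 \<le> 10 ^ 4 * C0 * C1 * 2 powr (4 * e)"
      using C0 C1 e by (intro mult_mono) (auto intro: ge_one_powr_ge_zero)
    then show "1 \<le> 10 ^ 4 * C0 * C1 * 2 powr (4 * e)" by simp
    fix R :: real and m :: nat assume R: "1 \<le> R" and m: "1 \<le> m"
    define H where "H = {h::int. real_of_int \<bar>h\<bar> \<le> R\<^sup>2}"
    define S where "S = R\<^sup>2"
    have S: "S \<ge> 1" using R by (simp add: S_def)
    have finH: "finite H" unfolding H_def
      by (rule finite_subset[of _ "{-\<lceil>R\<^sup>2\<rceil>..\<lceil>R\<^sup>2\<rceil>}"]) (auto, linarith+)
    define cw where "cw h = real (card {w \<in> cong_id_box m (2 * R\<^sup>2). \<forall>i j. real_of_int (\<bar>h\<bar> * \<bar>w$i$j\<bar>) \<le> R\<^sup>2})" for h :: int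
    define B where "B = 48 * C0 * (2 * S) powr (2 * e)"
    have B0: "B \<ge> 0" using C0 by (simp add: B_def)
    define E where "E = S\<^sup>2 / real m ^ 3 + S"
    have E: "S \<le> E" "S\<^sup>2 / real m ^ 3 \<le> E" unfolding E_def using S by auto
    \<comment> \<open>For h = 0 the product condition is void, so the whole box of radius 2 S
      counts; 7 = 4 + 2 + 1 collects its three terms.\<close>
    have c0: "cw 0 \<le> B * (7 * E)"
    proof -
      have "cw 0 \<le> real (card (cong_id_box m (2 * S)))"
        unfolding cw_def S_def by (intro of_nat_mono card_mono finite_cong_id_box) auto
      also have "\<dots> \<le> 48 * C0 * (2 * S) powr (2 * e) * ((2 * S)\<^sup>2 / real m ^ 3 + 2 * S / real m + 1)"
        using S m e C0 by (intro card_cong_id_box) auto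
      also have "\<dots> = B * ((2 * S)\<^sup>2 / real m ^ 3 + 2 * S / real m + 1)" by (simp add: B_def)
      also have "\<dots> \<le> B * (7 * E)"
      proof (intro mult_left_mono B0)
        define x y where "x = S\<^sup>2 / real m ^ 3" and "y = S / real m"
        have "S / real m \<le> S / 1" using m S by (intro divide_left_mono) auto
        then have "y \<le> S" by (simp add: y_def)
        moreover have "0 \<le> x" by (simp add: x_def)
        ultimately have "4 * x + 2 * y + 1 \<le> 7 * x + 7 * S" using S by linarith
        then show "(2 * S)\<^sup>2 / real m ^ 3 + 2 * S / real m + 1 \<le> 7 * E"
          by (simp add: x_def y_def E_def power2_eq_square)
      qed
      finally show ?thesis .
    qed
    have ch: "cw h \<le> B * (3 * E * (1 / real (nat \<bar>h\<bar>)))" if h: "h \<in> H" "h \<noteq> 0" for h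
    proof -
      define k where "k = real_of_int \<bar>h\<bar>"
      have k: "k \<ge> 1" "k \<le> S" using h by (auto simp: k_def H_def S_def)
      have "{w \<in> cong_id_box m (2 * R\<^sup>2). \<forall>i j. real_of_int (\<bar>h\<bar> * \<bar>w$i$j\<bar>) \<le> R\<^sup>2} \<subseteq> cong_id_box m (S / k)"
        using k unfolding cong_id_box_def by (auto simp: S_def field_simps k_def)
      then have "cw h \<le> real (card (cong_id_box m (S / k)))"
        unfolding cw_def by (intro of_nat_mono card_mono finite_cong_id_box)
      also have "\<dots> \<le> 48 * C0 * (S / k) powr (2 * e) * ((S / k)\<^sup>2 / real m ^ 3 + S / k / real m + 1)"
        using k m e C0 by (intro card_cong_id_box) auto
      also have "\<dots> \<le> B * (3 * E * (1 / k))"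
      proof (rule mult_mono)
        have "S / k \<le> 2 * S" using k S by (simp add: field_simps)
        then show "48 * C0 * (S / k) powr (2 * e) \<le> B" unfolding B_def using C0 e S k
          by (intro mult_left_mono powr_mono2) auto
        have "1 \<le> S / k" using k by simp
        moreover have "S / k / real m \<le> S / k / 1" using m k S by (intro divide_left_mono) auto
        moreover have "(S / k)\<^sup>2 / real m ^ 3 \<le> S\<^sup>2 / real m ^ 3 / k"
        proof -
          have "(S / k)\<^sup>2 / real m ^ 3 = (S\<^sup>2 / real m ^ 3 / k) / k" by (simp add: power2_eq_square)
          also have "\<dots> \<le> (S\<^sup>2 / real m ^ 3 / k) / 1" using k by (intro divide_left_mono) auto
          finally show ?thesis by simp
        qed
        moreover have "S / k \<le> E / k" "S\<^sup>2 / real m ^ 3 / k \<le> E / k" using divide_right_mono[OF E(1), of k] divide_right_mono[OF E(2), of k] k by auto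
        ultimately show "(S / k)\<^sup>2 / real m ^ 3 + S / k / real m + 1 \<le> 3 * E * (1 / k)" by simp
        show "0 \<le> (S / k)\<^sup>2 / real m ^ 3 + S / k / real m + 1" using S k by simp
      qed (use B0 in auto)
      finally show ?thesis by (simp add: k_def)
    qed
    have sumH: "(\<Sum>h\<in>H - {0}. 1 / real (nat \<bar>h\<bar>)) \<le> 2 * (C1 * (2 * S) powr e)"
    proof -
      define N where "N = {k::nat. 1 \<le> k \<and> real k < 2 * S}"
      have finN: "finite N" unfolding N_def
        by (rule finite_subset[of _ "{..nat \<lceil>2 * S\<rceil>}"]) (auto simp: le_nat_iff, linarith)
      have sub: "H - {0} \<subseteq> (\<lambda>(s, k). s * int k) ` ({1, -1} \<times> N)"
      proof
        fix h assume h: "h \<in> H - {0}"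
        then have "real_of_int \<bar>h\<bar> < 2 * S" using S by (auto simp: H_def S_def)
        then have "nat \<bar>h\<bar> \<in> N" using h by (auto simp: N_def)
        then show "h \<in> (\<lambda>(s, k). s * int k) ` ({1, -1} \<times> N)"
          by (intro image_eqI[of _ _ "(if h \<ge> 0 then 1 else -1, nat \<bar>h\<bar>)"]) auto
      qed
      have "(\<Sum>h\<in>H - {0}. 1 / real (nat \<bar>h\<bar>)) \<le> (\<Sum>h\<in>(\<lambda>(s, k). s * int k) ` ({1, -1} \<times> N). 1 / real (nat \<bar>h\<bar>))"
        using sub finN by (intro sum_mono2) auto
      also have "\<dots> \<le> sum ((\<lambda>h. 1 / real (nat \<bar>h\<bar>)) \<circ> (\<lambda>(s, k). s * int k)) ({1, -1} \<times> N)"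
        using finN by (intro sum_image_le) auto
      also have "\<dots> = (\<Sum>s\<in>{1, -1 :: int}. \<Sum>k\<in>N. 1 / real k)"
        unfolding sum.cartesian_product by (intro sum.cong) (auto simp: abs_mult)
      also have "\<dots> = 2 * (\<Sum>k\<in>N. 1 / real k)" by simp
      also have "\<dots> \<le> 2 * (C1 * (2 * S) powr e)"
        using C1(2)[of "2 * S"] S unfolding N_def by simp
      finally show ?thesis .
    qed
    have "real (card {(y, z) \<in> Ybox R \<times> Ybox R. mat_cong m y z}) \<le> 2 * (\<Sum>h\<in>H. cw h)"
      using Ybox_pairs_le[OF R, of m] unfolding cw_def H_def by (simp flip: of_nat_sum of_nat_le_iff)
    also have "(\<Sum>h\<in>H. cw h) = cw 0 + (\<Sum>h\<in>H - {0}. cw h)"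
      using finH S by (subst sum.remove[of H 0]) (auto simp: H_def S_def)
    also have "\<dots> \<le> B * (7 * E) + (\<Sum>h\<in>H - {0}. B * (3 * E * (1 / real (nat \<bar>h\<bar>))))"
      using c0 ch by (intro add_mono sum_mono) auto
    also have "(\<Sum>h\<in>H - {0}. B * (3 * E * (1 / real (nat \<bar>h\<bar>)))) = B * (3 * E) * (\<Sum>h\<in>H - {0}. 1 / real (nat \<bar>h\<bar>))"
      by (simp only: sum_distrib_left mult.assoc)
    also have "\<dots> \<le> B * (3 * E) * (2 * (C1 * (2 * S) powr e))"
      using sumH B0 E S by (intro mult_left_mono) auto
    finally have "real (card {(y, z) \<in> Ybox R \<times> Ybox R. mat_cong m y z})
      \<le> 2 * (B * (7 * E) + B * (3 * E) * (2 * (C1 * (2 * S) powr e)))" by simp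
    also have "\<dots> \<le> 2 * (B * (7 * E) * (C1 * (2 * S) powr (2 * e)) + B * (3 * E) * (2 * (C1 * (2 * S) powr (2 * e))))"
    proof -
      have "1 * 1 \<le> C1 * (2 * S) powr (2 * e)" using C1 S e by (intro mult_mono ge_one_powr_ge_zero) auto
      then have "B * (7 * E) * 1 \<le> B * (7 * E) * (C1 * (2 * S) powr (2 * e))" using B0 E S by (intro mult_left_mono) auto
      moreover have "B * (3 * E) * (2 * (C1 * (2 * S) powr e)) \<le> B * (3 * E) * (2 * (C1 * (2 * S) powr (2 * e)))"
        using B0 E S C1 e by (intro mult_left_mono powr_mono) auto
      ultimately show ?thesis unfolding distrib_left by linarith
    qed
    also have "\<dots> = 26 * 48 * C0 * C1 * ((2 * S) powr (2 * e) * (2 * S) powr (2 * e)) * E"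
      by (simp add: B_def algebra_simps)
    also have "(2 * S) powr (2 * e) * (2 * S) powr (2 * e) = 2 powr (4 * e) * R powr \<epsilon>"
    proof -
      have "(2 * S) powr (2 * e) * (2 * S) powr (2 * e) = (2 * S) powr (4 * e)" by (simp flip: powr_add)
      also have "\<dots> = 2 powr (4 * e) * S powr (4 * e)" using S by (simp add: powr_mult)
      also have "S powr (4 * e) = R powr \<epsilon>" using R by (simp add: S_def powr_powr e_def flip: powr_numeral)
      finally show ?thesis .
    qed
    also have "26 * 48 * C0 * C1 * (2 powr (4 * e) * R powr \<epsilon>) * E
      \<le> 10 ^ 4 * C0 * C1 * (2 powr (4 * e) * R powr \<epsilon>) * E"
      using C0 C1 E S by (intro mult_right_mono) auto
    finally show "real (card {(y, z) \<in> Ybox R \<times> Ybox R. mat_cong m y z})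
      \<le> 10 ^ 4 * C0 * C1 * 2 powr (4 * e) * R powr \<epsilon> * (R ^ 4 / real m ^ 3 + R\<^sup>2)"
      by (simp add: E_def S_def mult_ac)
  qed
qed

section \<open>Counting in \<open>SL\<^sub>2(F\<^sub>p)\<close>\<close>

definition red :: "nat \<Rightarrow> imat \<Rightarrow> imat" where "red p x = (\<chi> i j. x$i$j mod int p)"

lemma red_entry [simp]: "red p x $ i $ j = x $ i $ j mod int p" by (simp add: red_def)

lemma mat_cong_refl [simp]: "mat_cong p x x" by (simp add: mat_cong_def)
lemma mat_cong_sym: "mat_cong p x y \<Longrightarrow> mat_cong p y x" by (auto simp: mat_cong_def cong_sym)
lemma mat_cong_trans: "mat_cong p x y \<Longrightarrow> mat_cong p y z \<Longrightarrow> mat_cong p x z" unfolding mat_cong_def by (meson cong_trans)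
lemma mat_cong_red [simp]: "mat_cong p (red p x) x" by (simp add: mat_cong_def cong_def)
lemma mat_cong_mult: "mat_cong p x x' \<Longrightarrow> mat_cong p y y' \<Longrightarrow> mat_cong p (x ** y) (x' ** y')"
  unfolding mat_cong_def mm_entry by (blast intro: cong_add cong_mult)
lemma mat_cong_iff: "mat_cong p x y \<longleftrightarrow> [x$1$1 = y$1$1] (mod int p) \<and> [x$1$2 = y$1$2] (mod int p) \<and>
    [x$2$1 = y$2$1] (mod int p) \<and> [x$2$2 = y$2$2] (mod int p)"
  by (auto simp: mat_cong_def forall_2)
lemma mat_cong_dvd: "mat_cong p x y \<Longrightarrow> int p dvd x$i$j \<longleftrightarrow> int p dvd y$i$j"
  by (simp add: mat_cong_def cong_dvd_iff)
lemma mat_cong_det: "mat_cong p x y \<Longrightarrow> [det x = det y] (mod int p)"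
  unfolding det_2 by (intro cong_diff cong_mult) (auto simp: mat_cong_def)
lemma mat_cong_ff: "mat_cong p x y \<Longrightarrow> [ff x = ff y] (mod int p)"
  unfolding ff_def by (intro cong_add cong_pow) (auto simp: mat_cong_def)
lemma red_eq_iff: "red p x = red p y \<longleftrightarrow> mat_cong p x y"
  by (simp add: imat_eq_iff mat_cong_iff cong_def)

lemma SL2_modD: "y \<in> SL2_mod p \<Longrightarrow> [det y = 1] (mod int p)" by (simp add: SL2_mod_def)

lemma red_in: "p > 0 \<Longrightarrow> [det x = 1] (mod int p) \<Longrightarrow> red p x \<in> SL2_mod p"
  using mat_cong_det[OF mat_cong_red, of p x] by (auto simp: SL2_mod_def intro: cong_trans)

lemma finite_SL2_mod [simp]: "finite (SL2_mod p)"
proof (rule finite_subset[OF _ finite_bounded_imat[of "int p"]], safe)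
  fix x i j assume "x \<in> SL2_mod p"
  then have "0 \<le> x$i$j \<and> x$i$j < int p" by (simp add: SL2_mod_def)
  then show "\<bar>x$i$j\<bar> \<le> int p" by linarith
qed

lemma SL2_mod_eqI: "x \<in> SL2_mod p \<Longrightarrow> y \<in> SL2_mod p \<Longrightarrow> mat_cong p x y \<Longrightarrow> x = y"
  by (auto simp: SL2_mod_def imat_eq_iff mat_cong_iff cong_def)

lemma adj_mult: "adj x ** x = mat2 (det x) 0 0 (det x)" "x ** adj x = mat2 (det x) 0 0 (det x)"
  by (simp_all add: imat_eq_iff det_2 algebra_simps)

lemma mat_cong_cancel_left:
  assumes "[det g = 1] (mod int p)" "mat_cong p (g ** x) (g ** y)"
  shows "mat_cong p x y"
proof -
  have 1: "mat_cong p (adj g ** g ** z) z" for z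
  proof -
    have "mat_cong p (adj g ** g) (mat 1)" unfolding adj_mult using assms(1) by (simp add: mat_cong_iff)
    from mat_cong_mult[OF this mat_cong_refl, of z] show ?thesis by (simp del: mm_entry)
  qed
  have "mat_cong p (adj g ** (g ** x)) (adj g ** (g ** y))" by (intro mat_cong_mult assms mat_cong_refl)
  then show ?thesis using 1 unfolding matrix_mul_assoc by (meson mat_cong_sym mat_cong_trans)
qed

lemma mat_cong_cancel_right:
  assumes "[det g = 1] (mod int p)" "mat_cong p (x ** g) (y ** g)"
  shows "mat_cong p x y"
proof -
  have 1: "mat_cong p (z ** (g ** adj g)) z" for z
  proof -
    have "mat_cong p (g ** adj g) (mat 1)" unfolding adj_mult using assms(1) by (simp add: mat_cong_iff)
    from mat_cong_mult[OF mat_cong_refl this, of z] show ?thesis by (simp del: mm_entry)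
  qed
  have "mat_cong p ((x ** g) ** adj g) ((y ** g) ** adj g)" by (intro mat_cong_mult assms mat_cong_refl)
  then show ?thesis using 1 unfolding matrix_mul_assoc[symmetric] by (meson mat_cong_sym mat_cong_trans)
qed

lemma bij_translate:
  assumes "p > 0" "[det g = 1] (mod int p)" "[det h = 1] (mod int p)"
  shows "bij_betw (\<lambda>y. red p (g ** y ** h)) (SL2_mod p) (SL2_mod p)"
proof -
  have "inj_on (\<lambda>y. red p (g ** y ** h)) (SL2_mod p)"
  proof (rule inj_onI)
    fix x y assume xy: "x \<in> SL2_mod p" "y \<in> SL2_mod p" "red p (g ** x ** h) = red p (g ** y ** h)"
    have "mat_cong p x y" using xy(3) unfolding red_eq_iff
      by (rule mat_cong_cancel_left[OF assms(2) mat_cong_cancel_right[OF assms(3)]])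
    then show "x = y" using xy SL2_mod_eqI by blast
  qed
  moreover have "(\<lambda>y. red p (g ** y ** h)) ` SL2_mod p \<subseteq> SL2_mod p"
  proof safe
    fix y assume "y \<in> SL2_mod p"
    then have "[det g * det y * det h = 1 * 1 * 1] (mod int p)"
      by (intro cong_mult assms SL2_modD)
    then show "red p (g ** y ** h) \<in> SL2_mod p" using assms by (intro red_in) (simp_all add: det_mul)
  qed
  ultimately show ?thesis by (simp add: bij_betw_def endo_inj_surj)
qed

lemma sum_translate:
  assumes "p > 0" "[det g = 1] (mod int p)" "[det h = 1] (mod int p)"
    and "\<And>x y. mat_cong p x y \<Longrightarrow> \<Phi> x = \<Phi> y"
  shows "(\<Sum>y\<in>SL2_mod p. \<Phi> (g ** y ** h)) = (\<Sum>y\<in>SL2_mod p. \<Phi> y)"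
proof -
  have "(\<Sum>y\<in>SL2_mod p. \<Phi> (g ** y ** h)) = (\<Sum>y\<in>SL2_mod p. \<Phi> (red p (g ** y ** h)))"
    using assms(4)[OF mat_cong_red] by metis
  also have "\<dots> = (\<Sum>y\<in>SL2_mod p. \<Phi> y)"
    using bij_translate[OF assms(1-3)] by (rule sum.reindex_bij_betw)
  finally show ?thesis .
qed

lemma card_translate:
  assumes "p > 0" "[det g = 1] (mod int p)" "[det h = 1] (mod int p)"
    and "\<And>x y. mat_cong p x y \<Longrightarrow> P x \<longleftrightarrow> P y"
  shows "card {y \<in> SL2_mod p. P (g ** y ** h)} = card {y \<in> SL2_mod p. P y}"
proof -
  have "(\<Sum>y\<in>SL2_mod p. (if P (g ** y ** h) then 1 else 0 :: nat)) = (\<Sum>y\<in>SL2_mod p. (if P y then 1 else 0))"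
    by (rule sum_translate[where \<Phi> = "\<lambda>y. if P y then 1 else 0 :: nat"]) (use assms in auto)
  then show ?thesis by (simp add: sum.If_cases Int_def)
qed

section \<open>Solution counts modulo a prime\<close>

lemma card_filter_Times:
  assumes "finite A" "finite B"
  shows "card {p \<in> A \<times> B. Q (fst p) (snd p)} = (\<Sum>a\<in>A. card {b\<in>B. Q a b})"
proof -
  have "{p \<in> A \<times> B. Q (fst p) (snd p)} = Sigma A (\<lambda>a. {b\<in>B. Q a b})" by auto
  then show ?thesis using assms by simp
qed

lemma prime_coprime_int: "prime (p::nat) \<Longrightarrow> \<not> int p dvd a \<Longrightarrow> coprime a (int p)"
  by (metis coprime_commute prime_imp_coprime prime_nat_int_transfer)

lemma prime_inverse:
  assumes "prime (p::nat)" "\<not> int p dvd a"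
  obtains b where "[a * b = 1] (mod int p)"
  using cong_solve_coprime_int[OF prime_coprime_int[OF assms]] by blast

lemma prime_dvd_mult_int: "prime (p::nat) \<Longrightarrow> int p dvd a * b \<longleftrightarrow> int p dvd a \<or> int p dvd b"
  by (simp add: prime_dvd_mult_iff)

lemma card_solve_linear:
  assumes p: "prime (p::nat)" and a: "\<not> int p dvd a"
  shows "card {c \<in> {0..<int p}. [a * c = e] (mod int p)} = 1"
proof -
  obtain b where b: "[a * b = 1] (mod int p)" using prime_inverse[OF assms] by blast
  have p0: "int p > 0" using p prime_gt_0_nat by auto
  have "{c \<in> {0..<int p}. [a * c = e] (mod int p)} = {(b * e) mod int p}"
  proof safe
    fix c assume c: "c \<in> {0..<int p}" "[a * c = e] (mod int p)"
    have "[b * (a * c) = b * e] (mod int p)" using c by (intro cong_mult) auto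
    moreover have "[(a * b) * c = 1 * c] (mod int p)" using b by (intro cong_mult) auto
    ultimately have "[c = b * e] (mod int p)"
      by (metis cong_sym cong_trans mult.commute mult.left_commute mult_1)
    then show "c = (b * e) mod int p" using c by (simp add: cong_def)
  next
    show "(b * e) mod int p \<in> {0..<int p}" using p0 by simp
    have "[a * (b * e mod int p) = (a * b) * e] (mod int p)"
      unfolding mult.assoc by (intro cong_mult) (auto simp: cong_def)
    also have "[(a * b) * e = 1 * e] (mod int p)" using b by (intro cong_mult) auto
    finally show "[a * (b * e mod int p) = e] (mod int p)" by simp
  qed
  then show ?thesis by simp
qed

lemma card_hyperbola:
  assumes p: "prime (p::nat)" and e: "\<not> int p dvd e"
  shows "card {q \<in> {0..<int p} \<times> {0..<int p}. [fst q * snd q = e] (mod int p)} = p - 1"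
proof -
  have "card {q \<in> {0..<int p} \<times> {0..<int p}. [fst q * snd q = e] (mod int p)}
      = (\<Sum>b\<in>{0..<int p}. card {c \<in> {0..<int p}. [b * c = e] (mod int p)})"
    by (rule card_filter_Times) auto
  also have "\<dots> = (\<Sum>b\<in>{0..<int p}. if b = 0 then 0 else 1)"
  proof (rule sum.cong)
    fix b assume b: "b \<in> {0..<int p}"
    show "card {c \<in> {0..<int p}. [b * c = e] (mod int p)} = (if b = 0 then 0 else 1)"
    proof (cases "b = 0")
      case True
      have "\<not> [0 = e] (mod int p)" using e by (simp add: cong_0_iff cong_sym_eq[of 0])
      then show ?thesis using True by simp
    next
      case False
      then have "\<not> int p dvd b" using b zdvd_imp_le[of "int p" b] by auto
      then show ?thesis using card_solve_linear[OF p] False by simp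
    qed
  qed simp
  also have "\<dots> = (\<Sum>b\<in>{0..<int p} - {0}. 1)"
    by (rule sum.mono_neutral_cong_right) auto
  also have "\<dots> = p - 1" using prime_gt_0_nat[OF p] by (simp add: card_Diff_subset)
  finally show ?thesis .
qed

lemma dvd_res: "c \<in> {0..<int p} \<Longrightarrow> int p dvd c \<longleftrightarrow> c = 0"
  using zdvd_imp_le[of "int p" c] by fastforce

lemma SL2_mod_det: "y \<in> SL2_mod p \<Longrightarrow> [y$1$1 * y$2$2 - y$1$2 * y$2$1 = 1] (mod int p)"
  and SL2_mod_range: "y \<in> SL2_mod p \<Longrightarrow> y$i$j \<in> {0..<int p}"
  by (simp_all add: SL2_mod_def det_2)

lemma mat2_in_SL2_mod:
  "a \<in> {0..<int p} \<Longrightarrow> b \<in> {0..<int p} \<Longrightarrow> c \<in> {0..<int p} \<Longrightarrow> d \<in> {0..<int p} \<Longrightarrow>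
    [a * d - b * c = 1] (mod int p) \<Longrightarrow> mat2 a b c d \<in> SL2_mod p"
  by (auto simp: SL2_mod_def det_2 forall_2)

lemma mat2_eta: "mat2 (y$1$1) (y$1$2) (y$2$1) (y$2$2) = y" by (simp add: imat_eq_iff)

lemma cong_neg1: "[- x = 1] (mod int p) \<longleftrightarrow> [x = -1] (mod int p)"
  by (metis add.inverse_inverse cong_minus_minus_iff)

lemma not_dvd_neg1: "prime (p::nat) \<Longrightarrow> \<not> int p dvd -1"
  using prime_gt_1_nat[of p] by auto

lemma card_diagonal_zero:
  assumes p: "prime (p::nat)"
  shows "card {y \<in> SL2_mod p. int p dvd y$1$1 \<and> int p dvd y$2$2} = p - 1"
proof -
  have "{y \<in> SL2_mod p. int p dvd y$1$1 \<and> int p dvd y$2$2}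
      = (\<lambda>q. mat2 0 (fst q) (snd q) 0) ` {q \<in> {0..<int p} \<times> {0..<int p}. [fst q * snd q = -1] (mod int p)}"
  proof safe
    fix y assume y: "y \<in> SL2_mod p" "int p dvd y$1$1" "int p dvd y$2$2"
    then have "y$1$1 = 0" "y$2$2 = 0" using SL2_mod_range dvd_res by blast+
    then show "y \<in> (\<lambda>q. mat2 0 (fst q) (snd q) 0) ` {q \<in> {0..<int p} \<times> {0..<int p}. [fst q * snd q = -1] (mod int p)}"
      using SL2_mod_det[OF y(1)] SL2_mod_range[OF y(1)] mat2_eta[of y]
      by (intro image_eqI[of _ _ "(y$1$2, y$2$1)"]) (auto simp: cong_neg1)
  qed (auto intro!: mat2_in_SL2_mod simp: cong_neg1)
  moreover have "inj_on (\<lambda>q. mat2 0 (fst q) (snd q) 0) S" for S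
    by (auto simp: inj_on_def imat_eq_iff prod_eq_iff)
  ultimately have "card {y \<in> SL2_mod p. int p dvd y$1$1 \<and> int p dvd y$2$2}
      = card {q \<in> {0..<int p} \<times> {0..<int p}. [fst q * snd q = -1] (mod int p)}"
    by (simp add: card_image)
  then show ?thesis using card_hyperbola[OF p not_dvd_neg1[OF p]] by simp
qed

lemma card_corner_zero:
  assumes p: "prime (p::nat)"
  shows "card {y \<in> SL2_mod p. int p dvd y$1$1} = p * (p - 1)"
proof -
  define H where "H = {q \<in> {0..<int p} \<times> {0..<int p}. [fst q * snd q = -1] (mod int p)}"
  have "{y \<in> SL2_mod p. int p dvd y$1$1}
      = (\<lambda>(d, q). mat2 0 (fst q) (snd q) d) ` ({0..<int p} \<times> H)"
  proof safe
    fix y assume y: "y \<in> SL2_mod p" "int p dvd y$1$1"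
    then have "y$1$1 = 0" using SL2_mod_range dvd_res by blast+
    then show "y \<in> (\<lambda>(d, q). mat2 0 (fst q) (snd q) d) ` ({0..<int p} \<times> H)"
      using SL2_mod_det[OF y(1)] SL2_mod_range[OF y(1)] mat2_eta[of y]
      by (intro image_eqI[of _ _ "(y$2$2, (y$1$2, y$2$1))"]) (auto simp: cong_neg1 H_def)
  qed (auto intro!: mat2_in_SL2_mod simp: cong_neg1 H_def)
  moreover have "inj_on (\<lambda>(d, q). mat2 0 (fst q) (snd q) d) S" for S
    by (auto simp: inj_on_def imat_eq_iff prod_eq_iff)
  ultimately have "card {y \<in> SL2_mod p. int p dvd y$1$1} = card ({0..<int p} \<times> H)"
    by (simp add: card_image)
  also have "\<dots> = p * (p - 1)" using card_hyperbola[OF p not_dvd_neg1[OF p]]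
    by (simp add: card_cartesian_product H_def)
  finally show ?thesis .
qed

lemma card_SL2_mod:
  assumes p: "prime (p::nat)"
  shows "real (card (SL2_mod p)) = real p * ((real p)\<^sup>2 - 1)"
proof -
  let ?I = "{0..<int p}"
  define S where "S = {q \<in> ((?I - {0}) \<times> (?I \<times> ?I)) \<times> ?I.
    [fst (fst q) * snd q = 1 + fst (snd (fst q)) * snd (snd (fst q))] (mod int p)}"
  have eq: "[x - y = 1] (mod int p) \<longleftrightarrow> [x = 1 + y] (mod int p)" for x y
    by (simp add: cong_iff_dvd_diff algebra_simps)
  have "{y \<in> SL2_mod p. \<not> int p dvd y$1$1} = (\<lambda>((a, (b, c)), d). mat2 a b c d) ` S"
  proof safe
    fix y assume y: "y \<in> SL2_mod p" "\<not> int p dvd y$1$1"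
    then show "y \<in> (\<lambda>((a, (b, c)), d). mat2 a b c d) ` S"
      using SL2_mod_det[OF y(1)] SL2_mod_range[OF y(1)] mat2_eta[of y]
      by (intro image_eqI[of _ _ "((y$1$1, (y$1$2, y$2$1)), y$2$2)"]) (auto simp: S_def eq)
  qed (auto intro!: mat2_in_SL2_mod simp: S_def eq dvd_res)
  moreover have "inj_on (\<lambda>((a, (b, c)), d). mat2 a b c d) S"
    by (auto simp: inj_on_def imat_eq_iff)
  ultimately have "card {y \<in> SL2_mod p. \<not> int p dvd y$1$1} = card S"
    by (simp add: card_image)
  also have "card S = (\<Sum>u\<in>(?I - {0}) \<times> (?I \<times> ?I). card {d\<in>?I. [fst u * d = 1 + fst (snd u) * snd (snd u)] (mod int p)})"
    unfolding S_def by (rule card_filter_Times) auto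
  also have "\<dots> = (\<Sum>u\<in>(?I - {0}) \<times> (?I \<times> ?I). 1)"
    by (intro sum.cong refl card_solve_linear[OF p]) (auto simp: dvd_res)
  also have "\<dots> = (p - 1) * (p * p)" using prime_gt_0_nat[OF p] by (simp add: card_cartesian_product card_Diff_subset)
  finally have 1: "card {y \<in> SL2_mod p. \<not> int p dvd y$1$1} = (p - 1) * (p * p)" .
  have "SL2_mod p = {y \<in> SL2_mod p. int p dvd y$1$1} \<union> {y \<in> SL2_mod p. \<not> int p dvd y$1$1}" by auto
  then have "card (SL2_mod p) = card {y \<in> SL2_mod p. int p dvd y$1$1} + card {y \<in> SL2_mod p. \<not> int p dvd y$1$1}"
    by (metis (no_types, lifting) card_Un_disjoint disjoint_iff finite_SL2_mod finite_Un mem_Collect_eq)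
  also have "\<dots> = p * (p - 1) + (p - 1) * (p * p)" using 1 card_corner_zero[OF p] by simp
  finally show ?thesis using prime_gt_0_nat[OF p] by (simp add: of_nat_diff algebra_simps power2_eq_square)
qed

text \<open>The value l y v for the row vector l = (l1, l2) and the column vector v = (v1, v2). Its
  vanishing modulo p says that \<open>y\<close> moves the point v of the projective line to the zero
  of the linear form l.\<close>

definition bil :: "int \<Rightarrow> int \<Rightarrow> int \<Rightarrow> int \<Rightarrow> imat \<Rightarrow> int" where
  "bil l1 l2 v1 v2 y = l1 * (y$1$1 * v1 + y$1$2 * v2) + l2 * (y$2$1 * v1 + y$2$2 * v2)"

lemma bil_mcong: "mat_cong p x y \<Longrightarrow> int p dvd bil l1 l2 v1 v2 x \<longleftrightarrow> int p dvd bil l1 l2 v1 v2 y"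
proof -
  assume "mat_cong p x y"
  then have "[bil l1 l2 v1 v2 x = bil l1 l2 v1 v2 y] (mod int p)"
    unfolding bil_def by (intro cong_add cong_mult cong_refl) (auto simp: mat_cong_def)
  then show ?thesis by (rule cong_dvd_iff)
qed

lemma complete_row:
  assumes "prime (p::nat)" "\<not> (int p dvd l1 \<and> int p dvd l2)"
  obtains m1 m2 where "[l1 * m2 - l2 * m1 = 1] (mod int p)"
proof (cases "int p dvd l1")
  case False
  then obtain b where "[l1 * b = 1] (mod int p)" using prime_inverse assms(1) by blast
  then show ?thesis using that[of b 0] by simp
next
  case True
  then have "\<not> int p dvd l2" using assms by auto
  then obtain b where "[l2 * b = 1] (mod int p)" using prime_inverse assms(1) by blast
  then show ?thesis using that[of 0 "- b"] by simp
qed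

text \<open>Complete l to the first row of \<open>g\<close> and v to the first column of
  \<open>h\<close>, both of determinant 1: the form becomes the corner of
  \<open>g ** y ** h\<close>, and translation by \<open>g\<close> and \<open>h\<close> permutes the
  group.\<close>

lemma card_bil:
  assumes p: "prime (p::nat)" and l: "\<not> (int p dvd l1 \<and> int p dvd l2)" and v: "\<not> (int p dvd v1 \<and> int p dvd v2)"
  shows "card {y \<in> SL2_mod p. int p dvd bil l1 l2 v1 v2 y} = p * (p - 1)"
proof -
  obtain m1 m2 where m: "[l1 * m2 - l2 * m1 = 1] (mod int p)" using complete_row[OF p l] by blast
  obtain u1 u2 where u: "[v1 * u2 - v2 * u1 = 1] (mod int p)" using complete_row[OF p v] by blast
  define g h where "g = mat2 l1 l2 m1 m2" and "h = mat2 v1 u1 v2 u2"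
  have gh: "[det g = 1] (mod int p)" "[det h = 1] (mod int p)" using m u by (simp_all add: g_def h_def det_2 mult_ac)
  have "bil l1 l2 v1 v2 y = (g ** y ** h)$1$1" for y
    by (simp add: bil_def g_def h_def algebra_simps)
  then have "card {y \<in> SL2_mod p. int p dvd bil l1 l2 v1 v2 y} = card {y \<in> SL2_mod p. int p dvd (g ** y ** h)$1$1}" by simp
  also have "\<dots> = card {y \<in> SL2_mod p. int p dvd y$1$1}"
    using prime_gt_0_nat[OF p] gh by (intro card_translate[where P = "\<lambda>y. int p dvd y$1$1"]) (auto simp: mat_cong_dvd)
  finally show ?thesis using card_corner_zero[OF p] by simp
qed

text \<open>Two-transitivity: independent rows and independent columns complete each other. After
  rescaling the second ones by inverses \<open>s\<close> and \<open>t\<close> of the determinants,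
  the two conditions say that both diagonal entries of \<open>g ** y ** h\<close> vanish.\<close>

lemma card_bil2:
  assumes p: "prime (p::nat)" and l: "\<not> int p dvd l1 * m2 - l2 * m1" and v: "\<not> int p dvd v1 * u2 - v2 * u1"
  shows "card {y \<in> SL2_mod p. int p dvd bil l1 l2 v1 v2 y \<and> int p dvd bil m1 m2 u1 u2 y} = p - 1"
proof -
  obtain s where s: "[(l1 * m2 - l2 * m1) * s = 1] (mod int p)" using prime_inverse[OF p l] by blast
  obtain t where t: "[(v1 * u2 - v2 * u1) * t = 1] (mod int p)" using prime_inverse[OF p v] by blast
  have nst: "\<not> int p dvd s" "\<not> int p dvd t"
    using s t p by (metis cong_dvd_iff dvd_mult prime_nat_int_transfer not_prime_unit)+
  define g h where "g = mat2 l1 l2 (s * m1) (s * m2)" and "h = mat2 v1 (t * u1) v2 (t * u2)"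
  have gh: "[det g = 1] (mod int p)" "[det h = 1] (mod int p)"
    using s t by (simp_all add: g_def h_def det_2 algebra_simps)
  have "bil l1 l2 v1 v2 y = (g ** y ** h)$1$1" for y
    by (simp add: bil_def g_def h_def algebra_simps)
  moreover have "int p dvd bil m1 m2 u1 u2 y \<longleftrightarrow> int p dvd (g ** y ** h)$2$2" for y
  proof -
    have "(g ** y ** h)$2$2 = s * (t * bil m1 m2 u1 u2 y)" by (simp add: bil_def g_def h_def algebra_simps)
    then show ?thesis using nst p by (simp add: prime_dvd_mult_int del: mm_entry)
  qed
  ultimately have "card {y \<in> SL2_mod p. int p dvd bil l1 l2 v1 v2 y \<and> int p dvd bil m1 m2 u1 u2 y}
    = card {y \<in> SL2_mod p. int p dvd (g ** y ** h)$1$1 \<and> int p dvd (g ** y ** h)$2$2}" by simp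
  also have "\<dots> = card {y \<in> SL2_mod p. int p dvd y$1$1 \<and> int p dvd y$2$2}"
    using prime_gt_0_nat[OF p] gh
    by (intro card_translate[where P = "\<lambda>y. int p dvd y$1$1 \<and> int p dvd y$2$2"]) (auto simp: mat_cong_dvd)
  finally show ?thesis using card_diagonal_zero[OF p] by simp
qed

lemma orthogonal_parallel:
  assumes p: "prime (p::nat)" and l: "\<not> (int p dvd l1 \<and> int p dvd l2)"
    and "int p dvd l1 * a1 + l2 * a2" "int p dvd l1 * b1 + l2 * b2"
  shows "int p dvd a1 * b2 - a2 * b1"
proof -
  have "l1 * (a1 * b2 - a2 * b1) = (l1 * a1 + l2 * a2) * b2 - (l1 * b1 + l2 * b2) * a2"
    "l2 * (a1 * b2 - a2 * b1) = (l1 * b1 + l2 * b2) * a1 - (l1 * a1 + l2 * a2) * b1"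
    by (simp_all add: algebra_simps)
  then have "int p dvd l1 * (a1 * b2 - a2 * b1)" "int p dvd l2 * (a1 * b2 - a2 * b1)"
    using assms(3,4) by simp_all
  then show ?thesis using l p by (auto simp: prime_dvd_mult_int)
qed

text \<open>Two independent vectors would both be sent by \<open>y\<close> into the kernel of the
  same linear form, which an invertible matrix cannot do.\<close>

lemma bil_mixed_left:
  assumes p: "prime (p::nat)" and y: "y \<in> SL2_mod p"
    and l: "\<not> (int p dvd l1 \<and> int p dvd l2)" and m: "\<not> (int p dvd m1 \<and> int p dvd m2)"
    and par: "int p dvd l1 * m2 - l2 * m1" and v: "\<not> int p dvd v1 * u2 - v2 * u1"
    and b: "int p dvd bil l1 l2 v1 v2 y" "int p dvd bil m1 m2 u1 u2 y"
  shows False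
proof -
  define a1 a2 b1 b2 where "a1 = y$1$1 * v1 + y$1$2 * v2" "a2 = y$2$1 * v1 + y$2$2 * v2"
    "b1 = y$1$1 * u1 + y$1$2 * u2" "b2 = y$2$1 * u1 + y$2$2 * u2"
  note ab = this
  have 1: "int p dvd l1 * a1 + l2 * a2" "int p dvd m1 * b1 + m2 * b2" using b by (simp_all add: bil_def ab)
  have "m1 * (l1 * b1 + l2 * b2) = l1 * (m1 * b1 + m2 * b2) - (l1 * m2 - l2 * m1) * b2"
    "m2 * (l1 * b1 + l2 * b2) = l2 * (m1 * b1 + m2 * b2) + (l1 * m2 - l2 * m1) * b1"
    by (simp_all add: algebra_simps)
  then have "int p dvd m1 * (l1 * b1 + l2 * b2)" "int p dvd m2 * (l1 * b1 + l2 * b2)"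
    using 1(2) par by simp_all
  then have "int p dvd l1 * b1 + l2 * b2" using m p by (auto simp: prime_dvd_mult_int)
  then have "int p dvd a1 * b2 - a2 * b1" using orthogonal_parallel[OF p l 1(1)] by blast
  also have "a1 * b2 - a2 * b1 = det y * (v1 * u2 - v2 * u1)" by (simp add: ab det_2 algebra_simps)
  finally have "int p dvd det y" using v p by (simp add: prime_dvd_mult_int)
  then show False using SL2_modD[OF y] p
    by (metis cong_dvd_iff not_prime_unit prime_nat_int_transfer)
qed

lemma transpose_SL2_mod: "y \<in> SL2_mod p \<Longrightarrow> transpose y \<in> SL2_mod p"
  by (auto simp: SL2_mod_def transpose_def det_2 mult.commute)

lemma bil_mixed_right:
  assumes p: "prime (p::nat)" and y: "y \<in> SL2_mod p"
    and v: "\<not> (int p dvd v1 \<and> int p dvd v2)" and u: "\<not> (int p dvd u1 \<and> int p dvd u2)"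
    and par: "int p dvd v1 * u2 - v2 * u1" and l: "\<not> int p dvd l1 * m2 - l2 * m1"
    and b: "int p dvd bil l1 l2 v1 v2 y" "int p dvd bil m1 m2 u1 u2 y"
  shows False
proof -
  have t: "bil l1 l2 v1 v2 y = bil v1 v2 l1 l2 (transpose y)" for l1 l2 v1 v2
    by (simp add: bil_def transpose_def algebra_simps)
  show False
    by (rule bil_mixed_left[OF p transpose_SL2_mod[OF y] v u par l]) (use b in \<open>simp_all add: t\<close>)
qed

section \<open>Tensor products of operators\<close>

lemma sum_PiE_insert:
  assumes "x \<notin> S"
  shows "(\<Sum>f\<in>Pi\<^sub>E (insert x S) T. h f) = (\<Sum>y\<in>T x. \<Sum>g\<in>Pi\<^sub>E S T. h (g(x := y)))"
proof -
  have "(\<Sum>f\<in>Pi\<^sub>E (insert x S) T. h f) = (\<Sum>(y, g)\<in>T x \<times> Pi\<^sub>E S T. h (g(x := y)))"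
    unfolding PiE_insert_eq by (subst sum.reindex[OF inj_combinator[OF assms]]) (simp add: case_prod_unfold)
  then show ?thesis by (simp add: sum.cartesian_product)
qed

text \<open>In the induction one coordinate b at \<open>p\<close> is held fixed, and the hypothesis
  for the other primes is applied to the partial sum over the coordinate a at \<open>p\<close>; then
  the local bound at \<open>p\<close> is used for each remaining index.\<close>

lemma tensor_opnorm:
  fixes K :: "'i \<Rightarrow> 'b \<Rightarrow> 'a \<Rightarrow> real"
  assumes "finite P" and "\<And>p. p \<in> P \<Longrightarrow> 0 \<le> C p"
    and "\<And>p \<nu>. p \<in> P \<Longrightarrow> (\<Sum>b\<in>B p. (\<Sum>a\<in>A p. K p b a * \<nu> a)\<^sup>2) \<le> C p * (\<Sum>a\<in>A p. (\<nu> a)\<^sup>2)"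
  shows "(\<Sum>b\<in>Pi\<^sub>E P B. (\<Sum>a\<in>Pi\<^sub>E P A. (\<Prod>p\<in>P. K p (b p) (a p)) * \<nu> a)\<^sup>2)
     \<le> (\<Prod>p\<in>P. C p) * (\<Sum>a\<in>Pi\<^sub>E P A. (\<nu> a)\<^sup>2)"
  using assms
proof (induction P arbitrary: \<nu> rule: finite_induct)
  case empty
  then show ?case by simp
next
  case (insert p P)
  have CP: "(\<Prod>p\<in>P. C p) \<ge> 0" using insert.prems by (intro prod_nonneg) auto
  have eq: "(\<Prod>q\<in>insert p P. K q ((g(p := b)) q) ((k(p := a)) q)) = K p b a * (\<Prod>q\<in>P. K q (g q) (k q))" for g b k a
  proof -
    have "(\<Prod>q\<in>P. K q ((g(p := b)) q) ((k(p := a)) q)) = (\<Prod>q\<in>P. K q (g q) (k q))"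
      using insert.hyps by (intro prod.cong) auto
    then show ?thesis using insert.hyps by simp
  qed
  have "(\<Sum>b\<in>Pi\<^sub>E (insert p P) B. (\<Sum>a\<in>Pi\<^sub>E (insert p P) A. (\<Prod>p\<in>insert p P. K p (b p) (a p)) * \<nu> a)\<^sup>2)
    = (\<Sum>b\<in>B p. \<Sum>g\<in>Pi\<^sub>E P B. (\<Sum>a\<in>A p. \<Sum>k\<in>Pi\<^sub>E P A. K p b a * (\<Prod>q\<in>P. K q (g q) (k q)) * \<nu> (k(p := a)))\<^sup>2)"
    unfolding sum_PiE_insert[OF insert.hyps(2)] eq ..
  also have "\<dots> = (\<Sum>b\<in>B p. \<Sum>g\<in>Pi\<^sub>E P B. (\<Sum>k\<in>Pi\<^sub>E P A. (\<Prod>q\<in>P. K q (g q) (k q)) * (\<Sum>a\<in>A p. K p b a * \<nu> (k(p := a))))\<^sup>2)"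
    by (subst sum.swap) (simp add: sum_distrib_left mult_ac)
  also have "\<dots> \<le> (\<Sum>b\<in>B p. (\<Prod>p\<in>P. C p) * (\<Sum>k\<in>Pi\<^sub>E P A. (\<Sum>a\<in>A p. K p b a * \<nu> (k(p := a)))\<^sup>2))"
    using insert.prems by (intro sum_mono insert.IH) auto
  also have "\<dots> = (\<Prod>p\<in>P. C p) * (\<Sum>k\<in>Pi\<^sub>E P A. \<Sum>b\<in>B p. (\<Sum>a\<in>A p. K p b a * \<nu> (k(p := a)))\<^sup>2)"
    unfolding sum_distrib_left[symmetric] by (subst sum.swap) (rule refl)
  also have "\<dots> \<le> (\<Prod>p\<in>P. C p) * (\<Sum>k\<in>Pi\<^sub>E P A. C p * (\<Sum>a\<in>A p. (\<nu> (k(p := a)))\<^sup>2))"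
    using CP insert.prems(2)[of p] by (intro mult_left_mono sum_mono) auto
  also have "\<dots> = (\<Prod>p\<in>insert p P. C p) * (\<Sum>a\<in>Pi\<^sub>E (insert p P) A. (\<nu> a)\<^sup>2)"
    unfolding sum_PiE_insert[OF insert.hyps(2)] using insert.hyps
    by (subst sum.swap) (simp add: sum_distrib_left mult_ac)
  finally show ?case .
qed

lemma sum_fibre_card_squared:
  assumes "finite S" "finite T" "g ` S \<subseteq> T"
  shows "(\<Sum>t\<in>T. (real (card {x\<in>S. g x = t}))\<^sup>2) = real (card {(x, y) \<in> S \<times> S. g x = g y})"
proof -
  have "{(x, y) \<in> S \<times> S. g x = g y} = Sigma S (\<lambda>x. {y\<in>S. g y = g x})" by auto
  then have "real (card {(x, y) \<in> S \<times> S. g x = g y}) = (\<Sum>x\<in>S. real (card {y\<in>S. g y = g x}))"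
    using assms by (simp add: card_SigmaI)
  also have "\<dots> = (\<Sum>t\<in>T. \<Sum>x\<in>{x\<in>S. g x = t}. real (card {y\<in>S. g y = g x}))"
    using sum.group[OF assms, of "\<lambda>x. real (card {y\<in>S. g y = g x})"] by simp
  also have "\<dots> = (\<Sum>t\<in>T. (real (card {x\<in>S. g x = t}))\<^sup>2)"
    by (intro sum.cong) (auto simp: power2_eq_square)
  finally show ?thesis by simp
qed

text \<open>Push both counting measures forward to the finite sets, apply Cauchy-Schwarz in b and
  then the operator bound. The squared norm of a pushed forward counting measure is its number of
  colliding pairs, which for \<open>Ybox\<close> is the quantity bounded by
  \<open>Ybox_pairs_bound\<close>.\<close>

lemma bilinear_pushforward:
  fixes K :: "'b \<Rightarrow> 'a \<Rightarrow> real"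
  assumes fin: "finite Y" "finite U" "finite A" "finite B" and sub: "\<phi> ` Y \<subseteq> B" "\<psi> ` U \<subseteq> A"
    and op: "\<And>\<nu>. (\<Sum>b\<in>B. (\<Sum>a\<in>A. K b a * \<nu> a)\<^sup>2) \<le> C * (\<Sum>a\<in>A. (\<nu> a)\<^sup>2)"
  shows "(\<Sum>y\<in>Y. \<Sum>u\<in>U. K (\<phi> y) (\<psi> u))\<^sup>2
    \<le> C * real (card {(y, y') \<in> Y \<times> Y. \<phi> y = \<phi> y'}) * real (card {(u, u') \<in> U \<times> U. \<psi> u = \<psi> u'})"
proof -
  define n where "n b = real (card {y\<in>Y. \<phi> y = b})" for b
  define \<nu> where "\<nu> a = real (card {u\<in>U. \<psi> u = a})" for a
  have 1: "(\<Sum>u\<in>U. K b (\<psi> u)) = (\<Sum>a\<in>A. K b a * \<nu> a)" for b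
    by (subst sum.group[OF fin(2,3) sub(2), symmetric]) (auto simp: \<nu>_def mult.commute intro!: sum.cong)
  have "(\<Sum>y\<in>Y. \<Sum>u\<in>U. K (\<phi> y) (\<psi> u)) = (\<Sum>y\<in>Y. \<Sum>a\<in>A. K (\<phi> y) a * \<nu> a)"
    by (simp add: 1)
  also have "\<dots> = (\<Sum>b\<in>B. n b * (\<Sum>a\<in>A. K b a * \<nu> a))"
    by (subst sum.group[OF fin(1,4) sub(1), symmetric]) (auto simp: n_def intro!: sum.cong)
  finally have "(\<Sum>y\<in>Y. \<Sum>u\<in>U. K (\<phi> y) (\<psi> u))\<^sup>2 = (\<Sum>b\<in>B. n b * (\<Sum>a\<in>A. K b a * \<nu> a))\<^sup>2" by simp
  also have "\<dots> \<le> (\<Sum>b\<in>B. (n b)\<^sup>2) * (\<Sum>b\<in>B. (\<Sum>a\<in>A. K b a * \<nu> a)\<^sup>2)"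
    by (rule Cauchy_Schwarz_ineq_sum)
  also have "\<dots> \<le> (\<Sum>b\<in>B. (n b)\<^sup>2) * (C * (\<Sum>a\<in>A. (\<nu> a)\<^sup>2))"
    by (intro mult_left_mono op sum_nonneg) auto
  also have "(\<Sum>b\<in>B. (n b)\<^sup>2) = real (card {(y, y') \<in> Y \<times> Y. \<phi> y = \<phi> y'})"
    unfolding n_def using sum_fibre_card_squared[OF fin(1,4) sub(1)] .
  also have "(\<Sum>a\<in>A. (\<nu> a)\<^sup>2) = real (card {(u, u') \<in> U \<times> U. \<psi> u = \<psi> u'})"
    unfolding \<nu>_def using sum_fibre_card_squared[OF fin(2,3) sub(2)] .
  finally show ?thesis by (simp add: mult_ac)
qed

section \<open>Operator norms over \<open>SL\<^sub>2(F\<^sub>p)\<close>\<close>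

text \<open>The Schur test for the Gram matrix of the columns of \<open>K\<close>. Absolute values
  are taken only after summing over b, so cancellation in b survives; this is what distinguishes it
  from \<open>schur_test\<close>.\<close>

lemma schur_gram:
  fixes K :: "'b \<Rightarrow> 'a \<Rightarrow> real"
  assumes "\<And>a. a \<in> A \<Longrightarrow> (\<Sum>a'\<in>A. \<bar>\<Sum>b\<in>B. K b a * K b a'\<bar>) \<le> M"
  shows "(\<Sum>b\<in>B. (\<Sum>a\<in>A. K b a * \<nu> a)\<^sup>2) \<le> M * (\<Sum>a\<in>A. (\<nu> a)\<^sup>2)"
proof -
  define T where "T a a' = (\<Sum>b\<in>B. K b a * K b a')" for a a'
  have sym: "T a a' = T a' a" for a a' by (simp add: T_def mult.commute)
  have "(\<Sum>b\<in>B. (\<Sum>a\<in>A. K b a * \<nu> a)\<^sup>2) = (\<Sum>b\<in>B. \<Sum>a\<in>A. \<Sum>a'\<in>A. (K b a * K b a') * (\<nu> a * \<nu> a'))"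
    unfolding power2_eq_square sum_product by (intro sum.cong) auto
  also have "\<dots> = (\<Sum>a\<in>A. \<Sum>b\<in>B. \<Sum>a'\<in>A. (K b a * K b a') * (\<nu> a * \<nu> a'))"
    by (rule sum.swap)
  also have "\<dots> = (\<Sum>a\<in>A. \<Sum>a'\<in>A. T a a' * (\<nu> a * \<nu> a'))"
    unfolding T_def sum_distrib_right by (intro sum.cong sum.swap) auto
  also have "\<dots> \<le> (\<Sum>a\<in>A. \<Sum>a'\<in>A. \<bar>T a a'\<bar> * (((\<nu> a)\<^sup>2 + (\<nu> a')\<^sup>2) / 2))"
  proof (intro sum_mono)
    fix a a'
    have "\<bar>\<nu> a * \<nu> a'\<bar> \<le> ((\<nu> a)\<^sup>2 + (\<nu> a')\<^sup>2) / 2"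
      using sum_squares_bound[of "\<bar>\<nu> a\<bar>" "\<bar>\<nu> a'\<bar>"] by (simp add: abs_mult)
    then have "\<bar>T a a'\<bar> * \<bar>\<nu> a * \<nu> a'\<bar> \<le> \<bar>T a a'\<bar> * (((\<nu> a)\<^sup>2 + (\<nu> a')\<^sup>2) / 2)"
      by (intro mult_left_mono) auto
    then show "T a a' * (\<nu> a * \<nu> a') \<le> \<bar>T a a'\<bar> * (((\<nu> a)\<^sup>2 + (\<nu> a')\<^sup>2) / 2)"
      by (metis abs_ge_self abs_mult order_trans)
  qed
  also have "\<dots> = (\<Sum>a\<in>A. \<Sum>a'\<in>A. \<bar>T a a'\<bar> * (\<nu> a)\<^sup>2 / 2) + (\<Sum>a\<in>A. \<Sum>a'\<in>A. \<bar>T a a'\<bar> * (\<nu> a')\<^sup>2 / 2)"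
    by (simp add: distrib_left add_divide_distrib sum.distrib)
  also have "(\<Sum>a\<in>A. \<Sum>a'\<in>A. \<bar>T a a'\<bar> * (\<nu> a')\<^sup>2 / 2) = (\<Sum>a\<in>A. \<Sum>a'\<in>A. \<bar>T a a'\<bar> * (\<nu> a)\<^sup>2 / 2)"
    by (subst sum.swap) (simp add: sym[symmetric])
  also have "(\<Sum>a\<in>A. \<Sum>a'\<in>A. \<bar>T a a'\<bar> * (\<nu> a)\<^sup>2 / 2) + \<dots> = (\<Sum>a\<in>A. (\<Sum>a'\<in>A. \<bar>T a a'\<bar>) * (\<nu> a)\<^sup>2)"
    by (simp add: sum.distrib[symmetric] sum_distrib_right)
  also have "\<dots> \<le> (\<Sum>a\<in>A. M * (\<nu> a)\<^sup>2)"
    using assms by (intro sum_mono mult_right_mono) (auto simp: T_def)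
  finally show ?thesis by (simp add: sum_distrib_left)
qed

lemma schur_test:
  fixes K :: "'b \<Rightarrow> 'a \<Rightarrow> real"
  assumes r: "\<And>b. b \<in> B \<Longrightarrow> (\<Sum>a\<in>A. \<bar>K b a\<bar>) \<le> r" and c: "\<And>a. a \<in> A \<Longrightarrow> (\<Sum>b\<in>B. \<bar>K b a\<bar>) \<le> c"
    and r0: "r \<ge> 0"
  shows "(\<Sum>b\<in>B. (\<Sum>a\<in>A. K b a * \<nu> a)\<^sup>2) \<le> r * c * (\<Sum>a\<in>A. (\<nu> a)\<^sup>2)"
proof (rule schur_gram)
  fix a assume a: "a \<in> A"
  have "(\<Sum>a'\<in>A. \<bar>\<Sum>b\<in>B. K b a * K b a'\<bar>) \<le> (\<Sum>a'\<in>A. \<Sum>b\<in>B. \<bar>K b a\<bar> * \<bar>K b a'\<bar>)"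
    by (intro sum_mono order_trans[OF sum_abs]) (simp add: abs_mult)
  also have "\<dots> = (\<Sum>b\<in>B. \<bar>K b a\<bar> * (\<Sum>a'\<in>A. \<bar>K b a'\<bar>))"
    by (subst sum.swap) (simp add: sum_distrib_left)
  also have "\<dots> \<le> (\<Sum>b\<in>B. \<bar>K b a\<bar> * r)" by (intro sum_mono mult_left_mono r) auto
  also have "\<dots> = (\<Sum>b\<in>B. \<bar>K b a\<bar>) * r" by (simp add: sum_distrib_right)
  also have "\<dots> \<le> c * r" using c[OF a] r0 by (intro mult_right_mono) auto
  finally show "(\<Sum>a'\<in>A. \<bar>\<Sum>b\<in>B. K b a * K b a'\<bar>) \<le> r * c" by (simp add: mult.commute)
qed

text \<open>\<open>opnorm_le p F B\<close> bounds by \<open>B\<close> the square of the norm of the operator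
  \<open>\<nu> \<mapsto> (y \<mapsto> \<Sum>\<^sub>x\<^sub>,\<^sub>z F(x y z) \<nu>(x, z))\<close> from \<open>L\<^sup>2(G \<times> G)\<close> to \<open>L\<^sup>2(G)\<close>, where \<open>G = SL\<^sub>2(F\<^sub>p)\<close>.\<close>

definition opnorm_le :: "nat \<Rightarrow> (imat \<Rightarrow> real) \<Rightarrow> real \<Rightarrow> bool" where
  "opnorm_le p F B \<longleftrightarrow> (\<forall>\<nu>. (\<Sum>y\<in>SL2_mod p. (\<Sum>a\<in>SL2_mod p \<times> SL2_mod p. F (fst a ** y ** snd a) * \<nu> a)\<^sup>2)
     \<le> B * (\<Sum>a\<in>SL2_mod p \<times> SL2_mod p. (\<nu> a)\<^sup>2))"

definition periodic :: "nat \<Rightarrow> (imat \<Rightarrow> 'a) \<Rightarrow> bool" where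
  "periodic p F \<longleftrightarrow> (\<forall>x y. mat_cong p x y \<longrightarrow> F x = F y)"

lemma opnorm_le_mono: "opnorm_le p F B \<Longrightarrow> B \<le> B' \<Longrightarrow> opnorm_le p F B'"
  unfolding opnorm_le_def by (meson mult_right_mono order_trans sum_nonneg zero_le_power2)

lemma opnorm_le_add:
  assumes "opnorm_le p F B" "opnorm_le p F' B'"
  shows "opnorm_le p (\<lambda>x. F x + F' x) (2 * (B + B'))"
  unfolding opnorm_le_def
proof
  fix \<nu>
  let ?G = "SL2_mod p"
  define u where "u y = (\<Sum>a\<in>?G \<times> ?G. F (fst a ** y ** snd a) * \<nu> a)" for y
  define v where "v y = (\<Sum>a\<in>?G \<times> ?G. F' (fst a ** y ** snd a) * \<nu> a)" for y
  have "(\<Sum>y\<in>?G. (\<Sum>a\<in>?G \<times> ?G. (F (fst a ** y ** snd a) + F' (fst a ** y ** snd a)) * \<nu> a)\<^sup>2) = (\<Sum>y\<in>?G. (u y + v y)\<^sup>2)"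
    by (simp add: u_def v_def distrib_right sum.distrib)
  also have "\<dots> \<le> (\<Sum>y\<in>?G. 2 * (u y)\<^sup>2 + 2 * (v y)\<^sup>2)"
  proof (rule sum_mono)
    fix y have "0 \<le> (u y - v y)\<^sup>2" by simp
    then show "(u y + v y)\<^sup>2 \<le> 2 * (u y)\<^sup>2 + 2 * (v y)\<^sup>2" by (simp add: power2_eq_square algebra_simps)
  qed
  also have "\<dots> = 2 * (\<Sum>y\<in>?G. (u y)\<^sup>2) + 2 * (\<Sum>y\<in>?G. (v y)\<^sup>2)" by (simp add: sum.distrib sum_distrib_left)
  also have "\<dots> \<le> 2 * (B * (\<Sum>a\<in>?G \<times> ?G. (\<nu> a)\<^sup>2)) + 2 * (B' * (\<Sum>a\<in>?G \<times> ?G. (\<nu> a)\<^sup>2))"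
    using assms unfolding opnorm_le_def u_def v_def by (intro add_mono mult_left_mono) auto
  finally show "(\<Sum>y\<in>?G. (\<Sum>a\<in>?G \<times> ?G. (F (fst a ** y ** snd a) + F' (fst a ** y ** snd a)) * \<nu> a)\<^sup>2)
     \<le> 2 * (B + B') * (\<Sum>a\<in>?G \<times> ?G. (\<nu> a)\<^sup>2)" by (simp add: algebra_simps)
qed

lemma card_SL2_mod_le: "prime p \<Longrightarrow> real (card (SL2_mod p)) \<le> real p ^ 3"
  unfolding card_SL2_mod by (simp add: algebra_simps power2_eq_square power3_eq_cube)

text \<open>By translation invariance each column sum is at most \<open>s\<close>, while a row sum
  runs over pairs and gains the order of the group, at most p^3. This is the bound without
  cancellation.\<close>

lemma opnorm_le_schur:
  assumes p: "prime (p::nat)" and F: "periodic p F" and s: "(\<Sum>y\<in>SL2_mod p. \<bar>F y\<bar>) \<le> s"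
  shows "opnorm_le p F (real p ^ 3 * s\<^sup>2)"
proof -
  let ?G = "SL2_mod p"
  have p0: "p > 0" using p prime_gt_0_nat by auto
  have per: "\<bar>F x\<bar> = \<bar>F y\<bar>" if "mat_cong p x y" for x y using F that by (auto simp: periodic_def)
  have s0: "0 \<le> s" using s by (meson abs_ge_zero order_trans sum_nonneg)
  have cl: "(\<Sum>y\<in>?G. \<bar>F (g ** y ** h)\<bar>) \<le> s" if "[det g = 1] (mod int p)" "[det h = 1] (mod int p)" for g h
    using sum_translate[OF p0 that, of "\<lambda>x. \<bar>F x\<bar>"] per s by simp
  have "(\<Sum>y\<in>?G. (\<Sum>a\<in>?G \<times> ?G. F (fst a ** y ** snd a) * \<nu> a)\<^sup>2)
      \<le> (real p ^ 3 * s) * s * (\<Sum>a\<in>?G \<times> ?G. (\<nu> a)\<^sup>2)" for \<nu>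
  proof (rule schur_test)
    fix y assume y: "y \<in> ?G"
    have "(\<Sum>a\<in>?G \<times> ?G. \<bar>F (fst a ** y ** snd a)\<bar>) = (\<Sum>x\<in>?G. \<Sum>z\<in>?G. \<bar>F ((x ** y) ** z ** mat 1)\<bar>)"
      by (simp add: sum.cartesian_product case_prod_unfold del: mm_entry)
    also have "\<dots> \<le> (\<Sum>x\<in>?G. s)"
    proof (intro sum_mono cl)
      fix x assume x: "x \<in> ?G"
      have "[det x * det y = 1 * 1] (mod int p)" using x y by (intro cong_mult SL2_modD)
      then show "[det (x ** y) = 1] (mod int p)" by (simp add: det_mul)
    qed (simp add: det_2)
    also have "\<dots> \<le> real p ^ 3 * s" using card_SL2_mod_le[OF p] s0 by (simp add: mult_right_mono)
    finally show "(\<Sum>a\<in>?G \<times> ?G. \<bar>F (fst a ** y ** snd a)\<bar>) \<le> real p ^ 3 * s" .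
  next
    fix a assume "a \<in> ?G \<times> ?G"
    then show "(\<Sum>b\<in>?G. \<bar>F (fst a ** b ** snd a)\<bar>) \<le> s" by (intro cl) (auto intro: SL2_modD)
  qed (use s0 in simp)
  then show ?thesis by (simp add: opnorm_le_def power2_eq_square mult.assoc)
qed

text \<open>1 / (p + 1) is the density of one incidence condition, so the Gram entry is N - E with N
  the number of common solutions and E = p (p - 1) / (p + 1) its expected value. For two transversal
  conditions N = p - 1, and the difference (p - 1) / (p + 1) is below 1: this is the cancellation.
  If only the forms or only the vectors are parallel, N = 0 and E \<le> p; if both are, N \<le>
  p^2.\<close>

lemma gram_bil:
  assumes p: "prime (p::nat)"
    and l: "\<not> (int p dvd l1 \<and> int p dvd l2)" and m: "\<not> (int p dvd m1 \<and> int p dvd m2)"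
    and v: "\<not> (int p dvd v1 \<and> int p dvd v2)" and u: "\<not> (int p dvd u1 \<and> int p dvd u2)"
  defines "k \<equiv> \<lambda>l1 l2 v1 v2 y. (if int p dvd bil l1 l2 v1 v2 y then 1 else 0) - 1 / (real p + 1)"
  shows "\<bar>\<Sum>y\<in>SL2_mod p. k l1 l2 v1 v2 y * k m1 m2 u1 u2 y\<bar>
    \<le> (if int p dvd l1 * m2 - l2 * m1 then real p else 1) * (if int p dvd v1 * u2 - v2 * u1 then real p else 1)"
proof -
  let ?G = "SL2_mod p"
  define e where "e = 1 / (real p + 1)"
  define N where "N = real (card {y\<in>?G. int p dvd bil l1 l2 v1 v2 y \<and> int p dvd bil m1 m2 u1 u2 y})"
  have p2: "real p \<ge> 2" using prime_ge_2_nat[OF p] by simp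
  define i j where "i y = (if int p dvd bil l1 l2 v1 v2 y then 1 else 0 :: real)"
    and "j y = (if int p dvd bil m1 m2 u1 u2 y then 1 else 0 :: real)" for y
  have i: "(\<Sum>y\<in>?G. i y) = real p * (real p - 1)"
    using card_bil[OF p l v] p2 unfolding i_def by (simp add: sum.If_cases Int_def of_nat_diff)
  have j: "(\<Sum>y\<in>?G. j y) = real p * (real p - 1)"
    using card_bil[OF p m u] p2 unfolding j_def by (simp add: sum.If_cases Int_def of_nat_diff)
  have ij: "(\<Sum>y\<in>?G. i y * j y) = N"
  proof -
    have "(\<Sum>y\<in>?G. i y * j y) = (\<Sum>y\<in>?G. if int p dvd bil l1 l2 v1 v2 y \<and> int p dvd bil m1 m2 u1 u2 y then 1 else 0)"
      by (intro sum.cong) (auto simp: i_def j_def)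
    then show ?thesis by (simp add: N_def sum.If_cases Int_def)
  qed
  have "(\<Sum>y\<in>?G. k l1 l2 v1 v2 y * k m1 m2 u1 u2 y) = (\<Sum>y\<in>?G. i y * j y - e * i y - e * j y + e * e)"
    unfolding k_def i_def j_def e_def by (intro sum.cong refl) (simp only: algebra_simps)
  also have "\<dots> = N - e * (real p * (real p - 1)) - e * (real p * (real p - 1)) + e * e * (real p * ((real p)\<^sup>2 - 1))"
    by (simp add: sum.distrib sum_subtractf i j ij sum_distrib_left[symmetric] card_SL2_mod[OF p])
  also have "e * e * (real p * ((real p)\<^sup>2 - 1)) = e * (real p * (real p - 1))"
  proof -
    have "e * (real p + 1) = 1" using p2 by (simp add: e_def)
    moreover have "e * e * (real p * ((real p)\<^sup>2 - 1)) = e * (real p * (real p - 1)) * (e * (real p + 1))"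
      by (simp add: power2_eq_square algebra_simps)
    ultimately show ?thesis by simp
  qed
  finally have T: "(\<Sum>y\<in>?G. k l1 l2 v1 v2 y * k m1 m2 u1 u2 y) = N - e * (real p * (real p - 1))" by simp
  define E where "E = e * (real p * (real p - 1))"
  have E: "0 \<le> E" "E \<le> real p" "real p - 1 - E \<le> 1" "0 \<le> real p - 1 - E"
    using p2 unfolding E_def e_def by (auto simp: field_simps)
  note T = T[folded E_def]
  show ?thesis
  proof (cases "int p dvd l1 * m2 - l2 * m1"; cases "int p dvd v1 * u2 - v2 * u1")
    assume 1: "int p dvd l1 * m2 - l2 * m1" "int p dvd v1 * u2 - v2 * u1"
    have "N \<le> (\<Sum>y\<in>?G. i y)" unfolding ij[symmetric] by (intro sum_mono) (auto simp: i_def j_def)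
    then have "N \<le> real p * real p" using p2 i by (simp add: algebra_simps)
    moreover have "N \<ge> 0" by (simp add: N_def)
    moreover have "real p \<le> real p * real p" using p2 by simp
    ultimately have "\<bar>N - E\<bar> \<le> real p * real p" using E by linarith
    then show ?thesis unfolding T using 1 by simp
  next
    assume 1: "int p dvd l1 * m2 - l2 * m1" "\<not> int p dvd v1 * u2 - v2 * u1"
    have "N = 0" unfolding N_def using bil_mixed_left[OF p _ l m 1] by (simp add: card_eq_0_iff) blast
    then have "\<bar>N - E\<bar> \<le> real p" using E by linarith
    then show ?thesis unfolding T using 1 by simp
  next
    assume 1: "\<not> int p dvd l1 * m2 - l2 * m1" "int p dvd v1 * u2 - v2 * u1"
    have "N = 0" unfolding N_def using bil_mixed_right[OF p _ v u 1(2,1)] by (simp add: card_eq_0_iff) blast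
    then have "\<bar>N - E\<bar> \<le> real p" using E by linarith
    then show ?thesis unfolding T using 1 by simp
  next
    assume 1: "\<not> int p dvd l1 * m2 - l2 * m1" "\<not> int p dvd v1 * u2 - v2 * u1"
    have "N = real p - 1" unfolding N_def using card_bil2[OF p 1] p2 by (simp add: of_nat_diff)
    then have "\<bar>N - E\<bar> \<le> 1" using E by linarith
    then show ?thesis unfolding T using 1 by simp
  qed
qed

lemma row_nonzero:
  fixes x :: imat
  assumes p: "prime (p::nat)" and x: "[det x = 1] (mod int p)" and l: "\<not> (int p dvd l1 \<and> int p dvd l2)"
  shows "\<not> (int p dvd l1 * x$1$1 + l2 * x$2$1 \<and> int p dvd l1 * x$1$2 + l2 * x$2$2)"
proof
  assume "int p dvd l1 * x$1$1 + l2 * x$2$1 \<and> int p dvd l1 * x$1$2 + l2 * x$2$2"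
  moreover have "l1 * det x = (l1 * x$1$1 + l2 * x$2$1) * x$2$2 - (l1 * x$1$2 + l2 * x$2$2) * x$2$1"
    "l2 * det x = (l1 * x$1$2 + l2 * x$2$2) * x$1$1 - (l1 * x$1$1 + l2 * x$2$1) * x$1$2"
    by (simp_all add: det_2 algebra_simps)
  ultimately have "int p dvd l1 * det x" "int p dvd l2 * det x" by simp_all
  moreover have "\<not> int p dvd det x" using x p by (metis cong_dvd_iff not_prime_unit prime_nat_int_transfer)
  ultimately show False using l p by (simp add: prime_dvd_mult_int)
qed

lemma col_nonzero:
  fixes x :: imat
  assumes p: "prime (p::nat)" and x: "[det x = 1] (mod int p)" and v: "\<not> (int p dvd v1 \<and> int p dvd v2)"
  shows "\<not> (int p dvd x$1$1 * v1 + x$1$2 * v2 \<and> int p dvd x$2$1 * v1 + x$2$2 * v2)"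
  using row_nonzero[OF p, of "transpose x" v1 v2] x v by (simp add: transpose_def det_2 mult.commute)

text \<open>The factors \<open>x\<close> and \<open>z\<close> move l and v to l x and z v, so the
  Gram entries are those of \<open>gram_bil\<close>, with a bound that splits into a factor for x'
  and one for z'. Parallelism costs a factor p but has density about 1/p, so each factor sums to at
  most 2 p^3.\<close>

lemma opnorm_le_bil:
  assumes p: "prime (p::nat)"
    and l: "\<not> (int p dvd l1 \<and> int p dvd l2)" and v: "\<not> (int p dvd v1 \<and> int p dvd v2)"
  shows "opnorm_le p (\<lambda>y. (if int p dvd bil l1 l2 v1 v2 y then 1 else 0) - 1 / (real p + 1)) (4 * real p ^ 6)"
proof -
  let ?G = "SL2_mod p"
  define k where "k l1 l2 v1 v2 y = (if int p dvd bil l1 l2 v1 v2 y then 1 else 0) - 1 / (real p + 1)" for l1 l2 v1 v2 y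
  define r1 r2 where "r1 x = l1 * x$1$1 + l2 * x$2$1" "r2 x = l1 * x$1$2 + l2 * x$2$2" for x :: imat
  define c1 c2 where "c1 x = x$1$1 * v1 + x$1$2 * v2" "c2 x = x$2$1 * v1 + x$2$2 * v2" for x :: imat
  have p2: "real p \<ge> 2" using prime_ge_2_nat[OF p] by simp
  have k: "k l1 l2 v1 v2 (x ** y ** z) = k (r1 x) (r2 x) (c1 z) (c2 z) y" for x y z
  proof -
    have "bil l1 l2 v1 v2 (x ** y ** z) = bil (r1 x) (r2 x) (c1 z) (c2 z) y"
      by (simp add: bil_def r1_r2_def c1_c2_def algebra_simps)
    then show ?thesis by (simp add: k_def)
  qed
  have rn: "\<not> (int p dvd r1 x \<and> int p dvd r2 x)" if "x \<in> ?G" for x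
    using row_nonzero[OF p SL2_modD[OF that] l] by (simp add: r1_r2_def)
  have cn: "\<not> (int p dvd c1 x \<and> int p dvd c2 x)" if "x \<in> ?G" for x
    using col_nonzero[OF p SL2_modD[OF that] v] by (simp add: c1_c2_def)
  have cnt: "(\<Sum>x\<in>?G. if P x then real p else 1) \<le> 2 * real p ^ 3" if "card {x\<in>?G. P x} = p * (p - 1)" for P
  proof -
    have "(\<Sum>x\<in>?G. if P x then real p else 1) \<le> (\<Sum>x\<in>?G. (if P x then real p else 0) + 1)" by (intro sum_mono) auto
    also have "\<dots> = real p * real (card {x\<in>?G. P x}) + real (card ?G)"
      by (simp add: sum.distrib sum.If_cases Int_def mult.commute)
    also have "\<dots> \<le> real p * (real p * real p) + real p ^ 3"
      unfolding that using card_SL2_mod_le[OF p] by (intro add_mono mult_left_mono) (auto simp flip: of_nat_mult)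
    finally show ?thesis by (simp add: power3_eq_cube)
  qed
  have "(\<Sum>y\<in>?G. (\<Sum>a\<in>?G \<times> ?G. k l1 l2 v1 v2 (fst a ** y ** snd a) * \<nu> a)\<^sup>2) \<le> 4 * real p ^ 6 * (\<Sum>a\<in>?G \<times> ?G. (\<nu> a)\<^sup>2)" for \<nu>
  proof (rule schur_gram)
    fix a assume "a \<in> ?G \<times> ?G"
    then obtain x z where a: "a = (x, z)" and x: "x \<in> ?G" and z: "z \<in> ?G" by auto
    define R where "R x' \<longleftrightarrow> int p dvd r1 x * r2 x' - r2 x * r1 x'" for x'
    define C where "C z' \<longleftrightarrow> int p dvd c1 z * c2 z' - c2 z * c1 z'" for z'
    \<comment> \<open>Being parallel to the fixed row l x is itself an incidence condition on x', so
      \<open>card_bil\<close> counts it.\<close>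
    have cR: "card {x'\<in>?G. R x'} = p * (p - 1)"
    proof -
      have "r1 x * r2 x' - r2 x * r1 x' = bil l1 l2 (- r2 x) (r1 x) x'" for x'
        unfolding bil_def r1_r2_def(1)[of x'] r1_r2_def(2)[of x'] by (simp add: algebra_simps)
      moreover have "\<not> (int p dvd - r2 x \<and> int p dvd r1 x)" using rn[OF x] by auto
      ultimately show ?thesis unfolding R_def using card_bil[OF p l] by presburger
    qed
    have cC: "card {z'\<in>?G. C z'} = p * (p - 1)"
    proof -
      have "c1 z * c2 z' - c2 z * c1 z' = bil (- c2 z) (c1 z) v1 v2 z'" for z'
        unfolding bil_def c1_c2_def(1)[of z'] c1_c2_def(2)[of z'] by (simp add: algebra_simps)
      moreover have "\<not> (int p dvd - c2 z \<and> int p dvd c1 z)" using cn[OF z] by auto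
      ultimately show ?thesis unfolding C_def using card_bil[OF p _ v] by presburger
    qed
    have "(\<Sum>a'\<in>?G \<times> ?G. \<bar>\<Sum>y\<in>?G. k l1 l2 v1 v2 (fst a ** y ** snd a) * k l1 l2 v1 v2 (fst a' ** y ** snd a')\<bar>)
      = (\<Sum>x'\<in>?G. \<Sum>z'\<in>?G. \<bar>\<Sum>y\<in>?G. k (r1 x) (r2 x) (c1 z) (c2 z) y * k (r1 x') (r2 x') (c1 z') (c2 z') y\<bar>)"
      unfolding k a by (simp add: sum.cartesian_product case_prod_unfold)
    also have "\<dots> \<le> (\<Sum>x'\<in>?G. \<Sum>z'\<in>?G. (if R x' then real p else 1) * (if C z' then real p else 1))"
      unfolding k_def R_def C_def by (intro sum_mono gram_bil[OF p] rn cn x z)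
    also have "\<dots> = (\<Sum>x'\<in>?G. if R x' then real p else 1) * (\<Sum>z'\<in>?G. if C z' then real p else 1)"
      by (simp add: sum_product)
    also have "\<dots> \<le> (2 * real p ^ 3) * (2 * real p ^ 3)"
      using cnt[OF cR] cnt[OF cC] by (intro mult_mono sum_nonneg) auto
    also have "\<dots> = 4 * real p ^ 6" by (simp flip: power_add)
    finally show "(\<Sum>a'\<in>?G \<times> ?G. \<bar>\<Sum>y\<in>?G. k l1 l2 v1 v2 (fst a ** y ** snd a) * k l1 l2 v1 v2 (fst a' ** y ** snd a')\<bar>)
      \<le> 4 * real p ^ 6" .
  qed
  then show ?thesis by (simp add: opnorm_le_def k_def)
qed

section \<open>Local estimates for \<open>Xi_prime\<close>\<close>

text \<open>The operator evaluates its kernel only at products of determinant 1 modulo p, so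
  identities that use the determinant may be applied to it.\<close>

lemma opnorm_le_cong:
  assumes "\<And>x. [det x = 1] (mod int p) \<Longrightarrow> F x = F' x" "opnorm_le p F B"
  shows "opnorm_le p F' B"
proof -
  have eq: "F' (fst a ** y ** snd a) = F (fst a ** y ** snd a)" if "y \<in> SL2_mod p" "a \<in> SL2_mod p \<times> SL2_mod p" for y a
  proof -
    have "[det (fst a) * det y * det (snd a) = 1 * 1 * 1] (mod int p)"
      using that by (intro cong_mult SL2_modD) auto
    then show ?thesis using assms(1) by (simp add: det_mul)
  qed
  have "(\<Sum>y\<in>SL2_mod p. (\<Sum>a\<in>SL2_mod p \<times> SL2_mod p. F' (fst a ** y ** snd a) * \<nu> a)\<^sup>2)
     = (\<Sum>y\<in>SL2_mod p. (\<Sum>a\<in>SL2_mod p \<times> SL2_mod p. F (fst a ** y ** snd a) * \<nu> a)\<^sup>2)" for \<nu>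
    by (intro sum.cong arg_cong[where f = "\<lambda>x. x\<^sup>2"]) (use eq in auto)
  then show ?thesis using assms(2) unfolding opnorm_le_def by simp
qed

lemma sqrt4_prime:
  assumes p: "prime (p::nat)" and t: "[t\<^sup>2 = 4] (mod int p)"
  obtains \<tau> where "\<tau> \<in> {1, -1 :: int}" "[t = 2 * \<tau>] (mod int p)"
proof -
  have "int p dvd t\<^sup>2 - 4" using t by (simp add: cong_iff_dvd_diff)
  also have "t\<^sup>2 - 4 = (t - 2) * (t - - 2)" by (simp add: algebra_simps power2_eq_square)
  finally have "int p dvd t - 2 \<or> int p dvd t - - 2" using p by (simp only: prime_dvd_mult_int)
  then show ?thesis using that[of 1] that[of "-1"] by (auto simp: cong_iff_dvd_diff)
qed

text \<open>\<open>ff y - 2 * \<tau> * det y\<close> is the sum of two squares (a - \<tau> d)^2 + (c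
  + \<tau> b)^2, which splits into two factors once -1 is a square; each factor is bilinear in an
  isotropic row (1, \<plusminus>i) and an isotropic column.\<close>

lemma ff_eq_bil:
  assumes p: "prime (p::nat)" and i: "[i\<^sup>2 = -1] (mod int p)" and \<tau>: "\<tau> \<in> {1, -1 :: int}" and y: "[det y = 1] (mod int p)"
  shows "[ff y = 2 * \<tau>] (mod int p) \<longleftrightarrow> int p dvd bil 1 i 1 (\<tau> * i) y \<or> int p dvd bil 1 (- i) 1 (- (\<tau> * i)) y"
proof -
  have "bil 1 i 1 (\<tau> * i) y * bil 1 (- i) 1 (- (\<tau> * i)) y = (y$1$1 + \<tau> * i\<^sup>2 * y$2$2)\<^sup>2 - i\<^sup>2 * (y$2$1 + \<tau> * y$1$2)\<^sup>2"
    by (simp add: bil_def algebra_simps power2_eq_square)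
  also have "[\<dots> = (y$1$1 + \<tau> * (-1) * y$2$2)\<^sup>2 - (-1) * (y$2$1 + \<tau> * y$1$2)\<^sup>2] (mod int p)"
    by (intro cong_diff cong_mult cong_pow cong_add cong_refl i)
  also have "(y$1$1 + \<tau> * (-1) * y$2$2)\<^sup>2 - (-1) * (y$2$1 + \<tau> * y$1$2)\<^sup>2 = ff y - 2 * \<tau> * det y"
    using \<tau> by (auto simp: ff_def det_2 algebra_simps power2_eq_square)
  also have "[ff y - 2 * \<tau> * det y = ff y - 2 * \<tau> * 1] (mod int p)" by (intro cong_diff cong_mult cong_refl y)
  finally have "int p dvd bil 1 i 1 (\<tau> * i) y * bil 1 (- i) 1 (- (\<tau> * i)) y \<longleftrightarrow> int p dvd ff y - 2 * \<tau>"
    by (simp add: cong_dvd_iff)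
  then show ?thesis using p by (simp add: prime_dvd_mult_int cong_iff_dvd_diff)
qed

lemma sum_two_squares_nonresidue:
  assumes p: "prime (p::nat)" and ni: "\<nexists>i. [i\<^sup>2 = -1] (mod int p)" and d: "int p dvd x\<^sup>2 + y\<^sup>2"
  shows "int p dvd x \<and> int p dvd y"
proof -
  have "int p dvd x" if "int p dvd x\<^sup>2 + y\<^sup>2" for x y
  proof (rule ccontr)
    assume "\<not> int p dvd x"
    then obtain b where b: "[x * b = 1] (mod int p)" using prime_inverse[OF p] by blast
    have "int p dvd b\<^sup>2 * (x\<^sup>2 + y\<^sup>2)" using that by simp
    then have "[(x * b)\<^sup>2 + (y * b)\<^sup>2 = 0] (mod int p)" by (simp add: cong_0_iff algebra_simps power_mult_distrib)
    moreover have "[(x * b)\<^sup>2 + (y * b)\<^sup>2 = 1\<^sup>2 + (y * b)\<^sup>2] (mod int p)" by (intro cong_add cong_pow cong_refl b)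
    ultimately have "[1 + (y * b)\<^sup>2 = 0] (mod int p)" by (metis cong_sym cong_trans power_one)
    then have "[(y * b)\<^sup>2 = -1] (mod int p)" by (simp add: cong_iff_dvd_diff add.commute)
    then show False using ni by blast
  qed
  from this[OF d] this[of y x] d show ?thesis by (simp add: add.commute)
qed

lemma card_square_roots:
  assumes p: "prime (p::nat)"
  shows "card {b \<in> {0..<int p}. [b\<^sup>2 = e] (mod int p)} \<le> 2"
proof (cases "{b \<in> {0..<int p}. [b\<^sup>2 = e] (mod int p)} = {}")
  case False
  then obtain c where c: "[c\<^sup>2 = e] (mod int p)" by auto
  have "{b \<in> {0..<int p}. [b\<^sup>2 = e] (mod int p)} \<subseteq> {c mod int p, (- c) mod int p}"
  proof
    fix b assume b: "b \<in> {b \<in> {0..<int p}. [b\<^sup>2 = e] (mod int p)}"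
    then have "[b\<^sup>2 = c\<^sup>2] (mod int p)" using c by (metis (mono_tags, lifting) cong_sym cong_trans mem_Collect_eq)
    then have "int p dvd (b - c) * (b - - c)" by (simp add: cong_iff_dvd_diff algebra_simps power2_eq_square)
    then have "[b = c] (mod int p) \<or> [b = - c] (mod int p)"
      using p by (simp only: prime_dvd_mult_int cong_iff_dvd_diff)
    then show "b \<in> {c mod int p, (- c) mod int p}" using b by (auto simp: cong_def)
  qed
  then have "card {b \<in> {0..<int p}. [b\<^sup>2 = e] (mod int p)} \<le> card {c mod int p, (- c) mod int p}"
    by (intro card_mono) auto
  also have "\<dots> \<le> 2" by (simp add: card_insert_if)
  finally show ?thesis .
next
  case True
  then show ?thesis by (simp only: card.empty)
qed

text \<open>The sum of two squares (a - \<tau> d)^2 + (c + \<tau> b)^2 is now anisotropic, so both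
  squares vanish. The second row is then determined by the first, which lies on the conic a^2 + b^2
  = \<tau>. The level set has size O(p) instead of p^2, and no cancellation is called for.\<close>

lemma card_ff_nonresidue:
  assumes p: "prime (p::nat)" and ni: "\<nexists>i. [i\<^sup>2 = -1] (mod int p)" and \<tau>: "\<tau> \<in> {1, -1 :: int}"
  shows "card {y \<in> SL2_mod p. [ff y = 2 * \<tau>] (mod int p)} \<le> 2 * p"
proof -
  define S where "S = {y \<in> SL2_mod p. [ff y = 2 * \<tau>] (mod int p)}"
  define Q where "Q a b \<longleftrightarrow> [b\<^sup>2 = \<tau> - a\<^sup>2] (mod int p)" for a b
  have key: "[y$2$2 = \<tau> * y$1$1] (mod int p)" "[y$2$1 = - (\<tau> * y$1$2)] (mod int p)" "Q (y$1$1) (y$1$2)" if "y \<in> S" for y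
  proof -
    have y: "y \<in> SL2_mod p" "[ff y = 2 * \<tau>] (mod int p)" using that by (auto simp: S_def)
    have "[ff y - 2 * \<tau> * det y = 2 * \<tau> - 2 * \<tau> * 1] (mod int p)"
      by (intro cong_diff cong_mult cong_refl y SL2_modD)
    moreover have "ff y - 2 * \<tau> * det y = (y$2$2 - \<tau> * y$1$1)\<^sup>2 + (y$2$1 - - (\<tau> * y$1$2))\<^sup>2"
      using \<tau> by (auto simp: ff_def det_2 algebra_simps power2_eq_square)
    ultimately have "int p dvd (y$2$2 - \<tau> * y$1$1)\<^sup>2 + (y$2$1 - - (\<tau> * y$1$2))\<^sup>2" by (simp add: cong_0_iff)
    then show 1: "[y$2$2 = \<tau> * y$1$1] (mod int p)" "[y$2$1 = - (\<tau> * y$1$2)] (mod int p)"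
      using sum_two_squares_nonresidue[OF p ni] unfolding cong_iff_dvd_diff by blast+
    have "[y$1$1 * y$2$2 - y$1$2 * y$2$1 = y$1$1 * (\<tau> * y$1$1) - y$1$2 * (- (\<tau> * y$1$2))] (mod int p)"
      by (intro cong_diff cong_mult cong_refl 1)
    then have "[1 = y$1$1 * (\<tau> * y$1$1) - y$1$2 * (- (\<tau> * y$1$2))] (mod int p)"
      using SL2_mod_det[OF y(1)] by (meson cong_sym cong_trans)
    then have "int p dvd \<tau> * (1 - (y$1$1 * (\<tau> * y$1$1) - y$1$2 * (- (\<tau> * y$1$2))))"
      by (simp add: cong_iff_dvd_diff)
    also have "\<tau> * (1 - (y$1$1 * (\<tau> * y$1$1) - y$1$2 * (- (\<tau> * y$1$2)))) = - ((y$1$2)\<^sup>2 - (\<tau> - (y$1$1)\<^sup>2))"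
      using \<tau> by (auto simp: algebra_simps power2_eq_square)
    finally show "Q (y$1$1) (y$1$2)" unfolding Q_def cong_iff_dvd_diff by (simp only: dvd_minus_iff)
  qed
  have "card S \<le> card {q \<in> {0..<int p} \<times> {0..<int p}. Q (fst q) (snd q)}"
  proof (rule card_inj_on_le)
    show "inj_on (\<lambda>y::imat. (y$1$1, y$1$2)) S"
    proof (rule inj_onI)
      fix x y assume x: "x \<in> S" and y: "y \<in> S" and e: "(x$1$1, x$1$2) = (y$1$1, y$1$2)"
      have "mat_cong p x y" unfolding mat_cong_iff using key[OF x] key[OF y] e
        by (auto intro: cong_trans[OF _ cong_sym])
      then show "x = y" using x y SL2_mod_eqI by (auto simp: S_def)
    qed
    show "(\<lambda>y::imat. (y$1$1, y$1$2)) ` S \<subseteq> {q \<in> {0..<int p} \<times> {0..<int p}. Q (fst q) (snd q)}"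
      using key(3) SL2_mod_range by (auto simp: S_def)
  qed auto
  also have "\<dots> = (\<Sum>a\<in>{0..<int p}. card {b\<in>{0..<int p}. Q a b})" by (rule card_filter_Times) auto
  also have "\<dots> \<le> (\<Sum>a\<in>{0..<int p}. 2)" unfolding Q_def by (intro sum_mono card_square_roots[OF p])
  finally show ?thesis by (simp add: S_def)
qed

lemma odd_prime_not_dvd:
  assumes p: "prime (p::nat)" "p \<noteq> 2" and i: "[i\<^sup>2 = -1] (mod int p)" and \<tau>: "\<tau> \<in> {1, -1 :: int}"
  shows "\<not> int p dvd i" "\<not> int p dvd 2" "\<not> int p dvd \<tau>"
proof -
  show "\<not> int p dvd i"
  proof
    assume "int p dvd i"
    then have "int p dvd i\<^sup>2" by (simp add: power2_eq_square)
    then have "int p dvd - 1" using i by (simp add: cong_dvd_iff)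
    then show False using not_dvd_neg1[OF p(1)] by blast
  qed
  show "\<not> int p dvd 2"
  proof
    assume "int p dvd 2"
    then have "p dvd 2" by (metis int_dvd_int_iff of_nat_numeral)
    then have "p \<le> 2" by (rule dvd_imp_le) simp
    then show False using p prime_ge_2_nat[of p] by simp
  qed
  show "\<not> int p dvd \<tau>" using \<tau> not_dvd_neg1[OF p(1)] by auto
qed

text \<open>Inclusion-exclusion for two incidence conditions of p (p - 1) solutions each. For odd p
  the two isotropic directions are independent, so they overlap in p - 1 elements. The count is the
  same for \<tau> = 1 and \<tau> = -1.\<close>

lemma card_ff_residue:
  assumes p: "prime (p::nat)" "p \<noteq> 2" and i: "[i\<^sup>2 = -1] (mod int p)" and \<tau>: "\<tau> \<in> {1, -1 :: int}"
  shows "real (card {y \<in> SL2_mod p. [ff y = 2 * \<tau>] (mod int p)}) = (2 * real p - 1) * (real p - 1)"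
proof -
  note nd = odd_prime_not_dvd[OF assms]
  define A where "A = {y \<in> SL2_mod p. int p dvd bil 1 i 1 (\<tau> * i) y}"
  define B where "B = {y \<in> SL2_mod p. int p dvd bil 1 (- i) 1 (- (\<tau> * i)) y}"
  have p1: "\<not> int p dvd 1" "p \<ge> 2" using p prime_ge_2_nat by auto
  have fin: "finite A" "finite B" by (auto simp: A_def B_def)
  have "{y \<in> SL2_mod p. [ff y = 2 * \<tau>] (mod int p)} = A \<union> B"
    using ff_eq_bil[OF p(1) i \<tau> SL2_modD] by (auto simp: A_def B_def)
  moreover have "card A = p * (p - 1)" unfolding A_def using p1 by (intro card_bil[OF p(1)]) auto
  moreover have "card B = p * (p - 1)" unfolding B_def using p1 by (intro card_bil[OF p(1)]) auto
  moreover have "card (A \<inter> B) = p - 1"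
  proof -
    have "1 * - i - i * 1 = - (2 * i)" "1 * - (\<tau> * i) - \<tau> * i * 1 = - (2 * (\<tau> * i))" by auto
    moreover have "\<not> int p dvd 2 * i" "\<not> int p dvd 2 * (\<tau> * i)" using nd p by (simp_all add: prime_dvd_mult_int)
    ultimately have "\<not> int p dvd 1 * - i - i * 1" "\<not> int p dvd 1 * - (\<tau> * i) - \<tau> * i * 1" by simp_all
    then have "card {y \<in> SL2_mod p. int p dvd bil 1 i 1 (\<tau> * i) y \<and> int p dvd bil 1 (- i) 1 (- (\<tau> * i)) y} = p - 1"
      by (rule card_bil2[OF p(1)])
    moreover have "A \<inter> B = {y \<in> SL2_mod p. int p dvd bil 1 i 1 (\<tau> * i) y \<and> int p dvd bil 1 (- i) 1 (- (\<tau> * i)) y}"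
      by (auto simp: A_def B_def)
    ultimately show ?thesis by simp
  qed
  moreover have "card A + card B = card (A \<union> B) + card (A \<inter> B)" using fin by (rule card_Un_Int)
  ultimately have "real (card {y \<in> SL2_mod p. [ff y = 2 * \<tau>] (mod int p)}) + real (p - 1) = real (p * (p - 1)) + real (p * (p - 1))"
    by (metis of_nat_add)
  then show ?thesis using p1 by (simp add: of_nat_diff algebra_simps)
qed


lemma card_ff_le:
  assumes p: "prime (p::nat)" "p \<noteq> 2" and \<tau>: "\<tau> \<in> {1, -1 :: int}"
  shows "real (card {y \<in> SL2_mod p. [ff y = 2 * \<tau>] (mod int p)}) \<le> 2 * (real p)\<^sup>2"
proof (cases "\<exists>i. [i\<^sup>2 = -1] (mod int p)")
  case True
  then obtain i where "[i\<^sup>2 = -1] (mod int p)" by blast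
  have "(2 * real p - 1) * (real p - 1) = 2 * (real p)\<^sup>2 - 3 * real p + 1"
    by (simp add: algebra_simps power2_eq_square)
  also have "\<dots> \<le> 2 * (real p)\<^sup>2" using prime_ge_2_nat[OF p(1)] by simp
  finally show ?thesis using card_ff_residue[OF p \<open>[i\<^sup>2 = -1] (mod int p)\<close> \<tau>] by simp
next
  case False
  have "real (card {y \<in> SL2_mod p. [ff y = 2 * \<tau>] (mod int p)}) \<le> real (2 * p)"
    using card_ff_nonresidue[OF p(1) False \<tau>] by (simp only: of_nat_le_iff)
  also have "\<dots> \<le> 2 * (real p)\<^sup>2" using prime_ge_2_nat[OF p(1)] by (simp add: power2_eq_square)
  finally show ?thesis .
qed

section \<open>The density of a level set and its indicator\<close>

lemma rho_prime_card: "prime p \<Longrightarrow> rho_prime p * real (card (SL2_mod p)) = real (card {y \<in> SL2_mod p. [ff y = 2] (mod int p)})"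
proof -
  assume p: "prime p"
  then have "real p > 1" using prime_gt_1_nat by simp
  then have "real p * ((real p)\<^sup>2 - 1) > 0" by (simp add: power2_eq_square less_1_mult)
  then have "real (card (SL2_mod p)) > 0" using card_SL2_mod[OF p] by simp
  then show ?thesis by (simp add: rho_prime_def)
qed

lemma rho_prime_nonneg: "0 \<le> rho_prime p" by (simp add: rho_prime_def)

lemma rho_prime_le_1: "rho_prime p \<le> 1"
proof -
  have "card {g \<in> SL2_mod p. [ff g = 2] (mod int p)} \<le> card (SL2_mod p)" by (intro card_mono) auto
  then show ?thesis unfolding rho_prime_def by (cases "card (SL2_mod p) = 0") (auto simp: divide_le_eq_1)
qed

lemma card_SL2_mod_ge:
  assumes p: "prime p"
  shows "real p ^ 3 / 2 \<le> real (card (SL2_mod p))" "real (card (SL2_mod p)) > 0"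
proof -
  have p2: "real p \<ge> 2" using prime_ge_2_nat[OF p] by simp
  then have "2 * 2 \<le> real p * real p" by (intro mult_mono) auto
  then have "(real p)\<^sup>2 / 2 \<le> (real p)\<^sup>2 - 1" by (simp add: power2_eq_square)
  then have "real p * ((real p)\<^sup>2 / 2) \<le> real p * ((real p)\<^sup>2 - 1)" by (intro mult_left_mono) auto
  then show "real p ^ 3 / 2 \<le> real (card (SL2_mod p))"
    unfolding card_SL2_mod[OF p] by (simp add: power2_eq_square power3_eq_cube)
  moreover have "real p ^ 3 / 2 > 0" using p2 by simp
  ultimately show "real (card (SL2_mod p)) > 0" by linarith
qed

definition level_ind :: "nat \<Rightarrow> int \<Rightarrow> imat \<Rightarrow> imat \<Rightarrow> real" where
  "level_ind p \<tau> w x = (if [ff (x ** w) = 2 * \<tau>] (mod int p) then 1 else 0)"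

lemma Xi_prime_level_ind:
  assumes "[t = 2 * \<tau>] (mod int p)"
  shows "Xi_prime p (ff (x ** w) - t) = level_ind p \<tau> w x - rho_prime p"
proof -
  have "[ff (x ** w) - t = 0] (mod int p) \<longleftrightarrow> [ff (x ** w) = t] (mod int p)" by (simp add: cong_iff_dvd_diff)
  also have "\<dots> \<longleftrightarrow> [ff (x ** w) = 2 * \<tau>] (mod int p)" using assms by (meson cong_sym cong_trans)
  finally show ?thesis by (simp add: Xi_prime_def level_ind_def)
qed

lemma level_ind_mcong: "mat_cong p x y \<Longrightarrow> level_ind p \<tau> w x = level_ind p \<tau> w y"
  unfolding level_ind_def using mat_cong_ff[OF mat_cong_mult[OF _ mat_cong_refl], of p x y w] by (metis cong_sym cong_trans)

lemma level_ind_bounds: "0 \<le> level_ind p \<tau> w x" "level_ind p \<tau> w x \<le> 1" by (auto simp: level_ind_def)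

lemma sum_level_ind:
  assumes p: "prime p" and w: "det w = 1"
  shows "(\<Sum>x\<in>SL2_mod p. level_ind p \<tau> w x) = real (card {y \<in> SL2_mod p. [ff y = 2 * \<tau>] (mod int p)})"
proof -
  have "(\<Sum>x\<in>SL2_mod p. level_ind p \<tau> w x) = (\<Sum>x\<in>SL2_mod p. level_ind p \<tau> (mat 1) (mat 1 ** x ** w))"
    by (simp add: level_ind_def del: mm_entry)
  also have "\<dots> = (\<Sum>x\<in>SL2_mod p. level_ind p \<tau> (mat 1) x)"
    using prime_gt_0_nat[OF p] w by (intro sum_translate level_ind_mcong) (auto simp: det_2)
  also have "\<dots> = real (card {y \<in> SL2_mod p. [ff y = 2 * \<tau>] (mod int p)})"
    by (simp add: level_ind_def sum.If_cases Int_def del: mm_entry)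
  finally show ?thesis .
qed

lemma periodic_Xi:
  assumes "[t = 2 * \<tau>] (mod int p)"
  shows "periodic p (\<lambda>x. Xi_prime p (ff (x ** w) - t))"
  unfolding periodic_def Xi_prime_level_ind[OF assms] using level_ind_mcong by metis

lemma bil_mult_right: "bil l1 l2 v1 v2 (x ** w) = bil l1 l2 (w$1$1 * v1 + w$1$2 * v2) (w$2$1 * v1 + w$2$2 * v2) x"
  by (simp add: bil_def algebra_simps)

text \<open>For p = 2 the two isotropic directions coincide, but the group has at most 8 elements
  and the trivial bound is 2^3 * 8^2 = 512.\<close>

lemma opnorm_le_Xi_2:
  assumes p: "p = 2" and F: "\<And>x. \<bar>F x\<bar> \<le> 1" and per: "periodic p F" and B: "B \<ge> 512"
  shows "opnorm_le p F B"
proof (rule opnorm_le_mono[OF opnorm_le_schur[OF _ per]])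
  show "prime p" using p by simp
  then have "real (card (SL2_mod p)) \<le> 8" using card_SL2_mod_le[of p] p by simp
  moreover have "(\<Sum>y\<in>SL2_mod p. \<bar>F y\<bar>) \<le> (\<Sum>y\<in>SL2_mod p. 1)" by (intro sum_mono F)
  ultimately show "(\<Sum>y\<in>SL2_mod p. \<bar>F y\<bar>) \<le> 8" by simp
  show "real p ^ 3 * 8\<^sup>2 \<le> B" using p B by simp
qed

lemma level_ind_rho_le_1: "\<bar>level_ind p \<tau> w x - rho_prime p\<bar> \<le> 1"
  using level_ind_bounds[of p \<tau> w x] rho_prime_nonneg[of p] rho_prime_le_1[of p] by linarith

text \<open>If -1 is a square, the indicator of the level set is a + b - a b for two incidence
  indicators. Centering a and b separately leaves the remainder \<open>ab\<close>, whose sum of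
  absolute values is O(p), so Schur gives p^5 for it and \<open>opnorm_le_bil\<close> gives p^6 for
  the rest. \<open>rho_prime\<close>, defined at level 2, also centers level -2 because both levels
  have equal size. If -1 is not a square, both levels have at most 2 p elements and Schur gives p^5.
  The constant 1024 = 2^10 is a power of two so that its product over primes is a power of
  2^\<omega>, hence of the divisor function.\<close>

lemma opnorm_le_Xi:
  assumes p: "prime (p::nat)" and t: "[t\<^sup>2 = 4] (mod int p)" and w: "det w = 1"
  shows "opnorm_le p (\<lambda>x. Xi_prime p (ff (x ** w) - t)) (1024 * real p ^ 6)"
proof -
  obtain \<tau> where \<tau>: "\<tau> \<in> {1, -1 :: int}" and t\<tau>: "[t = 2 * \<tau>] (mod int p)" using sqrt4_prime[OF p t] by blast
  note per = periodic_Xi[OF t\<tau>, of w]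
  have p2: "real p \<ge> 2" using prime_ge_2_nat[OF p] by simp
  have p56: "real p ^ 5 \<le> real p ^ 6" using p2 by (intro power_increasing) auto
  have p6: "1 \<le> real p ^ 6" using p2 by (intro one_le_power) auto
  consider (two) "p = 2" | (res) i where "p \<noteq> 2" "[i\<^sup>2 = -1] (mod int p)" | (nonres) "p \<noteq> 2" "\<nexists>i. [i\<^sup>2 = -1] (mod int p)" by blast
  then show ?thesis
  proof cases
    case two
    show ?thesis
      by (rule opnorm_le_Xi_2[OF two _ per]) (use level_ind_rho_le_1 p6 in \<open>auto simp: Xi_prime_level_ind[OF t\<tau>] simp del: mm_entry\<close>)
  next
    case nonres
    have "(\<Sum>y\<in>SL2_mod p. \<bar>Xi_prime p (ff (y ** w) - t)\<bar>) \<le> (\<Sum>y\<in>SL2_mod p. level_ind p \<tau> w y + rho_prime p)"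
      unfolding Xi_prime_level_ind[OF t\<tau>]
    proof (rule sum_mono)
      fix y show "\<bar>level_ind p \<tau> w y - rho_prime p\<bar> \<le> level_ind p \<tau> w y + rho_prime p"
        using level_ind_bounds[of p \<tau> w y] rho_prime_nonneg[of p] by linarith
    qed
    also have "\<dots> = real (card {y \<in> SL2_mod p. [ff y = 2 * \<tau>] (mod int p)}) + real (card {y \<in> SL2_mod p. [ff y = 2] (mod int p)})"
      using rho_prime_card[OF p] by (simp add: sum.distrib sum_level_ind[OF p w] mult.commute)
    also have "\<dots> \<le> real (2 * p) + real (2 * p)"
      using card_ff_nonresidue[OF p nonres(2) \<tau>] card_ff_nonresidue[OF p nonres(2), of 1]
      by (intro add_mono) (simp_all only: of_nat_le_iff, simp_all)
    finally have "opnorm_le p (\<lambda>x. Xi_prime p (ff (x ** w) - t)) (real p ^ 3 * (4 * real p)\<^sup>2)"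
      by (intro opnorm_le_schur[OF p per]) simp
    moreover have "real p ^ 3 * (4 * real p)\<^sup>2 \<le> 1024 * real p ^ 6"
      using p56 p6 by (simp add: power_mult_distrib flip: power_add)
    ultimately show ?thesis by (rule opnorm_le_mono)
  next
    case res
    note i = res(2)
    define v1 v2 u1 u2 where "v1 = w$1$1 * 1 + w$1$2 * (\<tau> * i)" "v2 = w$2$1 * 1 + w$2$2 * (\<tau> * i)"
      "u1 = w$1$1 * 1 + w$1$2 * (- (\<tau> * i))" "u2 = w$2$1 * 1 + w$2$2 * (- (\<tau> * i))"
    note vu = this
    have n1: "\<not> int p dvd 1" using p prime_gt_1_nat[of p] by auto
    have w1: "[det w = 1] (mod int p)" using w by simp
    have v: "\<not> (int p dvd v1 \<and> int p dvd v2)" unfolding vu by (rule col_nonzero[OF p w1]) (use n1 in auto)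
    have u: "\<not> (int p dvd u1 \<and> int p dvd u2)" unfolding vu by (rule col_nonzero[OF p w1]) (use n1 in auto)
    define a b where "a x = (if int p dvd bil 1 i v1 v2 x then 1 else 0 :: real)"
      and "b x = (if int p dvd bil 1 (- i) u1 u2 x then 1 else 0 :: real)" for x
    \<comment> \<open>By inclusion-exclusion this is the density of the overlap of the two
      conditions: multiplied by the order of the group it equals p - 1.\<close>
    define e where "e = 2 / (real p + 1) - rho_prime p"
    define ab where "ab x = e - a x * b x" for x
    have F: "(a x - 1 / (real p + 1)) + (b x - 1 / (real p + 1)) + ab x = Xi_prime p (ff (x ** w) - t)"
      if x: "[det x = 1] (mod int p)" for x
    proof -
      have "[det (x ** w) = 1] (mod int p)" using x w by (simp add: det_mul)
      then have "[ff (x ** w) = 2 * \<tau>] (mod int p) \<longleftrightarrow> int p dvd bil 1 i v1 v2 x \<or> int p dvd bil 1 (- i) u1 u2 x"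
        unfolding vu using ff_eq_bil[OF p i \<tau>] bil_mult_right by simp
      then have "level_ind p \<tau> w x = a x + b x - a x * b x" by (auto simp: level_ind_def a_def b_def)
      then show ?thesis by (simp add: Xi_prime_level_ind[OF t\<tau>] ab_def e_def)
    qed
    have cab: "(\<Sum>x\<in>SL2_mod p. a x * b x) = real p - 1"
    proof -
      have "v1 * u2 - v2 * u1 = - (2 * (\<tau> * i)) * det w" by (simp add: vu det_2 algebra_simps)
      then have "\<not> int p dvd v1 * u2 - v2 * u1" "\<not> int p dvd 1 * - i - i * 1"
        using odd_prime_not_dvd[OF p res \<tau>] p w prime_dvd_mult_int[OF p, of 2 i] by (auto simp: prime_dvd_mult_int)
      then have "card {y \<in> SL2_mod p. int p dvd bil 1 i v1 v2 y \<and> int p dvd bil 1 (- i) u1 u2 y} = p - 1"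
        by (intro card_bil2[OF p])
      moreover have "(\<Sum>x\<in>SL2_mod p. a x * b x) = (\<Sum>x\<in>SL2_mod p. if int p dvd bil 1 i v1 v2 x \<and> int p dvd bil 1 (- i) u1 u2 x then 1 else 0)"
        by (intro sum.cong) (auto simp: a_def b_def)
      ultimately show ?thesis using p2 by (simp add: sum.If_cases Int_def of_nat_diff)
    qed
    have ce: "real (card (SL2_mod p)) * e = real p - 1"
    proof -
      have "real (card (SL2_mod p)) * e = real (card (SL2_mod p)) * 2 / (real p + 1) - (2 * real p - 1) * (real p - 1)"
        using rho_prime_card[OF p] card_ff_residue[OF p res, of 1] by (simp add: e_def algebra_simps)
      also have "real (card (SL2_mod p)) * 2 / (real p + 1) = 2 * real p * (real p - 1)"
      proof -
        have "real p * ((real p)\<^sup>2 - 1) * 2 = 2 * real p * (real p - 1) * (real p + 1)"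
          by (simp add: algebra_simps power2_eq_square)
        then show ?thesis unfolding card_SL2_mod[OF p] using p2 by (simp only:) simp
      qed
      finally show ?thesis by (simp add: algebra_simps)
    qed
    have e0: "e \<ge> 0"
    proof (rule ccontr)
      assume "\<not> e \<ge> 0"
      then have "real (card (SL2_mod p)) * e < 0" using card_SL2_mod_ge(2)[OF p] by (intro mult_pos_neg) auto
      then show False using ce p2 by simp
    qed
    have "opnorm_le p ab (real p ^ 3 * (2 * real p)\<^sup>2)"
    proof (rule opnorm_le_schur[OF p])
      show "periodic p ab" unfolding periodic_def
      proof (intro allI impI)
        fix x y assume "mat_cong p x y"
        then show "ab x = ab y" using bil_mcong by (simp add: ab_def a_def b_def)
      qed
      have "(\<Sum>y\<in>SL2_mod p. \<bar>ab y\<bar>) \<le> (\<Sum>y\<in>SL2_mod p. e + a y * b y)"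
        using e0 by (intro sum_mono) (auto simp: ab_def a_def b_def)
      also have "\<dots> = 2 * (real p - 1)" by (simp add: sum.distrib cab ce)
      finally show "(\<Sum>y\<in>SL2_mod p. \<bar>ab y\<bar>) \<le> 2 * real p" by simp
    qed
    moreover have "opnorm_le p (\<lambda>x. a x - 1 / (real p + 1)) (4 * real p ^ 6)"
      unfolding a_def using n1 v by (intro opnorm_le_bil[OF p]) auto
    moreover have "opnorm_le p (\<lambda>x. b x - 1 / (real p + 1)) (4 * real p ^ 6)"
      unfolding b_def using n1 u by (intro opnorm_le_bil[OF p]) auto
    ultimately have "opnorm_le p (\<lambda>x. (a x - 1 / (real p + 1)) + (b x - 1 / (real p + 1)) + ab x)
        (2 * (2 * (4 * real p ^ 6 + 4 * real p ^ 6) + real p ^ 3 * (2 * real p)\<^sup>2))"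
      by (intro opnorm_le_add)
    then have "opnorm_le p (\<lambda>x. Xi_prime p (ff (x ** w) - t)) (2 * (2 * (4 * real p ^ 6 + 4 * real p ^ 6) + real p ^ 3 * (2 * real p)\<^sup>2))"
      by (rule opnorm_le_cong[rotated]) (rule F)
    moreover have "2 * (2 * (4 * real p ^ 6 + 4 * real p ^ 6) + real p ^ 3 * (2 * real p)\<^sup>2) \<le> 1024 * real p ^ 6"
      using p56 p6 by (simp add: power_mult_distrib flip: power_add)
    ultimately show ?thesis by (rule opnorm_le_mono)
  qed
qed

lemma card_bil_pair_le:
  assumes p: "prime (p::nat)"
    and l: "\<not> (int p dvd l1 \<and> int p dvd l2)" and m: "\<not> (int p dvd m1 \<and> int p dvd m2)"
    and v: "\<not> int p dvd v1 * u2 - v2 * u1"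
  shows "card {y \<in> SL2_mod p. int p dvd bil l1 l2 v1 v2 y \<and> int p dvd bil m1 m2 u1 u2 y} \<le> p - 1"
proof (cases "int p dvd l1 * m2 - l2 * m1")
  case True
  have "{y \<in> SL2_mod p. int p dvd bil l1 l2 v1 v2 y \<and> int p dvd bil m1 m2 u1 u2 y} = {}"
    using bil_mixed_left[OF p _ l m True v] by blast
  then show ?thesis by (simp only: card.empty)
next
  case False
  then show ?thesis using card_bil2[OF p False v] by simp
qed

text \<open>If two isotropic directions \<open>w u\<close> and \<open>w' u'\<close> coincide modulo \<open>p\<close>, then \<open>w\<^sup>-\<^sup>1 w'\<close> lies on a level set of \<open>ff\<close>.\<close>

lemma isotropic_parallel:
  assumes i: "[i\<^sup>2 = -1] (mod int p)" and w: "det w = 1" "det w' = 1"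
    and s: "\<sigma> \<in> {1, -1 :: int}" "j\<^sup>2 = i\<^sup>2" "j' = \<sigma> * j"
    and d: "int p dvd (w$1$1 * 1 + w$1$2 * j) * (w'$2$1 * 1 + w'$2$2 * j') - (w$2$1 * 1 + w$2$2 * j) * (w'$1$1 * 1 + w'$1$2 * j')"
  shows "int p dvd (ff (adj w ** w'))\<^sup>2 - 4"
proof -
  define g where "g = adj w ** w'"
  have "det (adj w) = det w" by (simp add: det_2 mult.commute)
  then have dg: "det g = 1" using w by (simp add: g_def det_mul)
  have "(w$1$1 * 1 + w$1$2 * j) * (w'$2$1 * 1 + w'$2$2 * j') - (w$2$1 * 1 + w$2$2 * j) * (w'$1$1 * 1 + w'$1$2 * j')
    = (g$2$1 - \<sigma> * j\<^sup>2 * g$1$2) + j * (\<sigma> * g$2$2 - g$1$1)"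
    unfolding s(3) by (simp add: g_def algebra_simps power2_eq_square)
  \<comment> \<open>Multiplying by the conjugate expression removes \<open>j\<close>, and what is
    left is \<open>ff g - 2 * \<sigma>\<close> modulo p.\<close>
  then have "int p dvd ((g$2$1 - \<sigma> * j\<^sup>2 * g$1$2) + j * (\<sigma> * g$2$2 - g$1$1)) * ((g$2$1 - \<sigma> * j\<^sup>2 * g$1$2) - j * (\<sigma> * g$2$2 - g$1$1))"
    using d by simp
  also have "((g$2$1 - \<sigma> * j\<^sup>2 * g$1$2) + j * (\<sigma> * g$2$2 - g$1$1)) * ((g$2$1 - \<sigma> * j\<^sup>2 * g$1$2) - j * (\<sigma> * g$2$2 - g$1$1))
    = (g$2$1 - \<sigma> * i\<^sup>2 * g$1$2)\<^sup>2 - i\<^sup>2 * (\<sigma> * g$2$2 - g$1$1)\<^sup>2"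
    unfolding s(2)[symmetric] by (simp add: algebra_simps power2_eq_square)
  finally have 1: "int p dvd (g$2$1 - \<sigma> * i\<^sup>2 * g$1$2)\<^sup>2 - i\<^sup>2 * (\<sigma> * g$2$2 - g$1$1)\<^sup>2" .
  have "[(g$2$1 - \<sigma> * i\<^sup>2 * g$1$2)\<^sup>2 - i\<^sup>2 * (\<sigma> * g$2$2 - g$1$1)\<^sup>2
    = (g$2$1 - \<sigma> * (-1) * g$1$2)\<^sup>2 - (-1) * (\<sigma> * g$2$2 - g$1$1)\<^sup>2] (mod int p)"
    by (intro cong_diff cong_mult cong_pow cong_add cong_refl i)
  also have "(g$2$1 - \<sigma> * (-1) * g$1$2)\<^sup>2 - (-1) * (\<sigma> * g$2$2 - g$1$1)\<^sup>2 = ff g - 2 * \<sigma> * det g"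
    using s(1) by (auto simp: ff_def det_2 algebra_simps power2_eq_square)
  finally have "int p dvd ff g - 2 * \<sigma>" using 1 dg by (simp add: cong_dvd_iff)
  then have "int p dvd (ff g - 2 * \<sigma>) * (ff g + 2 * \<sigma>)" by simp
  also have "(ff g - 2 * \<sigma>) * (ff g + 2 * \<sigma>) = (ff g)\<^sup>2 - 4"
    using s(1) by (auto simp: algebra_simps power2_eq_square)
  finally show ?thesis by (simp add: g_def)
qed

text \<open>Unless p divides ff(w^-1 w')^2 - 4, each isotropic direction of \<open>w\<close> is
  independent of each one of \<open>w'\<close>. The joint condition is covered by four pairs of
  incidence conditions, each with at most p - 1 solutions. If -1 is not a square, one level set
  alone is small enough.\<close>

lemma sum_level_ind_pair:
  assumes p: "prime (p::nat)" "p \<noteq> 2" and w: "det w = 1" "det w' = 1"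
    and \<tau>: "\<tau> \<in> {1, -1 :: int}" "\<tau>' \<in> {1, -1 :: int}"
    and nD: "\<not> int p dvd (ff (adj w ** w'))\<^sup>2 - 4"
  shows "(\<Sum>x\<in>SL2_mod p. level_ind p \<tau> w x * level_ind p \<tau>' w' x) \<le> 4 * real p"
proof (cases "\<exists>i. [i\<^sup>2 = -1] (mod int p)")
  case False
  have "(\<Sum>x\<in>SL2_mod p. level_ind p \<tau> w x * level_ind p \<tau>' w' x) \<le> (\<Sum>x\<in>SL2_mod p. level_ind p \<tau> w x)"
    by (intro sum_mono) (auto simp: level_ind_def)
  also have "\<dots> = real (card {y \<in> SL2_mod p. [ff y = 2 * \<tau>] (mod int p)})" by (rule sum_level_ind[OF p(1) w(1)])
  also have "\<dots> \<le> real (2 * p)" using card_ff_nonresidue[OF p(1) False \<tau>(1)] by (simp only: of_nat_le_iff)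
  finally show ?thesis by simp
next
  case True
  then obtain i where i: "[i\<^sup>2 = -1] (mod int p)" by blast
  define a where "a s w \<tau> x = (if int p dvd bil 1 (s * i) (w$1$1 * 1 + w$1$2 * (s * \<tau> * i)) (w$2$1 * 1 + w$2$2 * (s * \<tau> * i)) x then 1 else 0 :: real)"
    for s \<tau> :: int and w x :: imat
  have a0: "0 \<le> a s w \<tau> x" for s w \<tau> x by (simp add: a_def)
  have level_ind: "level_ind p \<tau> w x \<le> (\<Sum>s\<in>{1, -1}. a s w \<tau> x)" if "det w = 1" "\<tau> \<in> {1, -1 :: int}" "x \<in> SL2_mod p" for w \<tau> x
  proof -
    have "[det (x ** w) = 1] (mod int p)" using SL2_modD[OF that(3)] that(1) by (simp add: det_mul)
    then show ?thesis unfolding level_ind_def a_def using ff_eq_bil[OF p(1) i that(2)] bil_mult_right by simp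
  qed
  have n1: "\<not> int p dvd 1" using p prime_gt_1_nat[of p] by auto
  have N: "(\<Sum>x\<in>SL2_mod p. a s w \<tau> x * a s' w' \<tau>' x) \<le> real p" if s: "s \<in> {1, -1}" "s' \<in> {1, -1}" for s s'
  proof -
    have "\<not> int p dvd (w$1$1 * 1 + w$1$2 * (s * \<tau> * i)) * (w'$2$1 * 1 + w'$2$2 * (s' * \<tau>' * i))
       - (w$2$1 * 1 + w$2$2 * (s * \<tau> * i)) * (w'$1$1 * 1 + w'$1$2 * (s' * \<tau>' * i))"
    proof
      assume "int p dvd (w$1$1 * 1 + w$1$2 * (s * \<tau> * i)) * (w'$2$1 * 1 + w'$2$2 * (s' * \<tau>' * i))
       - (w$2$1 * 1 + w$2$2 * (s * \<tau> * i)) * (w'$1$1 * 1 + w'$1$2 * (s' * \<tau>' * i))"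
      then have "int p dvd (ff (adj w ** w'))\<^sup>2 - 4"
        \<comment> \<open>The sign relating the two square roots of -1 that occur, s \<tau> i and s'
          \<tau>' i.\<close>
        by (rule isotropic_parallel[OF i w, of "s * \<tau> * s' * \<tau>'", rotated 3]) (use s \<tau> in auto)
      then show False using nD by blast
    qed
    then have "card {x \<in> SL2_mod p. int p dvd bil 1 (s * i) (w$1$1 * 1 + w$1$2 * (s * \<tau> * i)) (w$2$1 * 1 + w$2$2 * (s * \<tau> * i)) x
      \<and> int p dvd bil 1 (s' * i) (w'$1$1 * 1 + w'$1$2 * (s' * \<tau>' * i)) (w'$2$1 * 1 + w'$2$2 * (s' * \<tau>' * i)) x} \<le> p - 1"
      using n1 by (intro card_bil_pair_le[OF p(1)]) auto
    moreover have "(\<Sum>x\<in>SL2_mod p. a s w \<tau> x * a s' w' \<tau>' x)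
      = (\<Sum>x\<in>SL2_mod p. if int p dvd bil 1 (s * i) (w$1$1 * 1 + w$1$2 * (s * \<tau> * i)) (w$2$1 * 1 + w$2$2 * (s * \<tau> * i)) x
      \<and> int p dvd bil 1 (s' * i) (w'$1$1 * 1 + w'$1$2 * (s' * \<tau>' * i)) (w'$2$1 * 1 + w'$2$2 * (s' * \<tau>' * i)) x then 1 else 0)"
      by (intro sum.cong) (simp_all add: a_def)
    ultimately show ?thesis by (simp add: sum.If_cases Int_def)
  qed
  have "(\<Sum>x\<in>SL2_mod p. level_ind p \<tau> w x * level_ind p \<tau>' w' x) \<le> (\<Sum>x\<in>SL2_mod p. (\<Sum>s\<in>{1, -1}. a s w \<tau> x) * (\<Sum>s\<in>{1, -1}. a s w' \<tau>' x))"
    by (intro sum_mono mult_mono level_ind w \<tau> sum_nonneg a0 level_ind_bounds)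
  also have "\<dots> = (\<Sum>s\<in>{1, -1}. \<Sum>s'\<in>{1, -1}. \<Sum>x\<in>SL2_mod p. a s w \<tau> x * a s' w' \<tau>' x)"
    by (simp add: sum.distrib algebra_simps)
  also have "\<dots> \<le> (\<Sum>s\<in>{1, -1 :: int}. \<Sum>s'\<in>{1, -1 :: int}. real p)" by (intro sum_mono N)
  finally show ?thesis by simp
qed

text \<open>Schur is enough here, because two independent conditions already leave only O(p)
  elements: p^3 * p^2 = p^5. If p divides ff(w^-1 w')^2 - 4 the conditions may coincide, leaving
  O(p^2) elements and p^3 * p^4 = p^7; the factor gcd^2 expresses exactly this loss.\<close>

lemma opnorm_le_Xi_pair:
  assumes p: "prime (p::nat)" and t: "[t\<^sup>2 = 4] (mod int p)" "[t'\<^sup>2 = 4] (mod int p)" and w: "det w = 1" "det w' = 1"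
  shows "opnorm_le p (\<lambda>x. Xi_prime p (ff (x ** w) - t) * Xi_prime p (ff (x ** w') - t'))
    (1024 * (real p ^ 5 * (real_of_int (gcd (int p) ((ff (adj w ** w'))\<^sup>2 - 4)))\<^sup>2))"
proof -
  define D where "D = (ff (adj w ** w'))\<^sup>2 - 4"
  obtain \<tau> where \<tau>: "\<tau> \<in> {1, -1 :: int}" and t\<tau>: "[t = 2 * \<tau>] (mod int p)" using sqrt4_prime[OF p t(1)] by blast
  obtain \<tau>' where \<tau>': "\<tau>' \<in> {1, -1 :: int}" and t\<tau>': "[t' = 2 * \<tau>'] (mod int p)" using sqrt4_prime[OF p t(2)] by blast
  define F where "F x = (level_ind p \<tau> w x - rho_prime p) * (level_ind p \<tau>' w' x - rho_prime p)" for x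
  have F: "Xi_prime p (ff (x ** w) - t) * Xi_prime p (ff (x ** w') - t') = F x" for x
    unfolding Xi_prime_level_ind[OF t\<tau>] Xi_prime_level_ind[OF t\<tau>'] F_def ..
  have per: "periodic p F" unfolding periodic_def F_def using level_ind_mcong by metis
  define r where "r = rho_prime p"
  have r: "0 \<le> r" using rho_prime_nonneg by (simp add: r_def)
  have p2: "real p \<ge> 2" using prime_ge_2_nat[OF p] by simp
  have F1: "\<bar>F x\<bar> \<le> \<bar>level_ind p \<tau> w x - rho_prime p\<bar>" for x
    unfolding F_def abs_mult by (rule mult_left_le) (use level_ind_rho_le_1 in auto)
  have g1: "1 \<le> real_of_int (gcd (int p) D)" using p prime_gt_0_nat[OF p] by (simp add: Suc_leI int_one_le_iff_zero_less)
  have "opnorm_le p F (1024 * (real p ^ 5 * (real_of_int (gcd (int p) D))\<^sup>2))"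
  proof (cases "p = 2")
    case True
    have "1 * 1 \<le> real p ^ 5 * (real_of_int (gcd (int p) D))\<^sup>2"
      using p2 g1 by (intro mult_mono one_le_power) auto
    then show ?thesis by (intro opnorm_le_Xi_2[OF True order_trans[OF F1 level_ind_rho_le_1] per]) simp
  next
    case odd: False
    define G where "G = real (card (SL2_mod p))"
    have G: "real p ^ 3 / 2 \<le> G" "G > 0" using card_SL2_mod_ge[OF p] by (simp_all add: G_def)
    define b b' b2 where "b = (\<Sum>x\<in>SL2_mod p. level_ind p \<tau> w x)" and "b' = (\<Sum>x\<in>SL2_mod p. level_ind p \<tau>' w' x)"
      and "b2 = real (card {y \<in> SL2_mod p. [ff y = 2] (mod int p)})"
    have b: "b \<le> 2 * (real p)\<^sup>2" "b' \<le> 2 * (real p)\<^sup>2" "b2 \<le> 2 * (real p)\<^sup>2" "0 \<le> b" "0 \<le> b'" "0 \<le> b2"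
      unfolding b_def b'_def b2_def sum_level_ind[OF p w(1)] sum_level_ind[OF p w(2)]
      using card_ff_le[OF p odd \<tau>] card_ff_le[OF p odd \<tau>'] card_ff_le[OF p odd, of 1] by auto
    have rG: "r * G = b2" using rho_prime_card[OF p] by (simp add: r_def G_def b2_def)
    show ?thesis
    proof (cases "int p dvd D")
      case True
      have "(\<Sum>y\<in>SL2_mod p. \<bar>F y\<bar>) \<le> (\<Sum>y\<in>SL2_mod p. level_ind p \<tau> w y + r)"
      proof (rule sum_mono)
        fix y show "\<bar>F y\<bar> \<le> level_ind p \<tau> w y + r"
          using F1[of y] level_ind_bounds[of p \<tau> w y] r unfolding r_def by linarith
      qed
      also have "\<dots> = b + b2" using rG by (simp add: sum.distrib b_def G_def mult.commute)
      also have "\<dots> \<le> 4 * (real p)\<^sup>2" using b by simp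
      finally have "opnorm_le p F (real p ^ 3 * (4 * (real p)\<^sup>2)\<^sup>2)" by (intro opnorm_le_schur[OF p per])
      moreover have "gcd (int p) D = int p" using True by simp
      ultimately show ?thesis by (elim opnorm_le_mono) (simp add: power_mult_distrib flip: power_mult power_add)
    next
      case False
      have gcd1: "gcd (int p) D = 1" using False p by (metis coprime_iff_gcd_eq_1 prime_imp_coprime prime_nat_int_transfer)
      have "(\<Sum>y\<in>SL2_mod p. \<bar>F y\<bar>) \<le> (\<Sum>y\<in>SL2_mod p. level_ind p \<tau> w y * level_ind p \<tau>' w' y + r * level_ind p \<tau> w y + r * level_ind p \<tau>' w' y + r * r)"
      proof (rule sum_mono)
        fix y
        have "\<bar>F y\<bar> = \<bar>level_ind p \<tau> w y - r\<bar> * \<bar>level_ind p \<tau>' w' y - r\<bar>" by (simp add: F_def r_def abs_mult)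
        also have "\<dots> \<le> (level_ind p \<tau> w y + r) * (level_ind p \<tau>' w' y + r)"
          using level_ind_bounds[of p \<tau> w y] level_ind_bounds[of p \<tau>' w' y] r by (intro mult_mono) auto
        finally show "\<bar>F y\<bar> \<le> level_ind p \<tau> w y * level_ind p \<tau>' w' y + r * level_ind p \<tau> w y + r * level_ind p \<tau>' w' y + r * r"
          by (simp add: algebra_simps)
      qed
      also have "\<dots> = (\<Sum>y\<in>SL2_mod p. level_ind p \<tau> w y * level_ind p \<tau>' w' y) + r * b + r * b' + r * b2"
        by (simp add: sum.distrib sum_distrib_left b_def b'_def G_def flip: rG)
      also have "\<dots> \<le> 4 * real p + 8 * real p + 8 * real p + 8 * real p"
      proof (intro add_mono)
        show "(\<Sum>y\<in>SL2_mod p. level_ind p \<tau> w y * level_ind p \<tau>' w' y) \<le> 4 * real p"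
          by (rule sum_level_ind_pair[OF p odd w \<tau> \<tau>']) (use False in \<open>simp add: D_def\<close>)
        \<comment> \<open>The density \<open>r\<close> is at most 4 / p, since the level set has at
          most 2 p^2 elements and the group at least p^3 / 2.\<close>
        have *: "r * c \<le> 8 * real p" if "c \<le> 2 * (real p)\<^sup>2" "0 \<le> c" for c
        proof -
          have "r * c * G = b2 * c" by (simp add: rG[symmetric] mult_ac)
          also have "\<dots> \<le> (2 * (real p)\<^sup>2) * (2 * (real p)\<^sup>2)" using b that by (intro mult_mono) auto
          also have "\<dots> = 8 * real p * (real p ^ 3 / 2)" by (simp add: power2_eq_square power3_eq_cube)
          also have "\<dots> \<le> 8 * real p * G" using G by (intro mult_left_mono) auto
          finally show ?thesis using G by simp
        qed
        show "r * b \<le> 8 * real p" "r * b' \<le> 8 * real p" "r * b2 \<le> 8 * real p" using * b by auto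
      qed
      \<comment> \<open>28 = 4 + 8 + 8 + 8, and its square 784 is the largest local constant that
        1024 has to cover.\<close>
      finally have "opnorm_le p F (real p ^ 3 * (28 * real p)\<^sup>2)" by (intro opnorm_le_schur[OF p per]) simp
      then show ?thesis
        by (rule opnorm_le_mono) (simp add: gcd1 power_mult_distrib flip: power_add)
    qed
  qed
  then show ?thesis by (simp add: F D_def del: mm_entry)
qed

section \<open>Correlations over several primes\<close>

lemma prod_primes_dvd:
  fixes n :: nat
  assumes "finite S" "\<And>p. p \<in> S \<Longrightarrow> prime p" "\<And>p. p \<in> S \<Longrightarrow> p dvd n"
  shows "\<Prod>S dvd n"
  using assms
proof (induction S rule: finite_induct)
  case (insert p S)
  have "coprime p (\<Prod>S)"
  proof (intro prod_coprime_right)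
    fix q assume "q \<in> S"
    then show "coprime p q" using insert primes_coprime[of p q] by auto
  qed
  then show ?case using insert by (simp add: divides_mult)
qed simp

lemma squarefree_prod_prime_factors:
  assumes "squarefree (n::nat)"
  shows "\<Prod>(prime_factors n) = n"
proof -
  have n0: "n \<noteq> 0" using assms by (metis not_squarefree_0)
  have "n = (\<Prod>p\<in>prime_factors n. p ^ multiplicity p n)"
    using prod_prime_factors[OF n0] by simp
  also have "\<dots> = \<Prod>(prime_factors n)"
    using assms n0 squarefree_factorial_semiring'[OF n0] by (intro prod.cong) auto
  finally show ?thesis by simp
qed

lemma squarefree_dvd_int_iff:
  assumes "squarefree (n::nat)"
  shows "int n dvd x \<longleftrightarrow> (\<forall>p\<in>prime_factors n. int p dvd x)"
proof
  assume "int n dvd x"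
  then show "\<forall>p\<in>prime_factors n. int p dvd x" by (meson dvd_trans in_prime_factors_imp_dvd int_dvd_int_iff)
next
  assume "\<forall>p\<in>prime_factors n. int p dvd x"
  then have "\<Prod>(prime_factors n) dvd nat \<bar>x\<bar>"
    by (intro prod_primes_dvd) (auto simp: in_prime_factors_imp_prime)
  then show "int n dvd x" unfolding squarefree_prod_prime_factors[OF assms] by (simp only: dvd_nat_abs_iff)
qed

lemma squarefree_lcm:
  assumes "squarefree (a::nat)" "squarefree b"
  shows "squarefree (lcm a b)"
proof -
  have ab: "a \<noteq> 0" "b \<noteq> 0" using assms by (metis not_squarefree_0)+
  then show ?thesis
    using assms prime_factors_lcm[of a b] by (auto simp: squarefree_factorial_semiring'' multiplicity_lcm)
qed

lemma two_power_omega_le_divcount: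
  assumes "n > 0"
  shows "2 ^ card (prime_factors n) \<le> divcount n"
proof -
  have "Pow (prime_factors n) \<subseteq> prime_factors ` {d. d dvd n}"
  proof
    fix S assume "S \<in> Pow (prime_factors n)"
    then have S: "S \<subseteq> prime_factors n" by simp
    then have fin: "finite S" by (rule finite_subset) simp
    have "\<Prod>S dvd n"
      using S by (intro prod_primes_dvd[OF fin]) (auto simp: in_prime_factors_imp_prime in_prime_factors_imp_dvd)
    moreover have "prime_factors (\<Prod>S) = S"
    proof -
      have "0 \<notin> (\<lambda>x. x) ` S" using S by auto
      then have "prime_factors (\<Prod>S) = \<Union>((prime_factors \<circ> (\<lambda>x. x)) ` S)" by (rule prime_factors_prod[OF fin])
      also have "\<dots> = (\<Union>p\<in>S. {p})"
      proof (rule SUP_cong)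
        fix p assume "p \<in> S"
        then have "prime p" using S by auto
        then show "(prime_factors \<circ> (\<lambda>x. x)) p = {p}" by (simp add: prime_factorization_prime)
      qed simp
      finally show ?thesis by simp
    qed
    ultimately show "S \<in> prime_factors ` {d. d dvd n}" by (metis image_eqI mem_Collect_eq)
  qed
  then have "card (Pow (prime_factors n)) \<le> card {d. d dvd n}"
    using assms by (intro surj_card_le) auto
  then show ?thesis by (simp add: divcount_def card_Pow)
qed

lemma prod_gcd_le:
  assumes g: "squarefree (g::nat)"
  shows "(\<Prod>p\<in>prime_factors g. real_of_int (gcd (int p) D)) \<le> real_of_int (gcd (int g) D)"
proof -
  define S where "S = {p \<in> prime_factors g. int p dvd D}"
  have g0: "g > 0" using g by (metis not_squarefree_0 gr0I)
  have fin: "finite S" by (simp add: S_def)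
  have "(\<Prod>p\<in>prime_factors g. real_of_int (gcd (int p) D)) = (\<Prod>p\<in>prime_factors g. if int p dvd D then real p else 1)"
  proof (rule prod.cong)
    fix p assume "p \<in> prime_factors g"
    then have "prime p" by auto
    then have "coprime (int p) D" if "\<not> int p dvd D" using that by (metis prime_imp_coprime prime_nat_int_transfer)
    then show "real_of_int (gcd (int p) D) = (if int p dvd D then real p else 1)" by auto
  qed simp
  also have "\<dots> = (\<Prod>p\<in>S. real p)" unfolding S_def by (simp add: prod.inter_filter)
  also have "\<dots> = real (\<Prod>S)" by simp
  finally have eq: "(\<Prod>p\<in>prime_factors g. real_of_int (gcd (int p) D)) = real (\<Prod>S)" .
  have "\<Prod>S dvd g" by (intro prod_primes_dvd[OF fin]) (auto simp: S_def)
  moreover have "int (\<Prod>S) dvd D"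
  proof -
    have "\<Prod>S dvd nat \<bar>D\<bar>" by (intro prod_primes_dvd[OF fin]) (auto simp: S_def)
    then show ?thesis by (simp only: dvd_nat_abs_iff)
  qed
  ultimately have "int (\<Prod>S) dvd gcd (int g) D" by (simp del: of_nat_prod)
  then have "int (\<Prod>S) \<le> gcd (int g) D" using g0 by (intro zdvd_imp_le) auto
  then show ?thesis unfolding eq by (metis of_int_le_iff of_int_of_nat_eq)
qed

text \<open>The middle piece \<open>y\<close> is kept apart from the outer pair \<open>u\<close>, in
  the shape of the operator of \<open>opnorm_le\<close>.\<close>

definition correlation :: "real \<Rightarrow> nat \<Rightarrow> int \<Rightarrow> imat \<Rightarrow> nat \<Rightarrow> int \<Rightarrow> imat \<Rightarrow> real" where
  "correlation R q t w q' t' w' = (\<Sum>y\<in>Ybox R. \<Sum>u\<in>Ybox R \<times> Ybox R.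
     Xi q (ff ((fst u ** y ** snd u) ** w) - t) * Xi q' (ff ((fst u ** y ** snd u) ** w') - t'))"

text \<open>Both \<open>Xi\<close> factors are products over primes of functions of the residue, so
  the kernel is a tensor product over the primes of m. Families of residues indexed by these primes
  stand in for SL_2(Z/m), and since m is square-free two matrices have the same family exactly when
  they are congruent modulo m. Of the three collision counts one comes from \<open>y\<close> and two
  from the pair \<open>u\<close>.\<close>

lemma correlation_squared_le:
  assumes q: "squarefree q" "squarefree q'" and t: "[t\<^sup>2 = 4] (mod int q)" "[t'\<^sup>2 = 4] (mod int q')"
    and w: "det w = 1" "det w' = 1"
  defines "g \<equiv> gcd q q'" and "m \<equiv> lcm q q'" and "D \<equiv> (ff (adj w ** w'))\<^sup>2 - 4"
  shows "(correlation R q t w q' t' w')\<^sup>2 \<le> 1024 ^ card (prime_factors m) * (real g ^ 5 * (real_of_int (gcd (int g) D))\<^sup>2) *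
     (real m / real g) ^ 6 * real (card {(y, z) \<in> Ybox R \<times> Ybox R. mat_cong m y z}) ^ 3"
proof -
  define P where "P = prime_factors m"
  have q0: "q > 0" "q' > 0" using q by (metis not_squarefree_0 gr0I)+
  then have gm0: "g > 0" "m > 0" by (auto simp: g_def m_def lcm_pos_nat)
  have sm: "squarefree m" unfolding m_def by (rule squarefree_lcm[OF q])
  have sg: "squarefree g" using q(1) unfolding g_def by (meson gcd_dvd1 squarefree_mono)
  have P: "prime p" if "p \<in> P" for p using that by (auto simp: P_def)
  have Pq: "prime_factors q \<subseteq> P" "prime_factors q' \<subseteq> P" "prime_factors g \<subseteq> P"
    unfolding P_def g_def using gm0 q0 by (intro dvd_prime_factors; simp add: m_def; meson dvd_lcmI1 dvd_trans gcd_dvd1)+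
  have finP: "finite P" by (simp add: P_def)
  define F where "F p x = (if p \<in> prime_factors q then Xi_prime p (ff (x ** w) - t) else 1) *
      (if p \<in> prime_factors q' then Xi_prime p (ff (x ** w') - t') else 1)" for p x
  define B where "B p = (if p \<in> prime_factors g then 1024 * (real p ^ 5 * (real_of_int (gcd (int p) D))\<^sup>2) else 1024 * real p ^ 6)" for p
  have B0: "B p \<ge> 0" for p by (simp add: B_def)
  have pg: "p \<in> prime_factors g \<longleftrightarrow> p \<in> prime_factors q \<and> p \<in> prime_factors q'" for p
    using q0 gm0(1) by (auto simp: g_def in_prime_factors_iff)
  have pm: "p \<in> P \<longleftrightarrow> p \<in> prime_factors q \<or> p \<in> prime_factors q'" for p
    using prime_factors_lcm[of q q'] q0 by (auto simp: P_def m_def)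
  have tp: "[t\<^sup>2 = 4] (mod int p)" if "p \<in> prime_factors q" for p
    using that t(1) by (meson cong_dvd_modulus in_prime_factors_imp_dvd int_dvd_int_iff)
  have tp': "[t'\<^sup>2 = 4] (mod int p)" if "p \<in> prime_factors q'" for p
    using that t(2) by (meson cong_dvd_modulus in_prime_factors_imp_dvd int_dvd_int_iff)
  have opnorm_le: "opnorm_le p (F p) (B p)" and per: "periodic p (F p)" if pP: "p \<in> P" for p
  proof -
    have X: "periodic p (\<lambda>x. Xi_prime p (ff (x ** v) - s))" for v s
      unfolding periodic_def
    proof (intro allI impI)
      fix x y assume "mat_cong p x y"
      then have "[ff (x ** v) - s = ff (y ** v) - s] (mod int p)"
        by (intro cong_diff cong_refl mat_cong_ff mat_cong_mult mat_cong_refl)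
      then have "[ff (x ** v) - s = 0] (mod int p) \<longleftrightarrow> [ff (y ** v) - s = 0] (mod int p)"
        by (meson cong_sym cong_trans)
      then show "Xi_prime p (ff (x ** v) - s) = Xi_prime p (ff (y ** v) - s)" by (simp add: Xi_prime_def)
    qed
    show "periodic p (F p)" unfolding periodic_def F_def using X unfolding periodic_def by presburger
    show "opnorm_le p (F p) (B p)"
    proof (cases "p \<in> prime_factors g")
      case True
      then have "F p = (\<lambda>x. Xi_prime p (ff (x ** w) - t) * Xi_prime p (ff (x ** w') - t'))"
        using pg by (auto simp: F_def)
      then show ?thesis using True opnorm_le_Xi_pair[OF P[OF pP] tp tp' w] pg by (simp add: B_def D_def)
    next
      case False
      then consider "p \<in> prime_factors q" "p \<notin> prime_factors q'" | "p \<notin> prime_factors q" "p \<in> prime_factors q'"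
        using pg pm pP by blast
      then show ?thesis
      proof cases
        case 1
        then have "F p = (\<lambda>x. Xi_prime p (ff (x ** w) - t))" by (auto simp: F_def)
        then show ?thesis using False opnorm_le_Xi[OF P[OF pP] tp[OF 1(1)] w(1)] by (simp add: B_def)
      next
        case 2
        then have "F p = (\<lambda>x. Xi_prime p (ff (x ** w') - t'))" by (auto simp: F_def)
        then show ?thesis using False opnorm_le_Xi[OF P[OF pP] tp'[OF 2(2)] w(2)] by (simp add: B_def)
      qed
    qed
  qed
  define Y where "Y = Ybox R"
  have finY: "finite Y" by (simp add: Y_def finite_Ybox)
  define K where "K = (\<lambda>(p::nat) (b::imat) (a::imat \<times> imat). F p (fst a ** b ** snd a))"
  define \<phi> where "\<phi> y = (\<lambda>p\<in>P. red p y)" for y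
  define \<psi> where "\<psi> u = (\<lambda>p\<in>P. (red p (fst u), red p (snd u)))" for u
  have redY: "red p y \<in> SL2_mod p" if "p \<in> P" "y \<in> Y" for p y
    using that P prime_gt_0_nat by (intro red_in) (auto simp: Y_def Ybox_def)
  have Xiprod: "Xi q (ff (x ** w) - t) * Xi q' (ff (x ** w') - t') = (\<Prod>p\<in>P. F p x)" for x
  proof -
    have "(\<Prod>p\<in>P. if p \<in> prime_factors n then f p else 1) = prod f (prime_factors n)"
      if "prime_factors n \<subseteq> P" for n :: nat and f :: "nat \<Rightarrow> real"
      using that finP by (simp add: prod.If_cases Int_absorb1 Int_def[symmetric])
    then show ?thesis using Pq unfolding F_def prod.distrib Xi_def by presburger
  qed
  have K: "(\<Prod>p\<in>P. K p (\<phi> y p) (\<psi> u p)) = (\<Prod>p\<in>P. F p (fst u ** y ** snd u))" for y u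
  proof (rule prod.cong)
    fix p assume p: "p \<in> P"
    have "mat_cong p (red p (fst u) ** red p y ** red p (snd u)) (fst u ** y ** snd u)" by (intro mat_cong_mult mat_cong_red)
    then show "K p (\<phi> y p) (\<psi> u p) = F p (fst u ** y ** snd u)"
      using per[OF p] p unfolding periodic_def K_def \<phi>_def \<psi>_def by simp
  qed simp
  have "(correlation R q t w q' t' w')\<^sup>2 = (\<Sum>y\<in>Y. \<Sum>u\<in>Y \<times> Y. (\<Prod>p\<in>P. K p (\<phi> y p) (\<psi> u p)))\<^sup>2"
    unfolding correlation_def Xiprod K Y_def ..
  also have "\<dots> \<le> (\<Prod>p\<in>P. B p) * real (card {(y, y') \<in> Y \<times> Y. \<phi> y = \<phi> y'}) *
      real (card {(u, u') \<in> (Y \<times> Y) \<times> (Y \<times> Y). \<psi> u = \<psi> u'})"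
  proof (rule bilinear_pushforward[where B = "Pi\<^sub>E P SL2_mod" and A = "Pi\<^sub>E P (\<lambda>p. SL2_mod p \<times> SL2_mod p)"
        and K = "\<lambda>b a. \<Prod>p\<in>P. K p (b p) (a p)"])
    show "\<phi> ` Y \<subseteq> Pi\<^sub>E P SL2_mod" using redY by (auto simp: \<phi>_def)
    show "\<psi> ` (Y \<times> Y) \<subseteq> Pi\<^sub>E P (\<lambda>p. SL2_mod p \<times> SL2_mod p)" using redY by (auto simp: \<psi>_def)
    show "(\<Sum>b\<in>Pi\<^sub>E P SL2_mod. (\<Sum>a\<in>Pi\<^sub>E P (\<lambda>p. SL2_mod p \<times> SL2_mod p). (\<Prod>p\<in>P. K p (b p) (a p)) * \<nu> a)\<^sup>2)
        \<le> (\<Prod>p\<in>P. B p) * (\<Sum>a\<in>Pi\<^sub>E P (\<lambda>p. SL2_mod p \<times> SL2_mod p). (\<nu> a)\<^sup>2)" for \<nu>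
      using opnorm_le unfolding opnorm_le_def K_def by (intro tensor_opnorm finP B0) auto
  qed (use finY finP in \<open>auto intro!: finite_PiE\<close>)
  \<comment> \<open>Two pairs collide when both coordinates do, so regrouping the coordinates
    identifies the set of collisions with a Cartesian square.\<close>
  also have "card {(u, u') \<in> (Y \<times> Y) \<times> (Y \<times> Y). \<psi> u = \<psi> u'} = (card {(y, z) \<in> Y \<times> Y. mat_cong m y z})\<^sup>2"
  proof -
    define E where "E = {(y, z) \<in> Y \<times> Y. mat_cong m y z}"
    have mc: "mat_cong m y z \<longleftrightarrow> (\<forall>p\<in>P. mat_cong p y z)" for y z
      unfolding mat_cong_def P_def cong_iff_dvd_diff squarefree_dvd_int_iff[OF sm] by blast
    have "\<psi> u = \<psi> u' \<longleftrightarrow> (\<forall>p\<in>P. mat_cong p (fst u) (fst u') \<and> mat_cong p (snd u) (snd u'))" for u u'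
      by (auto simp: \<psi>_def fun_eq_iff restrict_def red_eq_iff)
    then have "\<psi> u = \<psi> u' \<longleftrightarrow> mat_cong m (fst u) (fst u') \<and> mat_cong m (snd u) (snd u')" for u u'
      unfolding mc by blast
    then have "{(u, u') \<in> (Y \<times> Y) \<times> (Y \<times> Y). \<psi> u = \<psi> u'}
      = (\<lambda>((a, b), (c, d)). ((a, c), (b, d))) ` (E \<times> E)"
      by (auto simp: E_def image_iff)
    moreover have "inj_on (\<lambda>((a, b), (c, d)). ((a, c), (b, d))) (E \<times> E)" by (auto simp: inj_on_def)
    ultimately show ?thesis
      unfolding E_def[symmetric] by (simp only: card_image card_cartesian_product power2_eq_square)
  qed
  also have "card {(y, y') \<in> Y \<times> Y. \<phi> y = \<phi> y'} = card {(y, z) \<in> Y \<times> Y. mat_cong m y z}"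
  proof -
    have mc: "mat_cong m y z \<longleftrightarrow> (\<forall>p\<in>P. mat_cong p y z)" for y z
      unfolding mat_cong_def P_def cong_iff_dvd_diff squarefree_dvd_int_iff[OF sm] by blast
    have "\<phi> y = \<phi> y' \<longleftrightarrow> mat_cong m y y'" for y y'
      unfolding mc by (auto simp: \<phi>_def fun_eq_iff restrict_def red_eq_iff)
    then show ?thesis by simp
  qed
  finally have 1: "(correlation R q t w q' t' w')\<^sup>2 \<le> (\<Prod>p\<in>P. B p) * real (card {(y, z) \<in> Y \<times> Y. mat_cong m y z}) ^ 3"
    by (simp add: power2_eq_square power3_eq_cube mult.assoc)
  have "(\<Prod>p\<in>P. B p) = (\<Prod>p\<in>prime_factors g. B p) * (\<Prod>p\<in>P - prime_factors g. B p)"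
    using Pq(3) finP by (metis mult.commute prod.subset_diff)
  also have "(\<Prod>p\<in>prime_factors g. B p) = (\<Prod>p\<in>prime_factors g. 1024 * (real p ^ 5 * (real_of_int (gcd (int p) D))\<^sup>2))"
    by (intro prod.cong) (auto simp: B_def)
  also have "\<dots> = 1024 ^ card (prime_factors g) * ((\<Prod>p\<in>prime_factors g. real p) ^ 5 * (\<Prod>p\<in>prime_factors g. real_of_int (gcd (int p) D))\<^sup>2)"
    by (simp add: prod.distrib prod_power_distrib)
  also have "(\<Prod>p\<in>P - prime_factors g. B p) = (\<Prod>p\<in>P - prime_factors g. 1024 * real p ^ 6)"
    by (intro prod.cong) (auto simp: B_def)
  also have "\<dots> = 1024 ^ card (P - prime_factors g) * (\<Prod>p\<in>P - prime_factors g. real p) ^ 6"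
    by (simp add: prod.distrib prod_power_distrib)
  also have pgr: "(\<Prod>p\<in>prime_factors g. real p) = real g"
    using arg_cong[OF squarefree_prod_prime_factors[OF sg], of real] by (simp only: of_nat_prod)
  also have "(\<Prod>p\<in>P - prime_factors g. real p) = real m / real g"
  proof -
    have "real m = (\<Prod>p\<in>P. real p)" 
      using arg_cong[OF squarefree_prod_prime_factors[OF sm], of real] by (simp only: of_nat_prod P_def)
    also have "\<dots> = (\<Prod>p\<in>P - prime_factors g. real p) * real g"
      using Pq(3) finP pgr by (metis prod.subset_diff)
    finally show ?thesis using gm0 by simp
  qed
  finally have 2: "(\<Prod>p\<in>P. B p) = 1024 ^ card (prime_factors g) * (real g ^ 5 * (\<Prod>p\<in>prime_factors g. real_of_int (gcd (int p) D))\<^sup>2) *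
    (1024 ^ card (P - prime_factors g) * (real m / real g) ^ 6)" .
  have c: "card (prime_factors g) + card (P - prime_factors g) = card P"
    using Pq(3) finP by (metis card_Diff_subset card_mono finite_subset le_add_diff_inverse)
  have "(\<Prod>p\<in>P. B p) = 1024 ^ card P * (real g ^ 5 * (\<Prod>p\<in>prime_factors g. real_of_int (gcd (int p) D))\<^sup>2) * (real m / real g) ^ 6"
    unfolding 2 c[symmetric] power_add by (simp only: mult_ac)
  also have "\<dots> \<le> 1024 ^ card P * (real g ^ 5 * (real_of_int (gcd (int g) D))\<^sup>2) * (real m / real g) ^ 6"
    by (intro mult_left_mono mult_right_mono power_mono prod_gcd_le[OF sg] prod_nonneg) auto
  finally have "(\<Prod>p\<in>P. B p) \<le> 1024 ^ card P * (real g ^ 5 * (real_of_int (gcd (int g) D))\<^sup>2) * (real m / real g) ^ 6" .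
  then have "(\<Prod>p\<in>P. B p) * real (card {(y, z) \<in> Y \<times> Y. mat_cong m y z}) ^ 3
    \<le> 1024 ^ card P * (real g ^ 5 * (real_of_int (gcd (int g) D))\<^sup>2) * (real m / real g) ^ 6 * real (card {(y, z) \<in> Y \<times> Y. mat_cong m y z}) ^ 3"
    by (intro mult_right_mono) auto
  with 1 show ?thesis by (simp add: P_def Y_def)
qed

section \<open>Divisor sums and the trivial bound\<close>

definition nat_below :: "real \<Rightarrow> nat set" where "nat_below Q = {k. 1 \<le> k \<and> real k < Q}"
definition harm_below :: "real \<Rightarrow> real" where "harm_below Q = (\<Sum>k\<in>nat_below Q. 1 / real k)"

lemma finite_nat_below: "finite (nat_below Q)"
proof (rule finite_subset)
  show "nat_below Q \<subseteq> {..nat \<lceil>Q\<rceil>}"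
  proof
    fix k assume "k \<in> nat_below Q"
    then have "int k \<le> \<lceil>Q\<rceil>" by (simp add: nat_below_def le_ceiling_iff)
    then show "k \<in> {..nat \<lceil>Q\<rceil>}" by simp
  qed
qed simp

lemma harm_below_nonneg: "0 \<le> harm_below Q" by (simp add: harm_below_def sum_nonneg)

lemma sum_multiples:
  fixes f :: "nat \<Rightarrow> real"
  assumes "e \<ge> 1" "\<And>k. 0 \<le> f k"
  shows "(\<Sum>q\<in>{q\<in>nat_below Q. e dvd q}. f (q div e)) \<le> (\<Sum>k\<in>nat_below Q. f k)"
proof -
  have inj: "inj_on (\<lambda>q. q div e) {q\<in>nat_below Q. e dvd q}"
    using assms(1) by (auto simp: inj_on_def elim!: dvdE)
  have "(\<lambda>q. q div e) ` {q\<in>nat_below Q. e dvd q} \<subseteq> nat_below Q"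
  proof safe
    fix q assume q: "q \<in> nat_below Q" "e dvd q"
    then have "q div e \<le> q" "q div e \<ge> 1" using assms(1) by (auto simp: nat_below_def elim!: dvdE)
    moreover have "real (q div e) \<le> real q" by simp
    ultimately show "q div e \<in> nat_below Q" using q unfolding nat_below_def mem_Collect_eq by linarith
  qed
  then have "(\<Sum>k\<in>(\<lambda>q. q div e) ` {q\<in>nat_below Q. e dvd q}. f k) \<le> (\<Sum>k\<in>nat_below Q. f k)"
    using assms finite_nat_below by (intro sum_mono2) auto
  then show ?thesis by (simp add: sum.reindex[OF inj])
qed

lemma sum_multiples_inverse:
  assumes "e \<ge> 1"
  shows "(\<Sum>q\<in>{q\<in>nat_below Q. e dvd q}. 1 / real q) \<le> harm_below Q / real e"
proof -
  have "(\<Sum>q\<in>{q\<in>nat_below Q. e dvd q}. 1 / real q) = (\<Sum>q\<in>{q\<in>nat_below Q. e dvd q}. 1 / real (q div e)) / real e"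
    unfolding sum_divide_distrib by (intro sum.cong) (auto elim!: dvdE simp: assms)
  also have "\<dots> \<le> harm_below Q / real e"
    unfolding harm_below_def by (intro divide_right_mono sum_multiples[OF assms]) auto
  finally show ?thesis .
qed

text \<open>The gcd is one of the divisors d of \<open>D\<close> dividing e, so the sum is at most
  that of d / e over all such d and e. For fixed d the multiples e contribute d * (1/d) times the
  harmonic sum.\<close>

lemma sum_gcd_le:
  assumes "D \<noteq> 0"
  shows "(\<Sum>e\<in>nat_below Q. real_of_int (gcd (int e) D) / real e) \<le> real (divcount (nat \<bar>D\<bar>)) * harm_below Q"
proof -
  define V where "V = {d. d dvd nat \<bar>D\<bar>}"
  have finV: "finite V" unfolding V_def using assms by (intro finite_divisors_nat) simp
  have "real_of_int (gcd (int e) D) / real e \<le> (\<Sum>d\<in>V. if d dvd e then real d / real e else 0)" if "e \<in> nat_below Q" for e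
  proof -
    define d where "d = nat (gcd (int e) D)"
    have d: "int d = gcd (int e) D" by (simp add: d_def)
    have "int d dvd int e" "int d dvd D" unfolding d by auto
    then have de: "d dvd e" "d \<in> V" by (simp_all add: V_def)
    have "real_of_int (gcd (int e) D) / real e = (if d dvd e then real d / real e else 0)"
      using de by (simp flip: d)
    also have "\<dots> \<le> (\<Sum>d\<in>V. if d dvd e then real d / real e else 0)"
      using finV de by (intro member_le_sum) auto
    finally show ?thesis .
  qed
  then have "(\<Sum>e\<in>nat_below Q. real_of_int (gcd (int e) D) / real e) \<le> (\<Sum>e\<in>nat_below Q. \<Sum>d\<in>V. if d dvd e then real d / real e else 0)"
    by (rule sum_mono)
  also have "\<dots> = (\<Sum>d\<in>V. real d * (\<Sum>e\<in>{e\<in>nat_below Q. d dvd e}. 1 / real e))"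
    by (subst sum.swap) (simp add: sum_distrib_left sum.inter_filter[OF finite_nat_below] if_distrib cong: if_cong)
  also have "\<dots> \<le> (\<Sum>d\<in>V. harm_below Q)"
  proof (rule sum_mono)
    fix d assume "d \<in> V"
    then have d: "d \<ge> 1" using assms by (auto simp: V_def Suc_le_eq intro!: Nat.gr0I)
    have "real d * (\<Sum>e\<in>{e\<in>nat_below Q. d dvd e}. 1 / real e) \<le> real d * (harm_below Q / real d)"
      by (intro mult_left_mono sum_multiples_inverse d) auto
    then show "real d * (\<Sum>e\<in>{e\<in>nat_below Q. d dvd e}. 1 / real e) \<le> harm_below Q" using d by simp
  qed
  finally show ?thesis by (simp add: V_def divcount_def)
qed

text \<open>Replacing the value at the gcd by the sum over all common divisors e decouples q from
  q'; each of them then gives \<open>harm_below Q / e\<close>.\<close>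

lemma sum_pairs_gcd:
  fixes f :: "nat \<Rightarrow> real"
  assumes S: "S \<subseteq> nat_below Q" and f: "\<And>e. 0 \<le> f e"
  shows "(\<Sum>q\<in>S. \<Sum>q'\<in>S. f (gcd q q') / (real q * real q')) \<le> (\<Sum>e\<in>nat_below Q. f e / (real e)\<^sup>2) * (harm_below Q)\<^sup>2"
proof -
  have "(\<Sum>q\<in>S. \<Sum>q'\<in>S. f (gcd q q') / (real q * real q'))
      \<le> (\<Sum>q\<in>nat_below Q. \<Sum>q'\<in>nat_below Q. f (gcd q q') / (real q * real q'))"
  proof -
    have "(\<Sum>q\<in>S. \<Sum>q'\<in>S. f (gcd q q') / (real q * real q')) \<le> (\<Sum>q\<in>S. \<Sum>q'\<in>nat_below Q. f (gcd q q') / (real q * real q'))"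
      using S f finite_nat_below by (intro sum_mono sum_mono2) auto
    also have "\<dots> \<le> (\<Sum>q\<in>nat_below Q. \<Sum>q'\<in>nat_below Q. f (gcd q q') / (real q * real q'))"
      using S f finite_nat_below by (intro sum_mono2 sum_nonneg) auto
    finally show ?thesis .
  qed
  also have "\<dots> \<le> (\<Sum>q\<in>nat_below Q. \<Sum>q'\<in>nat_below Q. \<Sum>e\<in>nat_below Q. if e dvd q \<and> e dvd q' then f e / (real q * real q') else 0)"
  proof (intro sum_mono)
    fix q q' assume q: "q \<in> nat_below Q" "q' \<in> nat_below Q"
    have "gcd q q' \<le> q" "gcd q q' \<ge> 1" using q by (auto simp: nat_below_def gcd_le1_nat Suc_le_eq)
    then have g: "gcd q q' \<in> nat_below Q" using q by (simp add: nat_below_def)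
    have "f (gcd q q') / (real q * real q') = (if gcd q q' dvd q \<and> gcd q q' dvd q' then f (gcd q q') / (real q * real q') else 0)" by simp
    also have "\<dots> \<le> (\<Sum>e\<in>nat_below Q. if e dvd q \<and> e dvd q' then f e / (real q * real q') else 0)"
      using g finite_nat_below f by (intro member_le_sum) auto
    finally show "f (gcd q q') / (real q * real q') \<le> (\<Sum>e\<in>nat_below Q. if e dvd q \<and> e dvd q' then f e / (real q * real q') else 0)" .
  qed
  also have "\<dots> = (\<Sum>e\<in>nat_below Q. f e * (\<Sum>q\<in>{q\<in>nat_below Q. e dvd q}. 1 / real q)\<^sup>2)"
  proof -
    have "(\<Sum>q\<in>nat_below Q. \<Sum>q'\<in>nat_below Q. \<Sum>e\<in>nat_below Q. if e dvd q \<and> e dvd q' then f e / (real q * real q') else 0)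
      = (\<Sum>q\<in>nat_below Q. \<Sum>e\<in>nat_below Q. \<Sum>q'\<in>nat_below Q. if e dvd q \<and> e dvd q' then f e / (real q * real q') else 0)"
      by (intro sum.cong sum.swap refl)
    also have "\<dots> = (\<Sum>e\<in>nat_below Q. \<Sum>q\<in>nat_below Q. \<Sum>q'\<in>nat_below Q. if e dvd q \<and> e dvd q' then f e / (real q * real q') else 0)"
      by (rule sum.swap)
    also have "\<dots> = (\<Sum>e\<in>nat_below Q. \<Sum>q\<in>nat_below Q. \<Sum>q'\<in>nat_below Q. f e * ((if e dvd q then 1 / real q else 0) * (if e dvd q' then 1 / real q' else 0)))"
      by (intro sum.cong) auto
    also have "\<dots> = (\<Sum>e\<in>nat_below Q. f e * ((\<Sum>q\<in>nat_below Q. if e dvd q then 1 / real q else 0) * (\<Sum>q'\<in>nat_below Q. if e dvd q' then 1 / real q' else 0)))"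
      by (subst sum_product) (simp only: sum_distrib_left)
    finally show ?thesis by (simp add: power2_eq_square sum.inter_filter[OF finite_nat_below])
  qed
  also have "\<dots> \<le> (\<Sum>e\<in>nat_below Q. f e * (harm_below Q / real e)\<^sup>2)"
    by (intro sum_mono mult_left_mono power_mono sum_multiples_inverse f sum_nonneg) (auto simp: nat_below_def)
  also have "\<dots> = (\<Sum>e\<in>nat_below Q. f e / (real e)\<^sup>2) * (harm_below Q)\<^sup>2"
    by (simp add: sum_distrib_right power_divide)
  finally show ?thesis .
qed

text \<open>At every prime dividing q the root t is 2 or -2, so t is determined by the divisor gcd(t
  - 2, q) of q.\<close>

lemma card_sqrt4_mod:
  assumes q: "squarefree q"
  shows "finite (sqrt4_mod q)" "card (sqrt4_mod q) \<le> divcount q"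
proof -
  show "finite (sqrt4_mod q)" by (rule finite_subset[of _ "{0..<int q}"]) (auto simp: sqrt4_mod_def)
  have q0: "q > 0" using q by (metis not_squarefree_0 gr0I)
  define f where "f t = nat (gcd (t - 2) (int q))" for t
  have "inj_on f (sqrt4_mod q)"
  proof (rule inj_onI)
    fix s t assume s: "s \<in> sqrt4_mod q" and t: "t \<in> sqrt4_mod q" and e: "f s = f t"
    have g: "gcd (s - 2) (int q) = gcd (t - 2) (int q)" using e unfolding f_def by (simp only: nat_eq_iff2) (metis gcd_ge_0_int nat_0_le)
    have "int p dvd s - t" if p: "p \<in> prime_factors q" for p
    proof -
      have pq: "int p dvd int q" "prime p" using p by (auto simp: in_prime_factors_imp_dvd)
      have iff: "int p dvd s - 2 \<longleftrightarrow> int p dvd t - 2"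
        using g pq by (metis gcd_greatest_iff)
      have two: "int p dvd u - 2 \<or> int p dvd u + 2" if "u \<in> sqrt4_mod q" for u
      proof -
        have "int q dvd u\<^sup>2 - 4" using that by (simp add: sqrt4_mod_def cong_iff_dvd_diff)
        then have "int p dvd u\<^sup>2 - 4" using pq dvd_trans by blast
        also have "u\<^sup>2 - 4 = (u - 2) * (u + 2)" by (simp add: algebra_simps power2_eq_square)
        finally show ?thesis using pq by (simp add: prime_dvd_mult_int)
      qed
      show ?thesis
      proof (cases "int p dvd s - 2")
        case True
        then have "int p dvd (s - 2) - (t - 2)" using iff by (metis dvd_diff)
        then show ?thesis by simp
      next
        case False
        then have "int p dvd (s + 2) - (t + 2)" using iff two[OF s] two[OF t] by (metis dvd_diff)
        then show ?thesis by simp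
      qed
    qed
    then have "int q dvd s - t" using squarefree_dvd_int_iff[OF q] by blast
    moreover have "\<bar>s - t\<bar> < int q" using s t by (auto simp: sqrt4_mod_def)
    ultimately show "s = t" by (rule int_eq_of_dvd_diff)
  qed
  moreover have "f ` sqrt4_mod q \<subseteq> {d. d dvd q}" by (auto simp: f_def nat_dvd_iff)
  ultimately show "card (sqrt4_mod q) \<le> divcount q"
    unfolding divcount_def using q0 by (intro card_inj_on_le[of f]) auto
qed

text \<open>As k is square-free, q and k / q are coprime, so a lift is determined by its residue
  modulo k / q, which is again a square root of 4.\<close>

lemma card_lifts_sqrt4_mod:
  assumes k: "squarefree k" and q: "q dvd k"
  shows "card {\<tau> \<in> sqrt4_mod k. [\<tau> = t] (mod int q)} \<le> divcount (k div q)"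
proof -
  obtain j where kj: "k = q * j" using q by blast
  have k0: "k > 0" using k by (metis not_squarefree_0 gr0I)
  have q0: "q > 0" "j > 0" using k0 kj by auto
  have j: "k div q = j" using kj q0 by simp
  have sj: "squarefree j" using k kj by (metis dvd_triv_right squarefree_mono)
  have cop: "coprime q j"
  proof (rule coprimeI)
    fix d assume "d dvd q" "d dvd j"
    then have "d\<^sup>2 dvd k" unfolding kj power2_eq_square by (rule mult_dvd_mono)
    then show "is_unit d" using k squarefreeD by blast
  qed
  have "card {\<tau> \<in> sqrt4_mod k. [\<tau> = t] (mod int q)} \<le> card (sqrt4_mod j)"
  proof (rule card_inj_on_le[of "\<lambda>\<tau>. \<tau> mod int j"])
    show "inj_on (\<lambda>\<tau>. \<tau> mod int j) {\<tau> \<in> sqrt4_mod k. [\<tau> = t] (mod int q)}"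
    proof (rule inj_onI)
      fix x y assume x: "x \<in> {\<tau> \<in> sqrt4_mod k. [\<tau> = t] (mod int q)}" and y: "y \<in> {\<tau> \<in> sqrt4_mod k. [\<tau> = t] (mod int q)}"
        and e: "x mod int j = y mod int j"
      have "int j dvd x - y" using e by (simp add: mod_eq_dvd_iff)
      moreover have "int q dvd x - y"
      proof -
        have "[x = t] (mod int q)" "[t = y] (mod int q)" using x y by (auto simp: cong_sym)
        then have "[x = y] (mod int q)" by (rule cong_trans)
        then show ?thesis by (simp add: cong_iff_dvd_diff)
      qed
      ultimately have "int q * int j dvd x - y" using cop by (intro divides_mult) auto
      then have "int k dvd x - y" by (simp add: kj)
      moreover have "\<bar>x - y\<bar> < int k" using x y by (auto simp: sqrt4_mod_def)
      ultimately show "x = y" by (rule int_eq_of_dvd_diff)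
    qed
    show "(\<lambda>\<tau>. \<tau> mod int j) ` {\<tau> \<in> sqrt4_mod k. [\<tau> = t] (mod int q)} \<subseteq> sqrt4_mod j"
    proof safe
      fix x assume "x \<in> sqrt4_mod k"
      then have "[x\<^sup>2 = 4] (mod int j)" using kj by (auto simp: sqrt4_mod_def intro: cong_dvd_modulus)
      moreover have "[(x mod int j)\<^sup>2 = x\<^sup>2] (mod int j)" by (intro cong_pow) (simp add: cong_def)
      ultimately show "x mod int j \<in> sqrt4_mod j" using q0 by (auto simp: sqrt4_mod_def intro: cong_trans)
    qed
  qed (use card_sqrt4_mod[OF sj] in auto)
  also have "\<dots> \<le> divcount j" by (rule card_sqrt4_mod[OF sj])
  finally show ?thesis by (simp add: j)
qed

section \<open>Sizes of the density and of its centered indicator\<close>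

lemma rho_prime_le:
  assumes p: "prime (p::nat)"
  shows "rho_prime p \<le> 2 / real p"
proof (cases "p = 2")
  case True
  then show ?thesis using rho_prime_le_1[of p] by simp
next
  case odd: False
  have p2: "real p \<ge> 2" using prime_ge_2_nat[OF p] by simp
  define G where "G = real (card (SL2_mod p))"
  have G: "G = real p * ((real p)\<^sup>2 - 1)" "G > 0" using card_SL2_mod[OF p] card_SL2_mod_ge[OF p] by (auto simp: G_def)
  have "rho_prime p * G \<le> 2 * ((real p)\<^sup>2 - 1)"
  proof (cases "\<exists>i. [i\<^sup>2 = -1] (mod int p)")
    case True
    then obtain i where "[i\<^sup>2 = -1] (mod int p)" by blast
    from card_ff_residue[OF p odd this, of 1]
    have "rho_prime p * G = (2 * real p - 1) * (real p - 1)" using rho_prime_card[OF p] by (simp add: G_def)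
    also have "\<dots> \<le> (2 * (real p + 1)) * (real p - 1)" using p2 by (intro mult_right_mono) auto
    finally show ?thesis by (simp add: algebra_simps power2_eq_square)
  next
    case False
    have "card {y \<in> SL2_mod p. [ff y = 2] (mod int p)} \<le> 2 * p" using card_ff_nonresidue[OF p False, of 1] by simp
    then have "rho_prime p * G \<le> 2 * real p" unfolding G_def rho_prime_card[OF p] by linarith
    also have "2 * real p \<le> 2 * ((real p)\<^sup>2 - 1)"
    proof -
      have "2 * real p \<le> real p * real p" using p2 by (intro mult_right_mono) auto
      then show ?thesis using p2 unfolding power2_eq_square right_diff_distrib by linarith
    qed
    finally show ?thesis .
  qed
  also have "\<dots> = 2 / real p * G" using p2 by (simp add: G(1))
  finally show ?thesis using G(2) by (rule mult_right_le_imp_le)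
qed

lemma rho_nonneg: "0 \<le> rho k" unfolding rho_def by (intro prod_nonneg) (simp add: rho_prime_nonneg)

lemma prod_two_div_le:
  assumes k: "squarefree k"
  shows "(\<Prod>p\<in>prime_factors k. 2 / real p) \<le> real (divcount k) / real k"
proof -
  have k0: "k > 0" using k by (metis not_squarefree_0 gr0I)
  have "(\<Prod>p\<in>prime_factors k. 2 / real p) = 2 ^ card (prime_factors k) / (\<Prod>p\<in>prime_factors k. real p)"
    by (simp add: prod_dividef)
  also have "(\<Prod>p\<in>prime_factors k. real p) = real k"
    using arg_cong[OF squarefree_prod_prime_factors[OF k], of real] by (simp only: of_nat_prod)
  also have "2 ^ card (prime_factors k) / real k \<le> real (divcount k) / real k"
    using two_power_omega_le_divcount[OF k0] by (intro divide_right_mono) (simp_all flip: of_nat_le_iff)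
  finally show ?thesis .
qed

lemma rho_le:
  assumes k: "squarefree k"
  shows "rho k \<le> real (divcount k) / real k"
proof -
  have "rho k \<le> (\<Prod>p\<in>prime_factors k. 2 / real p)"
    unfolding rho_def by (intro prod_mono conjI rho_prime_nonneg rho_prime_le) auto
  then show ?thesis using prod_two_div_le[OF k] by linarith
qed

text \<open>A prime dividing n contributes at most 1, any other at most the density 2 / p; both are
  covered by 2 gcd(p, n) / p.\<close>

lemma Xi_le:
  assumes q: "squarefree q"
  shows "\<bar>Xi q n\<bar> \<le> real (divcount q) * real_of_int (gcd (int q) n) / real q"
proof -
  have "\<bar>Xi q n\<bar> = (\<Prod>p\<in>prime_factors q. \<bar>Xi_prime p n\<bar>)" by (simp add: Xi_def abs_prod)
  also have "\<dots> \<le> (\<Prod>p\<in>prime_factors q. 2 / real p * real_of_int (gcd (int p) n))"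
  proof (intro prod_mono conjI)
    fix p assume "p \<in> prime_factors q"
    then have p: "prime p" by auto
    have p2: "real p \<ge> 2" using prime_ge_2_nat[OF p] by simp
    show "\<bar>Xi_prime p n\<bar> \<le> 2 / real p * real_of_int (gcd (int p) n)"
    proof (cases "int p dvd n")
      case True
      have "\<bar>Xi_prime p n\<bar> \<le> 1" using rho_prime_nonneg[of p] rho_prime_le_1[of p] by (auto simp: Xi_prime_def)
      moreover have "gcd (int p) n = int p" using True by simp
      ultimately show ?thesis using p2 by simp
    next
      case False
      then have "\<bar>Xi_prime p n\<bar> = rho_prime p" using rho_prime_nonneg[of p] by (simp add: Xi_prime_def cong_0_iff)
      moreover have "gcd (int p) n = 1" using False p by (metis coprime_iff_gcd_eq_1 prime_imp_coprime prime_nat_int_transfer)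
      ultimately show ?thesis using rho_prime_le[OF p] by simp
    qed
  qed simp
  also have "\<dots> = (\<Prod>p\<in>prime_factors q. 2 / real p) * (\<Prod>p\<in>prime_factors q. real_of_int (gcd (int p) n))"
    by (simp only: prod.distrib)
  also have "\<dots> \<le> (real (divcount q) / real q) * real_of_int (gcd (int q) n)"
    by (intro mult_mono prod_two_div_le[OF q] prod_gcd_le[OF q] prod_nonneg) auto
  finally show ?thesis by simp
qed

definition sqfree_range :: "real \<Rightarrow> real \<Rightarrow> nat set" where "sqfree_range Q0 Q = {q. squarefree q \<and> Q0 < real q \<and> real q < Q}"

lemma sqfree_range_subset: "sqfree_range Q0 Q \<subseteq> nat_below Q"
proof
  fix q assume q: "q \<in> sqfree_range Q0 Q"
  then have "q \<noteq> 0" unfolding sqfree_range_def by (metis (mono_tags, lifting) mem_Collect_eq not_squarefree_0)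
  then show "q \<in> nat_below Q" using q by (simp add: sqfree_range_def nat_below_def)
qed

lemma finite_sqfree_range: "finite (sqfree_range Q0 Q)" using sqfree_range_subset finite_nat_below finite_subset by blast

definition expsum :: "imat set \<Rightarrow> nat \<Rightarrow> int \<Rightarrow> real" where
  "expsum P q t = (\<Sum>\<phi>\<in>P. Xi q (ff \<phi> - t))"

text \<open>The sum over \<tau> does not involve \<phi> and factors out; it has at most
  \<open>divcount (k div q)\<close> terms, each at most \<open>divcount (k div q)\<close> divided by
  k / q. Exchanging the sums over k and q and writing k = q j then separates the two.\<close>

lemma err_total_le:
  "err_total P Q0 Q \<le> (\<Sum>k\<in>nat_below Q. (real (divcount k))\<^sup>2 / real k) * (\<Sum>q\<in>sqfree_range Q0 Q. \<Sum>t\<in>sqrt4_mod q. \<bar>expsum P q t\<bar>)"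
proof -
  define c where "c j = (real (divcount j))\<^sup>2 / real j" for j
  define U where "U q = (\<Sum>t\<in>sqrt4_mod q. \<bar>expsum P q t\<bar>)" for q
  have c0: "0 \<le> c j" for j by (simp add: c_def)
  have U0: "0 \<le> U q" for q by (simp add: U_def sum_nonneg)
  have K: "{k::nat. squarefree k \<and> real k < Q} \<subseteq> nat_below Q"
  proof safe
    fix k assume "squarefree k" "real k < Q"
    then show "k \<in> nat_below Q" unfolding nat_below_def by (metis (mono_tags, lifting) One_nat_def Suc_leI gr0I mem_Collect_eq not_squarefree_0)
  qed
  have r: "\<bar>err_r P Q0 k\<bar> \<le> (\<Sum>q\<in>sqfree_range Q0 Q. if q dvd k then U q * c (k div q) else 0)"
    if k: "squarefree k" "real k < Q" for k
  proof -
    have k0: "k > 0" using k by (metis not_squarefree_0 gr0I)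
    have sub: "{q. q dvd k \<and> Q0 < real q} = {q \<in> sqfree_range Q0 Q. q dvd k}"
    proof safe
      fix q assume q: "q dvd k" "Q0 < real q"
      have "q \<le> k" using q k0 by (intro dvd_imp_le)
      then show "q \<in> sqfree_range Q0 Q" using q k squarefree_mono[OF q(1)] by (simp add: sqfree_range_def)
    qed (auto simp: sqfree_range_def)
    have "\<bar>err_r P Q0 k\<bar> \<le> (\<Sum>q\<in>{q \<in> sqfree_range Q0 Q. q dvd k}. U q * c (k div q))"
      unfolding err_r_def sub
    proof (rule order_trans[OF sum_abs], rule sum_mono)
      fix q assume "q \<in> {q \<in> sqfree_range Q0 Q. q dvd k}"
      then have q: "q dvd k" by auto
      obtain j where kj: "k = q * j" using q by blast
      have sj: "squarefree (k div q)" using k(1) q by (metis div_dvd_iff_mult dvd_triv_left dvd_mult_div_cancel dvd_triv_right squarefree_mono)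
      have *: "\<bar>\<Sum>\<phi>\<in>P. Xi q (ff \<phi> - t) * (\<Sum>\<tau>\<in>{\<tau> \<in> sqrt4_mod k. [\<tau> = t] (mod int q)}. rho (k div q))\<bar>
          \<le> \<bar>expsum P q t\<bar> * c (k div q)" for t
      proof -
        have "(\<Sum>\<tau>\<in>{\<tau> \<in> sqrt4_mod k. [\<tau> = t] (mod int q)}. rho (k div q)) \<le> real (divcount (k div q)) * (real (divcount (k div q)) / real (k div q))"
          using card_lifts_sqrt4_mod[OF k(1) q, of t] rho_le[OF sj] rho_nonneg
          by (simp only: sum_constant, intro mult_mono) auto
        also have "\<dots> = c (k div q)" by (simp add: c_def power2_eq_square)
        finally have "(\<Sum>\<tau>\<in>{\<tau> \<in> sqrt4_mod k. [\<tau> = t] (mod int q)}. rho (k div q)) \<le> c (k div q)" .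
        moreover have "0 \<le> (\<Sum>\<tau>\<in>{\<tau> \<in> sqrt4_mod k. [\<tau> = t] (mod int q)}. rho (k div q))" using rho_nonneg by (simp add: sum_nonneg)
        ultimately show ?thesis unfolding sum_distrib_right[symmetric] expsum_def abs_mult
          by (intro mult_left_mono) auto
      qed
      show "\<bar>\<Sum>t\<in>sqrt4_mod q. \<Sum>\<phi>\<in>P. Xi q (ff \<phi> - t) * (\<Sum>\<tau>\<in>{\<tau> \<in> sqrt4_mod k. [\<tau> = t] (mod int q)}. rho (k div q))\<bar>
          \<le> U q * c (k div q)"
        unfolding U_def sum_distrib_right by (rule order_trans[OF sum_abs], rule sum_mono, rule *)
    qed
    also have "\<dots> = (\<Sum>q\<in>sqfree_range Q0 Q. if q dvd k then U q * c (k div q) else 0)"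
      by (rule sum.inter_filter[OF finite_sqfree_range])
    finally show ?thesis .
  qed
  have "err_total P Q0 Q \<le> (\<Sum>k\<in>{k::nat. squarefree k \<and> real k < Q}. \<Sum>q\<in>sqfree_range Q0 Q. if q dvd k then U q * c (k div q) else 0)"
    unfolding err_total_def by (intro sum_mono r) auto
  also have "\<dots> \<le> (\<Sum>k\<in>nat_below Q. \<Sum>q\<in>sqfree_range Q0 Q. if q dvd k then U q * c (k div q) else 0)"
    using K finite_nat_below U0 c0 by (intro sum_mono2 sum_nonneg) auto
  also have "\<dots> = (\<Sum>q\<in>sqfree_range Q0 Q. U q * (\<Sum>k\<in>{k\<in>nat_below Q. q dvd k}. c (k div q)))"
    by (subst sum.swap) (simp add: sum_distrib_left sum.inter_filter[OF finite_nat_below] if_distrib cong: if_cong)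
  also have "\<dots> \<le> (\<Sum>q\<in>sqfree_range Q0 Q. U q * (\<Sum>k\<in>nat_below Q. c k))"
    using sqfree_range_subset[of Q0 Q] by (intro sum_mono mult_left_mono sum_multiples c0 U0) (auto simp: nat_below_def)
  finally show ?thesis by (simp add: c_def U_def sum_distrib_right mult.commute)
qed

text \<open>As t^2 = 4 modulo q, every common divisor of q and ff \<phi> - t divides (ff \<phi>)^2 -
  4. This nonzero number is independent of q and t, so the sum over q is one of
  \<open>sum_gcd_le\<close>.\<close>

lemma expsum_trivial:
  assumes P: "\<And>\<phi>. \<phi> \<in> P \<Longrightarrow> (ff \<phi>)\<^sup>2 - 4 \<noteq> 0 \<and> real (divcount (nat \<bar>(ff \<phi>)\<^sup>2 - 4\<bar>)) \<le> d"
    and n: "\<And>k. k \<in> nat_below Q \<Longrightarrow> real (divcount k) \<le> n" and n0: "n \<ge> 0"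
  shows "(\<Sum>q\<in>sqfree_range Q0 Q. \<Sum>t\<in>sqrt4_mod q. \<bar>expsum P q t\<bar>) \<le> real (card P) * (n\<^sup>2 * (d * harm_below Q))"
proof -
  have "(\<Sum>t\<in>sqrt4_mod q. \<bar>Xi q (ff \<phi> - t)\<bar>) \<le> n\<^sup>2 * (real_of_int (gcd (int q) ((ff \<phi>)\<^sup>2 - 4)) / real q)"
    if q: "q \<in> sqfree_range Q0 Q" and \<phi>: "\<phi> \<in> P" for q \<phi>
  proof -
    define D where "D = (ff \<phi>)\<^sup>2 - 4"
    have sq: "squarefree q" using q by (simp add: sqfree_range_def)
    have qN: "q \<in> nat_below Q" using q sqfree_range_subset by auto
    have "\<bar>Xi q (ff \<phi> - t)\<bar> \<le> n * (real_of_int (gcd (int q) D) / real q)" if t: "t \<in> sqrt4_mod q" for t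
    proof -
      have "gcd (int q) (ff \<phi> - t) dvd D"
      proof -
        have "gcd (int q) (ff \<phi> - t) dvd (ff \<phi> - t) * (ff \<phi> + t)" by simp
        moreover have "gcd (int q) (ff \<phi> - t) dvd t\<^sup>2 - 4"
          using t by (auto simp: sqrt4_mod_def cong_iff_dvd_diff intro: dvd_trans)
        ultimately have "gcd (int q) (ff \<phi> - t) dvd (ff \<phi> - t) * (ff \<phi> + t) + (t\<^sup>2 - 4)" by (rule dvd_add)
        also have "(ff \<phi> - t) * (ff \<phi> + t) + (t\<^sup>2 - 4) = D" by (simp add: D_def algebra_simps power2_eq_square)
        finally show ?thesis .
      qed
      then have "gcd (int q) (ff \<phi> - t) dvd gcd (int q) D" by simp
      then have "gcd (int q) (ff \<phi> - t) \<le> gcd (int q) D" using qN by (intro zdvd_imp_le) (auto simp: nat_below_def)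
      then have g: "real_of_int (gcd (int q) (ff \<phi> - t)) \<le> real_of_int (gcd (int q) D)" by linarith
      have "\<bar>Xi q (ff \<phi> - t)\<bar> \<le> real (divcount q) * real_of_int (gcd (int q) (ff \<phi> - t)) / real q" by (rule Xi_le[OF sq])
      also have "\<dots> \<le> n * real_of_int (gcd (int q) D) / real q"
        using g n[OF qN] n0 by (intro divide_right_mono mult_mono) auto
      finally show ?thesis by simp
    qed
    then have "(\<Sum>t\<in>sqrt4_mod q. \<bar>Xi q (ff \<phi> - t)\<bar>) \<le> real (card (sqrt4_mod q)) * (n * (real_of_int (gcd (int q) D) / real q))"
      by (rule sum_bounded_above)
    also have "\<dots> \<le> n * (n * (real_of_int (gcd (int q) D) / real q))"
      using card_sqrt4_mod(2)[OF sq] n[OF qN] n0 by (intro mult_right_mono) auto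
    finally show ?thesis by (simp add: D_def power2_eq_square)
  qed
  note 1 = this
  have "(\<Sum>q\<in>sqfree_range Q0 Q. \<Sum>t\<in>sqrt4_mod q. \<bar>expsum P q t\<bar>) \<le> (\<Sum>q\<in>sqfree_range Q0 Q. \<Sum>t\<in>sqrt4_mod q. \<Sum>\<phi>\<in>P. \<bar>Xi q (ff \<phi> - t)\<bar>)"
    unfolding expsum_def by (intro sum_mono sum_abs)
  also have "\<dots> = (\<Sum>q\<in>sqfree_range Q0 Q. \<Sum>\<phi>\<in>P. \<Sum>t\<in>sqrt4_mod q. \<bar>Xi q (ff \<phi> - t)\<bar>)"
    by (intro sum.cong sum.swap refl)
  also have "\<dots> \<le> (\<Sum>q\<in>sqfree_range Q0 Q. \<Sum>\<phi>\<in>P. n\<^sup>2 * (real_of_int (gcd (int q) ((ff \<phi>)\<^sup>2 - 4)) / real q))"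
    by (intro sum_mono 1)
  also have "\<dots> = (\<Sum>\<phi>\<in>P. n\<^sup>2 * (\<Sum>q\<in>sqfree_range Q0 Q. real_of_int (gcd (int q) ((ff \<phi>)\<^sup>2 - 4)) / real q))"
    by (subst sum.swap) (simp only: sum_distrib_left)
  also have "\<dots> \<le> (\<Sum>\<phi>\<in>P. n\<^sup>2 * (d * harm_below Q))"
  proof (intro sum_mono mult_left_mono)
    fix \<phi> assume \<phi>: "\<phi> \<in> P"
    have "(\<Sum>q\<in>sqfree_range Q0 Q. real_of_int (gcd (int q) ((ff \<phi>)\<^sup>2 - 4)) / real q) \<le> (\<Sum>q\<in>nat_below Q. real_of_int (gcd (int q) ((ff \<phi>)\<^sup>2 - 4)) / real q)"
      using sqfree_range_subset finite_nat_below by (intro sum_mono2) auto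
    also have "\<dots> \<le> real (divcount (nat \<bar>(ff \<phi>)\<^sup>2 - 4\<bar>)) * harm_below Q" using P[OF \<phi>] by (intro sum_gcd_le) auto
    also have "\<dots> \<le> d * harm_below Q" using P[OF \<phi>] harm_below_nonneg by (intro mult_right_mono) auto
    finally show "(\<Sum>q\<in>sqfree_range Q0 Q. real_of_int (gcd (int q) ((ff \<phi>)\<^sup>2 - 4)) / real q) \<le> d * harm_below Q" .
  qed simp
  finally show ?thesis by simp
qed

section \<open>The bilinear large sieve\<close>

text \<open>The condition m^3 \<le> R^2 makes R^4 / m^3 dominate each collision count. Multiplying
  out g^5 a^2 (m/g)^6 (R^4/m^3)^3 leaves R^12 a^2 / (g m^3). The parameter s with g \<le> s^2 m
  rewrites this as a square with denominator g m = q q'; it is left free because it is chosen in two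
  ways later. The power of the divisor function comes from 1024^\<omega> = (2^\<omega>)^10.\<close>

lemma correlation_bound:
  assumes "\<epsilon> > 0"
  shows "\<exists>C\<ge>1. \<forall>R\<ge>1. \<forall>q q' t t' w w' s. squarefree q \<longrightarrow> squarefree q' \<longrightarrow> [t\<^sup>2 = 4] (mod int q) \<longrightarrow> [t'\<^sup>2 = 4] (mod int q') \<longrightarrow>
     det w = 1 \<longrightarrow> det w' = 1 \<longrightarrow> real (lcm q q') ^ 3 \<le> R\<^sup>2 \<longrightarrow> 0 \<le> s \<longrightarrow> real (gcd q q') \<le> s\<^sup>2 * real (lcm q q') \<longrightarrow>
     \<bar>correlation R q t w q' t' w'\<bar> \<le> C * R powr (6 + \<epsilon>) * real (divcount (lcm q q')) ^ 5 *
       (real_of_int (gcd (int (gcd q q')) ((ff (adj w ** w'))\<^sup>2 - 4)) * s / (real q * real q'))"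
proof -
  \<comment> \<open>Three collision counts contribute R^(3 e), which has to be the square of
    R^\<epsilon>.\<close>
  define e where "e = 2 * \<epsilon> / 3"
  have e: "e > 0" using assms by (simp add: e_def)
  obtain C0 where C0: "C0 \<ge> 1" "\<And>R m. R \<ge> 1 \<Longrightarrow> m \<ge> 1 \<Longrightarrow> real (card {(y, z) \<in> Ybox R \<times> Ybox R. mat_cong m y z})
    \<le> C0 * R powr e * (R ^ 4 / real m ^ 3 + R\<^sup>2)" using Ybox_pairs_bound[OF e] by blast
  define C where "C = 8 * C0 ^ 3"
  have "1 \<le> C0 ^ 3" using C0(1) by (rule one_le_power)
  then have C1: "C \<ge> 1" by (simp add: C_def)
  show ?thesis
  proof (intro exI[of _ C] conjI allI impI C1)
    fix R s :: real and q q' :: nat and t t' :: int and w w' :: imat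
    assume R: "1 \<le> R" and sq: "squarefree q" "squarefree q'" and t: "[t\<^sup>2 = 4] (mod int q)" "[t'\<^sup>2 = 4] (mod int q')"
      and w: "det w = 1" "det w' = 1" and mR: "real (lcm q q') ^ 3 \<le> R\<^sup>2" and s: "0 \<le> s" "real (gcd q q') \<le> s\<^sup>2 * real (lcm q q')"
    define g m a where "g = real (gcd q q')" and "m = real (lcm q q')"
      and "a = real_of_int (gcd (int (gcd q q')) ((ff (adj w ** w'))\<^sup>2 - 4))"
    define n where "n = real (divcount (lcm q q'))"
    have q0: "q > 0" "q' > 0" using sq by (metis not_squarefree_0 gr0I)+
    have m0: "lcm q q' \<ge> 1" using q0 by (simp add: Suc_le_eq lcm_pos_nat)
    have g: "g \<ge> 1" "m \<ge> 1" using q0 m0 by (auto simp: g_def m_def Suc_le_eq)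
    have gm: "g * m = real q * real q'" unfolding g_def m_def by (metis of_nat_mult prod_gcd_lcm_nat)
    have a0: "a \<ge> 0" by (simp add: a_def)
    define N where "N = real (card {(y, z) \<in> Ybox R \<times> Ybox R. mat_cong (lcm q q') y z})"
    have N: "N \<le> 2 * C0 * (R powr e * (R ^ 4 / m ^ 3))"
    proof -
      have "R\<^sup>2 * m ^ 3 \<le> R\<^sup>2 * R\<^sup>2" using mR by (intro mult_left_mono) (auto simp: m_def)
      then have "R\<^sup>2 \<le> R ^ 4 / m ^ 3" using g by (simp add: pos_le_divide_eq flip: power_add)
      then have "C0 * R powr e * (R ^ 4 / m ^ 3 + R\<^sup>2) \<le> C0 * R powr e * (2 * (R ^ 4 / m ^ 3))"
        using C0 by (intro mult_left_mono) auto
      then show ?thesis using C0(2)[OF R m0] by (simp add: N_def m_def)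
    qed
    have N3: "N ^ 3 \<le> C * (R powr (6 + \<epsilon>))\<^sup>2 / m ^ 9"
    proof -
      have "N ^ 3 \<le> (2 * C0 * (R powr e * (R ^ 4 / m ^ 3))) ^ 3" using N by (intro power_mono) (auto simp: N_def)
      also have "\<dots> = C * ((R powr e) ^ 3 * R ^ 12) / m ^ 9"
        by (simp add: C_def power_mult_distrib power_divide flip: power_mult)
      also have "(R powr e) ^ 3 * R ^ 12 = (R powr (6 + \<epsilon>))\<^sup>2"
        using R by (simp add: e_def powr_powr powr_add[symmetric] algebra_simps flip: powr_realpow powr_numeral)
      finally show ?thesis .
    qed
    have om: "1024 ^ card (prime_factors (lcm q q')) \<le> n ^ 10"
    proof -
      have "(1024 :: real) ^ card (prime_factors (lcm q q')) = (2 ^ card (prime_factors (lcm q q'))) ^ 10"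
        by (simp add: power_mult[symmetric] mult.commute[of _ 10] power_mult)
      also have "\<dots> \<le> n ^ 10" unfolding n_def
        using two_power_omega_le_divcount[of "lcm q q'"] m0 by (intro power_mono) (simp_all flip: of_nat_le_iff)
      finally show ?thesis .
    qed
    have "(correlation R q t w q' t' w')\<^sup>2 \<le> 1024 ^ card (prime_factors (lcm q q')) * (g ^ 5 * a\<^sup>2) * (m / g) ^ 6 * N ^ 3"
      using correlation_squared_le[OF sq t w, of R] by (simp add: g_def m_def a_def N_def)
    also have "\<dots> \<le> n ^ 10 * (g ^ 5 * a\<^sup>2) * (m / g) ^ 6 * (C * (R powr (6 + \<epsilon>))\<^sup>2 / m ^ 9)"
      using om N3 g a0 by (intro mult_mono) (auto simp: N_def)
    also have "\<dots> = C * (R powr (6 + \<epsilon>))\<^sup>2 * (n ^ 5)\<^sup>2 * a\<^sup>2 * (1 / (g * m ^ 3))"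
      using g by (simp add: field_simps power_divide eval_nat_numeral)
    also have "1 / (g * m ^ 3) \<le> (s / (g * m))\<^sup>2"
    proof -
      have "g \<le> s\<^sup>2 * m" using s by (simp add: g_def m_def)
      then have "g * (g * m\<^sup>2) \<le> s\<^sup>2 * m * (g * m\<^sup>2)" using g by (intro mult_right_mono) auto
      then have "1 * (g * m)\<^sup>2 \<le> s\<^sup>2 * (g * m ^ 3)" by (simp add: power_mult_distrib power2_eq_square power3_eq_cube mult_ac)
      then show ?thesis using g by (simp add: power_divide divide_simps)
    qed
    also have "C \<le> C\<^sup>2" using C1 by (simp add: power2_eq_square)
    finally have "(correlation R q t w q' t' w')\<^sup>2 \<le> C\<^sup>2 * (R powr (6 + \<epsilon>))\<^sup>2 * (n ^ 5)\<^sup>2 * a\<^sup>2 * (s / (g * m))\<^sup>2"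
      using C1 by (simp add: mult_left_mono mult_right_mono)
    also have "\<dots> = (C * R powr (6 + \<epsilon>) * n ^ 5 * (a * s / (g * m)))\<^sup>2" by (simp add: power_mult_distrib power_divide mult_ac)
    finally have "\<bar>correlation R q t w q' t' w'\<bar> \<le> \<bar>C * R powr (6 + \<epsilon>) * n ^ 5 * (a * s / (g * m))\<bar>"
      by (simp only: abs_le_square_iff)
    also have "\<dots> = C * R powr (6 + \<epsilon>) * n ^ 5 * (a * s / (g * m))"
      using C1 a0 s(1) g by (intro abs_of_nonneg mult_nonneg_nonneg divide_nonneg_nonneg) (auto simp: n_def)
    finally have "\<bar>correlation R q t w q' t' w'\<bar> \<le> C * R powr (6 + \<epsilon>) * n ^ 5 * (a * s / (g * m))" .
    then show "\<bar>correlation R q t w q' t' w'\<bar> \<le> C * R powr (6 + \<epsilon>) * real (divcount (lcm q q')) ^ 5 *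
       (real_of_int (gcd (int (gcd q q')) ((ff (adj w ** w'))\<^sup>2 - 4)) * s / (real q * real q'))"
      unfolding gm by (simp add: n_def a_def)
  qed
qed

text \<open>After Cauchy-Schwarz the summands in x are squares, so the sum may be enlarged to all of
  \<open>U\<close>, with multiplicity. The coefficients \<open>c j\<close> are disposed of only
  after the square is expanded, when each correlation stands alone.\<close>

lemma cauchy_schwarz_enlarge:
  fixes \<phi> :: "'j \<Rightarrow> 'x \<Rightarrow> real"
  assumes fin: "finite \<Omega>" "finite U" and sub: "\<Omega> \<subseteq> \<pi> ` U" and c: "\<And>j. j \<in> J \<Longrightarrow> \<bar>c j\<bar> \<le> 1"
  shows "(\<Sum>x\<in>\<Omega>. \<Sum>j\<in>J. c j * \<phi> j x)\<^sup>2 \<le> real (card \<Omega>) * (\<Sum>j\<in>J. \<Sum>j'\<in>J. \<bar>\<Sum>u\<in>U. \<phi> j (\<pi> u) * \<phi> j' (\<pi> u)\<bar>)"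
proof -
  define G where "G x = (\<Sum>j\<in>J. c j * \<phi> j x)" for x
  have "(\<Sum>x\<in>\<Omega>. 1 * G x)\<^sup>2 \<le> (\<Sum>x\<in>\<Omega>. 1\<^sup>2) * (\<Sum>x\<in>\<Omega>. (G x)\<^sup>2)" by (rule Cauchy_Schwarz_ineq_sum)
  also have "\<dots> \<le> real (card \<Omega>) * (\<Sum>u\<in>U. (G (\<pi> u))\<^sup>2)"
  proof -
    have "(\<Sum>x\<in>\<Omega>. (G x)\<^sup>2) \<le> (\<Sum>x\<in>\<pi> ` U. (G x)\<^sup>2)" using fin sub by (intro sum_mono2) auto
    also have "\<dots> \<le> sum ((\<lambda>x. (G x)\<^sup>2) \<circ> \<pi>) U" using fin by (intro sum_image_le) auto
    finally show ?thesis by (simp add: mult_left_mono)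
  qed
  also have "(\<Sum>u\<in>U. (G (\<pi> u))\<^sup>2) = (\<Sum>j\<in>J. \<Sum>j'\<in>J. \<Sum>u\<in>U. (c j * c j') * (\<phi> j (\<pi> u) * \<phi> j' (\<pi> u)))"
  proof -
    have "(\<Sum>u\<in>U. (G (\<pi> u))\<^sup>2) = (\<Sum>u\<in>U. \<Sum>j\<in>J. \<Sum>j'\<in>J. (c j * c j') * (\<phi> j (\<pi> u) * \<phi> j' (\<pi> u)))"
      unfolding G_def power2_eq_square sum_product by (intro sum.cong refl) (simp only: mult_ac)
    also have "\<dots> = (\<Sum>j\<in>J. \<Sum>u\<in>U. \<Sum>j'\<in>J. (c j * c j') * (\<phi> j (\<pi> u) * \<phi> j' (\<pi> u)))" by (rule sum.swap)
    also have "\<dots> = (\<Sum>j\<in>J. \<Sum>j'\<in>J. \<Sum>u\<in>U. (c j * c j') * (\<phi> j (\<pi> u) * \<phi> j' (\<pi> u)))" by (intro sum.cong sum.swap refl)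
    finally show ?thesis .
  qed
  also have "\<dots> \<le> (\<Sum>j\<in>J. \<Sum>j'\<in>J. \<bar>\<Sum>u\<in>U. \<phi> j (\<pi> u) * \<phi> j' (\<pi> u)\<bar>)"
  proof (intro sum_mono)
    fix j j' assume j: "j \<in> J" "j' \<in> J"
    have "\<bar>c j * c j'\<bar> \<le> 1" using c[OF j(1)] c[OF j(2)] by (simp add: abs_mult mult_le_one)
    then have "\<bar>c j * c j'\<bar> * \<bar>\<Sum>u\<in>U. \<phi> j (\<pi> u) * \<phi> j' (\<pi> u)\<bar> \<le> 1 * \<bar>\<Sum>u\<in>U. \<phi> j (\<pi> u) * \<phi> j' (\<pi> u)\<bar>"
      by (intro mult_right_mono) auto
    then show "(\<Sum>u\<in>U. (c j * c j') * (\<phi> j (\<pi> u) * \<phi> j' (\<pi> u))) \<le> \<bar>\<Sum>u\<in>U. \<phi> j (\<pi> u) * \<phi> j' (\<pi> u)\<bar>"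
      unfolding sum_distrib_left[symmetric] abs_mult[symmetric] by linarith
  qed
  finally show ?thesis by (simp add: G_def mult_left_mono)
qed

text \<open>Correlations are summed according to whether D = ff(w^-1 w')^2 - 4 vanishes. For D
  \<noteq> 0 the gcd with D is small on average over its first argument, and 1/Q0 is gained; for D =
  0 there is no gain, and these pairs are merely counted. In n^7 five factors come from the
  correlation and two from the numbers of square roots t and t'. In harm^3 two come from q and q',
  one from their common divisor.\<close>

lemma bilinear_large_sieve:
  assumes "\<epsilon> > 0"
  shows "\<exists>C\<ge>1. \<forall>R\<ge>1. \<forall>Q0\<ge>1. \<forall>Q n d \<Omega> W. finite \<Omega> \<longrightarrow> finite W \<longrightarrow>
     (\<forall>x\<in>\<Omega>. \<exists>a\<in>Ybox R. \<exists>b\<in>Ybox R. \<exists>c\<in>Ybox R. x = a ** b ** c) \<longrightarrow> (\<forall>w\<in>W. det w = 1) \<longrightarrow>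
     Q ^ 6 \<le> R\<^sup>2 \<longrightarrow> 1 \<le> n \<longrightarrow> 1 \<le> d \<longrightarrow> (\<forall>k\<in>nat_below (Q\<^sup>2). real (divcount k) \<le> n) \<longrightarrow>
     (\<forall>w\<in>W. \<forall>w'\<in>W. (ff (adj w ** w'))\<^sup>2 - 4 \<noteq> 0 \<longrightarrow> real (divcount (nat \<bar>(ff (adj w ** w'))\<^sup>2 - 4\<bar>)) \<le> d) \<longrightarrow>
     (\<Sum>q\<in>sqfree_range Q0 Q. \<Sum>t\<in>sqrt4_mod q. \<bar>\<Sum>x\<in>\<Omega>. \<Sum>w\<in>W. Xi q (ff (x ** w) - t)\<bar>)\<^sup>2
       \<le> real (card \<Omega>) * (C * R powr (6 + \<epsilon>) * n ^ 7 * harm_below Q ^ 3 * d *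
          ((real (card W))\<^sup>2 / Q0 + real (card {(w, w') \<in> W \<times> W. (ff (adj w ** w'))\<^sup>2 = 4})))"
proof -
  obtain C where C1: "C \<ge> 1" and C: "\<And>R q q' t t' w w' s. R \<ge> 1 \<Longrightarrow> squarefree q \<Longrightarrow> squarefree q' \<Longrightarrow> [t\<^sup>2 = 4] (mod int q) \<Longrightarrow> [t'\<^sup>2 = 4] (mod int q') \<Longrightarrow>
     det w = 1 \<Longrightarrow> det w' = 1 \<Longrightarrow> real (lcm q q') ^ 3 \<le> R\<^sup>2 \<Longrightarrow> 0 \<le> s \<Longrightarrow> real (gcd q q') \<le> s\<^sup>2 * real (lcm q q') \<Longrightarrow>
     \<bar>correlation R q t w q' t' w'\<bar> \<le> C * R powr (6 + \<epsilon>) * real (divcount (lcm q q')) ^ 5 *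
       (real_of_int (gcd (int (gcd q q')) ((ff (adj w ** w'))\<^sup>2 - 4)) * s / (real q * real q'))"
    using correlation_bound[OF assms] by blast
  show ?thesis
  proof (intro exI[of _ C] conjI allI impI C1)
    fix R Q0 Q n d :: real and \<Omega> W :: "imat set"
    assume R: "1 \<le> R" and Q0: "1 \<le> Q0" and fin: "finite \<Omega>" "finite W"
      and split: "\<forall>x\<in>\<Omega>. \<exists>a\<in>Ybox R. \<exists>b\<in>Ybox R. \<exists>c\<in>Ybox R. x = a ** b ** c" and W: "\<forall>w\<in>W. det w = 1"
      and QR: "Q ^ 6 \<le> R\<^sup>2" and n: "1 \<le> n" "\<forall>k\<in>nat_below (Q\<^sup>2). real (divcount k) \<le> n" and d1: "1 \<le> d"
      and d: "\<forall>w\<in>W. \<forall>w'\<in>W. (ff (adj w ** w'))\<^sup>2 - 4 \<noteq> 0 \<longrightarrow> real (divcount (nat \<bar>(ff (adj w ** w'))\<^sup>2 - 4\<bar>)) \<le> d"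
    define D where "D w w' = (ff (adj w ** w'))\<^sup>2 - 4" for w w'
    define S where "S = sqfree_range Q0 Q"
    define I where "I = (SIGMA q:S. sqrt4_mod q)"
    define E where "E q t = (\<Sum>x\<in>\<Omega>. \<Sum>w\<in>W. Xi q (ff (x ** w) - t))" for q t
    \<comment> \<open>The signs that open the absolute values of the inner sums, so that all of (q,
      t, w) becomes one index under the sum over x.\<close>
    define c where "c j = sgn (E (fst (snd j)) (snd (snd j)))" for j :: "imat \<times> (nat \<times> int)"
    define \<phi> where "\<phi> j x = Xi (fst (snd j)) (ff (x ** fst j) - snd (snd j))" for j :: "imat \<times> (nat \<times> int)" and x
    define U where "U = Ybox R \<times> (Ybox R \<times> Ybox R)"
    define \<pi> where "\<pi> u = fst (snd u) ** fst u ** snd (snd u)" for u :: "imat \<times> (imat \<times> imat)"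
    define M where "M = C * R powr (6 + \<epsilon>) * n ^ 5"
    have M0: "M \<ge> 0" using C1 n by (simp add: M_def)
    have finS: "finite S" by (simp add: S_def finite_sqfree_range)
    have S: "squarefree q" "Q0 < real q" "real q < Q" "1 \<le> q" if "q \<in> S" for q
      using that sqfree_range_subset[of Q0 Q] unfolding S_def by (auto simp: sqfree_range_def nat_below_def)
    have finI: "finite I" unfolding I_def using finS card_sqrt4_mod(1)[OF S(1)] by (intro finite_SigmaI) auto
    have sumI: "(\<Sum>i\<in>I. h i) = (\<Sum>q\<in>S. \<Sum>t\<in>sqrt4_mod q. h (q, t))" for h :: "nat \<times> int \<Rightarrow> real"
      unfolding I_def using finS card_sqrt4_mod(1)[OF S(1)] by (subst sum.Sigma) auto
    have "(\<Sum>q\<in>S. \<Sum>t\<in>sqrt4_mod q. \<bar>E q t\<bar>) = (\<Sum>i\<in>I. \<bar>E (fst i) (snd i)\<bar>)"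
      unfolding sumI by simp
    also have "\<dots> = (\<Sum>i\<in>I. \<Sum>x\<in>\<Omega>. \<Sum>w\<in>W. sgn (E (fst i) (snd i)) * Xi (fst i) (ff (x ** w) - snd i))"
      by (intro sum.cong refl) (simp only: sum_distrib_left[symmetric] E_def[symmetric] abs_sgn mult.commute)
    also have "\<dots> = (\<Sum>x\<in>\<Omega>. \<Sum>i\<in>I. \<Sum>w\<in>W. sgn (E (fst i) (snd i)) * Xi (fst i) (ff (x ** w) - snd i))"
      by (rule sum.swap)
    also have "\<dots> = (\<Sum>x\<in>\<Omega>. \<Sum>w\<in>W. \<Sum>i\<in>I. sgn (E (fst i) (snd i)) * Xi (fst i) (ff (x ** w) - snd i))"
      by (intro sum.cong sum.swap refl)
    also have "\<dots> = (\<Sum>x\<in>\<Omega>. \<Sum>j\<in>W \<times> I. c j * \<phi> j x)"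
      unfolding c_def \<phi>_def sum.cartesian_product by (intro sum.cong refl) (auto simp: case_prod_unfold)
    finally have "(\<Sum>q\<in>S. \<Sum>t\<in>sqrt4_mod q. \<bar>E q t\<bar>)\<^sup>2 = (\<Sum>x\<in>\<Omega>. \<Sum>j\<in>W \<times> I. c j * \<phi> j x)\<^sup>2" by simp
    also have "\<dots> \<le> real (card \<Omega>) * (\<Sum>j\<in>W \<times> I. \<Sum>j'\<in>W \<times> I. \<bar>\<Sum>u\<in>U. \<phi> j (\<pi> u) * \<phi> j' (\<pi> u)\<bar>)"
    proof (rule cauchy_schwarz_enlarge)
      show "finite U" by (simp add: U_def finite_Ybox)
      show "\<Omega> \<subseteq> \<pi> ` U"
      proof
        fix x assume "x \<in> \<Omega>"
        then obtain a b c where "a \<in> Ybox R" "b \<in> Ybox R" "c \<in> Ybox R" "x = a ** b ** c" using split by blast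
        then show "x \<in> \<pi> ` U" by (intro image_eqI[of _ _ "(b, (a, c))"]) (auto simp: U_def \<pi>_def)
      qed
      show "\<bar>c j\<bar> \<le> 1" for j unfolding c_def by (simp add: sgn_if)
    qed fact
    also have "(\<Sum>j\<in>W \<times> I. \<Sum>j'\<in>W \<times> I. \<bar>\<Sum>u\<in>U. \<phi> j (\<pi> u) * \<phi> j' (\<pi> u)\<bar>)
        \<le> (\<Sum>w\<in>W. \<Sum>w'\<in>W. n\<^sup>2 * (M * (if D w w' = 0 then harm_below Q ^ 3 else d * harm_below Q ^ 3 / Q0)))"
    proof -
      define f where "f w w' e = real_of_int (gcd (int e) (D w w')) * (if D w w' = 0 then 1 else real e / Q0)" for w w' e
      have f0: "0 \<le> f w w' e" for w w' e using Q0 by (simp add: f_def)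
      have cb: "\<bar>\<Sum>u\<in>U. \<phi> (w, (q, t)) (\<pi> u) * \<phi> (w', (q', t')) (\<pi> u)\<bar> \<le> M * (f w w' (gcd q q') / (real q * real q'))"
        if j: "w \<in> W" "w' \<in> W" "q \<in> S" "q' \<in> S" "t \<in> sqrt4_mod q" "t' \<in> sqrt4_mod q'" for w w' q q' t t'
      proof -
        \<comment> \<open>For D = 0, g \<le> m allows s = 1. Otherwise g m = q q' exceeds Q0^2,
          which allows s = g / Q0.\<close>
        define s where "s = (if D w w' = 0 then 1 else real (gcd q q') / Q0)"
        have qq: "1 \<le> q" "1 \<le> q'" "real q < Q" "real q' < Q" "Q0 < real q" "Q0 < real q'" using S j by auto
        have g1: "gcd q q' \<ge> 1" using qq by (simp add: Suc_le_eq)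
        have gl: "real (gcd q q') * real (lcm q q') = real q * real q'" by (metis of_nat_mult prod_gcd_lcm_nat)
        have lq: "lcm q q' \<le> q * q'" using qq by (intro dvd_imp_le) (auto simp: lcm_least)
        have qqQ: "real q * real q' < Q * Q" using qq by (intro mult_strict_mono) auto
        then have lQ: "real (lcm q q') < Q\<^sup>2" using lq by (simp add: power2_eq_square flip: of_nat_le_iff of_nat_mult)
        have l1: "lcm q q' \<ge> 1" using qq by (simp add: Suc_le_eq lcm_pos_nat)
        have "real (lcm q q') ^ 3 \<le> (Q\<^sup>2) ^ 3" using lQ by (intro power_mono) auto
        then have lR: "real (lcm q q') ^ 3 \<le> R\<^sup>2" using QR by (simp flip: power_mult)
        have sg: "real (gcd q q') \<le> s\<^sup>2 * real (lcm q q')"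
        proof (cases "D w w' = 0")
          case True
          have "gcd q q' \<le> lcm q q'" using l1 by (intro dvd_imp_le) (auto intro: dvd_trans[OF gcd_dvd1 dvd_lcm1])
          then show ?thesis using True by (simp add: s_def)
        next
          case False
          have "Q0 * Q0 \<le> real q * real q'" using qq Q0 by (intro mult_mono) auto
          then have "real (gcd q q') * (Q0 * Q0) \<le> real (gcd q q') * (real (gcd q q') * real (lcm q q'))"
            unfolding gl by (intro mult_left_mono) auto
          then show ?thesis using False Q0 by (simp add: s_def power2_eq_square field_simps)
        qed
        have s0: "0 \<le> s" using Q0 by (simp add: s_def)
        have ndl: "real (divcount (lcm q q')) \<le> n" using n(2) l1 lQ by (auto simp: nat_below_def)
        have "\<bar>correlation R q t w q' t' w'\<bar> \<le> C * R powr (6 + \<epsilon>) * real (divcount (lcm q q')) ^ 5 *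
           (real_of_int (gcd (int (gcd q q')) ((ff (adj w ** w'))\<^sup>2 - 4)) * s / (real q * real q'))"
          using j W S by (intro C R lR s0 sg) (auto simp: sqrt4_mod_def)
        also have "\<dots> \<le> C * R powr (6 + \<epsilon>) * n ^ 5 *
           (real_of_int (gcd (int (gcd q q')) ((ff (adj w ** w'))\<^sup>2 - 4)) * s / (real q * real q'))"
          using ndl C1 s0 by (intro mult_right_mono mult_left_mono power_mono) auto
        also have "\<dots> = M * (f w w' (gcd q q') / (real q * real q'))"
          by (simp add: M_def f_def D_def s_def)
        finally have "\<bar>correlation R q t w q' t' w'\<bar> \<le> M * (f w w' (gcd q q') / (real q * real q'))" .
        moreover have "(\<Sum>u\<in>U. \<phi> (w, (q, t)) (\<pi> u) * \<phi> (w', (q', t')) (\<pi> u)) = correlation R q t w q' t' w'"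
          unfolding correlation_def U_def \<phi>_def \<pi>_def by (simp add: sum.cartesian_product case_prod_unfold)
        ultimately show ?thesis by simp
      qed
      have "(\<Sum>j\<in>W \<times> I. \<Sum>j'\<in>W \<times> I. \<bar>\<Sum>u\<in>U. \<phi> j (\<pi> u) * \<phi> j' (\<pi> u)\<bar>)
        = (\<Sum>w\<in>W. \<Sum>i\<in>I. \<Sum>w'\<in>W. \<Sum>i'\<in>I. \<bar>\<Sum>u\<in>U. \<phi> (w, i) (\<pi> u) * \<phi> (w', i') (\<pi> u)\<bar>)"
        by (simp only: sum.cartesian_product' fst_conv snd_conv)
      also have "\<dots> = (\<Sum>w\<in>W. \<Sum>w'\<in>W. \<Sum>i\<in>I. \<Sum>i'\<in>I. \<bar>\<Sum>u\<in>U. \<phi> (w, i) (\<pi> u) * \<phi> (w', i') (\<pi> u)\<bar>)"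
        by (intro sum.cong sum.swap refl)
      also have "\<dots> \<le> (\<Sum>w\<in>W. \<Sum>w'\<in>W. n\<^sup>2 * (M * (if D w w' = 0 then harm_below Q ^ 3 else d * harm_below Q ^ 3 / Q0)))"
      proof (intro sum_mono)
        fix w w' assume w: "w \<in> W" "w' \<in> W"
        have cs: "real (card (sqrt4_mod q)) \<le> n" if "q \<in> S" for q
        proof -
          have "real q * 1 \<le> Q * Q" using S[OF that] by (intro mult_mono) auto
          moreover have "real q < Q\<^sup>2"
          proof -
            have "real q * 1 \<le> real q * real q" using S[OF that] by (intro mult_left_mono) auto
            also have "real q * real q < Q * Q" using S[OF that] by (intro mult_strict_mono) auto
            finally show ?thesis by (simp add: power2_eq_square)
          qed
          ultimately have "q \<in> nat_below (Q\<^sup>2)" using S[OF that] by (simp add: nat_below_def)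
          then show ?thesis using n(2) card_sqrt4_mod(2)[OF S(1)[OF that]] by (meson of_nat_le_iff order_trans)
        qed
        have "(\<Sum>i\<in>I. \<Sum>i'\<in>I. \<bar>\<Sum>u\<in>U. \<phi> (w, i) (\<pi> u) * \<phi> (w', i') (\<pi> u)\<bar>)
          = (\<Sum>q\<in>S. \<Sum>t\<in>sqrt4_mod q. \<Sum>q'\<in>S. \<Sum>t'\<in>sqrt4_mod q'. \<bar>\<Sum>u\<in>U. \<phi> (w, (q, t)) (\<pi> u) * \<phi> (w', (q', t')) (\<pi> u)\<bar>)"
          unfolding sumI ..
        also have "\<dots> \<le> (\<Sum>q\<in>S. \<Sum>t\<in>sqrt4_mod q. \<Sum>q'\<in>S. \<Sum>t'\<in>sqrt4_mod q'. M * (f w w' (gcd q q') / (real q * real q')))"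
          by (intro sum_mono cb w)
        also have "\<dots> = (\<Sum>q\<in>S. \<Sum>q'\<in>S. real (card (sqrt4_mod q)) * (real (card (sqrt4_mod q')) * (M * (f w w' (gcd q q') / (real q * real q')))))"
          by (simp add: sum_distrib_left)
        also have "\<dots> \<le> (\<Sum>q\<in>S. \<Sum>q'\<in>S. n * (n * (M * (f w w' (gcd q q') / (real q * real q')))))"
          using cs n(1) M0 f0 by (intro sum_mono mult_mono mult_nonneg_nonneg) auto
        also have "\<dots> = n\<^sup>2 * (M * (\<Sum>q\<in>S. \<Sum>q'\<in>S. f w w' (gcd q q') / (real q * real q')))"
          by (simp add: sum_distrib_left power2_eq_square mult_ac)
        finally have L: "(\<Sum>i\<in>I. \<Sum>i'\<in>I. \<bar>\<Sum>u\<in>U. \<phi> (w, i) (\<pi> u) * \<phi> (w', i') (\<pi> u)\<bar>)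
           \<le> n\<^sup>2 * (M * (\<Sum>q\<in>S. \<Sum>q'\<in>S. f w w' (gcd q q') / (real q * real q')))" .
        have F: "(\<Sum>q\<in>S. \<Sum>q'\<in>S. f w w' (gcd q q') / (real q * real q')) \<le> (\<Sum>e\<in>nat_below Q. f w w' e / (real e)\<^sup>2) * (harm_below Q)\<^sup>2"
          using sqfree_range_subset f0 unfolding S_def by (intro sum_pairs_gcd) auto
        have G: "(\<Sum>e\<in>nat_below Q. f w w' e / (real e)\<^sup>2) \<le> (if D w w' = 0 then harm_below Q else d * harm_below Q / Q0)"
        proof (cases "D w w' = 0")
          case True
          then have "(\<Sum>e\<in>nat_below Q. f w w' e / (real e)\<^sup>2) = harm_below Q"
            unfolding harm_below_def by (intro sum.cong) (auto simp: f_def power2_eq_square nat_below_def)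
          then show ?thesis using True by simp
        next
          case False
          then have "(\<Sum>e\<in>nat_below Q. f w w' e / (real e)\<^sup>2) = (\<Sum>e\<in>nat_below Q. real_of_int (gcd (int e) (D w w')) / real e) / Q0"
            unfolding sum_divide_distrib by (intro sum.cong) (auto simp: f_def power2_eq_square nat_below_def)
          also have "\<dots> \<le> real (divcount (nat \<bar>D w w'\<bar>)) * harm_below Q / Q0"
            using sum_gcd_le[OF False] Q0 by (intro divide_right_mono) auto
          also have "\<dots> \<le> d * harm_below Q / Q0"
            using d w False Q0 harm_below_nonneg by (intro divide_right_mono mult_right_mono) (auto simp: D_def)
          finally show ?thesis using False by simp
        qed
        note F
        also have "(\<Sum>e\<in>nat_below Q. f w w' e / (real e)\<^sup>2) * (harm_below Q)\<^sup>2 \<le> (if D w w' = 0 then harm_below Q else d * harm_below Q / Q0) * (harm_below Q)\<^sup>2"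
          using G by (intro mult_right_mono) auto
        also have "\<dots> = (if D w w' = 0 then harm_below Q ^ 3 else d * harm_below Q ^ 3 / Q0)"
          by (simp add: power2_eq_square power3_eq_cube)
        finally have "n\<^sup>2 * (M * (\<Sum>q\<in>S. \<Sum>q'\<in>S. f w w' (gcd q q') / (real q * real q')))
          \<le> n\<^sup>2 * (M * (if D w w' = 0 then harm_below Q ^ 3 else d * harm_below Q ^ 3 / Q0))"
          using M0 by (intro mult_left_mono) auto
        with L show "(\<Sum>i\<in>I. \<Sum>i'\<in>I. \<bar>\<Sum>u\<in>U. \<phi> (w, i) (\<pi> u) * \<phi> (w', i') (\<pi> u)\<bar>)
           \<le> n\<^sup>2 * (M * (if D w w' = 0 then harm_below Q ^ 3 else d * harm_below Q ^ 3 / Q0))" by (rule order_trans)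
      qed
      finally show ?thesis .
    qed
    also have "(\<Sum>w\<in>W. \<Sum>w'\<in>W. n\<^sup>2 * (M * (if D w w' = 0 then harm_below Q ^ 3 else d * harm_below Q ^ 3 / Q0)))
      \<le> (\<Sum>w\<in>W. \<Sum>w'\<in>W. n\<^sup>2 * M * harm_below Q ^ 3 * d * (1 / Q0 + (if D w w' = 0 then 1 else 0)))"
    proof (intro sum_mono)
      fix w w'
      have "(if D w w' = 0 then harm_below Q ^ 3 else d * harm_below Q ^ 3 / Q0) \<le> harm_below Q ^ 3 * d * (1 / Q0 + (if D w w' = 0 then 1 else 0))"
      proof (cases "D w w' = 0")
        case True
        have "harm_below Q ^ 3 * (1 * 1) \<le> harm_below Q ^ 3 * (d * (1 / Q0 + 1))"
          using harm_below_nonneg[of Q] d1 Q0 by (intro mult_left_mono mult_mono) auto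
        then show ?thesis using True by (simp add: mult.assoc)
      qed (simp add: mult.commute)
      then have "n\<^sup>2 * M * (if D w w' = 0 then harm_below Q ^ 3 else d * harm_below Q ^ 3 / Q0) \<le> n\<^sup>2 * M * (harm_below Q ^ 3 * d * (1 / Q0 + (if D w w' = 0 then 1 else 0)))"
        using M0 n by (intro mult_left_mono) auto
      then show "n\<^sup>2 * (M * (if D w w' = 0 then harm_below Q ^ 3 else d * harm_below Q ^ 3 / Q0))
         \<le> n\<^sup>2 * M * harm_below Q ^ 3 * d * (1 / Q0 + (if D w w' = 0 then 1 else 0))" by (simp only: mult.assoc)
    qed
    also have "\<dots> = n\<^sup>2 * M * harm_below Q ^ 3 * d * (\<Sum>w\<in>W. \<Sum>w'\<in>W. 1 / Q0 + (if D w w' = 0 then 1 else 0))"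
      by (simp only: sum_distrib_left)
    also have "(\<Sum>w\<in>W. \<Sum>w'\<in>W. 1 / Q0 + (if D w w' = 0 then 1 else 0)) = (real (card W))\<^sup>2 / Q0 + real (card {(w, w') \<in> W \<times> W. (ff (adj w ** w'))\<^sup>2 = 4})"
    proof -
      have "{(w, w') \<in> W \<times> W. (ff (adj w ** w'))\<^sup>2 = 4} = Sigma W (\<lambda>w. {w'\<in>W. D w w' = 0})" by (auto simp: D_def)
      then have "card {(w, w') \<in> W \<times> W. (ff (adj w ** w'))\<^sup>2 = 4} = (\<Sum>w\<in>W. card {w'\<in>W. D w w' = 0})"
        using fin by simp
      moreover have "(\<Sum>w\<in>W. \<Sum>w'\<in>W. (if D w w' = 0 then 1 else 0 :: real)) = (\<Sum>w\<in>W. real (card {w'\<in>W. D w w' = 0}))"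
        using fin by (simp add: sum.If_cases Int_def)
      ultimately show ?thesis by (simp add: sum.distrib power2_eq_square)
    qed
    finally have "(\<Sum>q\<in>S. \<Sum>t\<in>sqrt4_mod q. \<bar>E q t\<bar>)\<^sup>2 \<le> real (card \<Omega>) * (n\<^sup>2 * M * harm_below Q ^ 3 * d *
        ((real (card W))\<^sup>2 / Q0 + real (card {(w, w') \<in> W \<times> W. (ff (adj w ** w'))\<^sup>2 = 4})))"
      by (simp add: mult_left_mono)
    moreover have "n\<^sup>2 * M = C * R powr (6 + \<epsilon>) * n ^ 7" by (simp add: M_def eval_nat_numeral mult_ac)
    ultimately show "(\<Sum>q\<in>sqfree_range Q0 Q. \<Sum>t\<in>sqrt4_mod q. \<bar>\<Sum>x\<in>\<Omega>. \<Sum>w\<in>W. Xi q (ff (x ** w) - t)\<bar>)\<^sup>2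
       \<le> real (card \<Omega>) * (C * R powr (6 + \<epsilon>) * n ^ 7 * harm_below Q ^ 3 * d *
          ((real (card W))\<^sup>2 / Q0 + real (card {(w, w') \<in> W \<times> W. (ff (adj w ** w'))\<^sup>2 = 4})))"
      by (simp only: S_def E_def)
  qed
qed

section \<open>Unique factorization of products of words\<close>

lemma Gamma_sgE:
  assumes "x \<in> Gamma_sg A"
  obtains u where "x = word_mat u" "set u \<subseteq> {1..A}" "even (length u)" "u \<noteq> []"
  using assms by (force simp: Gamma_sg_def has_word_length_def)

lemma det_Gamma_sg: "x \<in> Gamma_sg A \<Longrightarrow> det x = 1"
  by (elim Gamma_sgE) (simp add: det_word_mat)

text \<open>Words in \<open>R\<close> share one length and words in \<open>U\<close> another, so the
  concatenated word, recovered by freeness, can be cut at known distances from both ends; the middle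
  word may have any length.\<close>

lemma word_product_inj:
  assumes "same_word_length A R" "same_word_length A' U" "S \<subseteq> Gamma_sg B"
  shows "inj_on (\<lambda>(x, y, z). x ** y ** z) (R \<times> S \<times> U)"
proof -
  obtain l where l: "\<And>x. x \<in> R \<Longrightarrow> has_word_length A l x" using assms(1) by (auto simp: same_word_length_def)
  obtain l' where l': "\<And>x. x \<in> U \<Longrightarrow> has_word_length A' l' x" using assms(2) by (auto simp: same_word_length_def)
  have R: "\<exists>u. x = word_mat u \<and> set u \<subseteq> {1..} \<and> length u = l" if "x \<in> R" for x
    using l[OF that] by (force simp: has_word_length_def)
  have U: "\<exists>u. x = word_mat u \<and> set u \<subseteq> {1..} \<and> length u = l'" if "x \<in> U" for x
    using l'[OF that] by (force simp: has_word_length_def)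
  have S: "\<exists>u. x = word_mat u \<and> set u \<subseteq> {1..}" if "x \<in> S" for x
  proof -
    have "x \<in> Gamma_sg B" using that assms(3) by blast
    then show ?thesis by (rule Gamma_sgE) force
  qed
  show ?thesis
  proof (rule inj_onI)
    fix p p' assume "p \<in> R \<times> S \<times> U" "p' \<in> R \<times> S \<times> U"
      and e: "(case p of (x, y, z) \<Rightarrow> x ** y ** z) = (case p' of (x, y, z) \<Rightarrow> x ** y ** z)"
    then obtain x y z x' y' z' where p: "p = (x, y, z)" "p' = (x', y', z')"
      and m: "x \<in> R" "y \<in> S" "z \<in> U" "x' \<in> R" "y' \<in> S" "z' \<in> U" by auto
    obtain a a' where a: "x = word_mat a" "set a \<subseteq> {1..}" "length a = l" "x' = word_mat a'" "set a' \<subseteq> {1..}" "length a' = l"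
      using R[OF m(1)] R[OF m(4)] by blast
    obtain b b' where b: "y = word_mat b" "set b \<subseteq> {1..}" "y' = word_mat b'" "set b' \<subseteq> {1..}"
      using S[OF m(2)] S[OF m(5)] by blast
    obtain c c' where c: "z = word_mat c" "set c \<subseteq> {1..}" "length c = l'" "z' = word_mat c'" "set c' \<subseteq> {1..}" "length c' = l'"
      using U[OF m(3)] U[OF m(6)] by blast
    have "word_mat (a @ b @ c) = word_mat (a' @ b' @ c')"
      using e unfolding p by (simp add: a b c word_mat_append matrix_mul_assoc)
    then have "a @ b @ c = a' @ b' @ c'" using a b c by (intro word_mat_inj) auto
    then have "a = a'" "b @ c = b' @ c'" using a by auto
    moreover from this have "b = b'" "c = c'" using c by auto
    ultimately show "p = p'" using p a b c by simp
  qed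
qed

section \<open>Entry bounds and integral rotations\<close>

lemma ff_bound:
  fixes x :: imat
  assumes "\<And>i j. \<bar>real_of_int (x$i$j)\<bar> \<le> B"
  shows "real_of_int (ff x) \<le> 4 * B\<^sup>2"
proof -
  have "(real_of_int (x$i$j))\<^sup>2 \<le> B\<^sup>2" for i j using assms[of i j] by (metis abs_ge_zero power2_abs power_mono)
  from this[of 1 1] this[of 1 2] this[of 2 1] this[of 2 2] show ?thesis by (simp add: ff_def)
qed

lemma ff_nonneg: "0 \<le> ff x" by (simp add: ff_def)

lemma mm_entry_bound:
  fixes x y :: imat
  assumes "\<And>i j. \<bar>real_of_int (x$i$j)\<bar> \<le> B" "\<And>i j. \<bar>real_of_int (y$i$j)\<bar> \<le> B'"
  shows "\<bar>real_of_int ((x ** y)$i$j)\<bar> \<le> 2 * (B * B')"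
proof -
  have "\<bar>real_of_int (x$i$k) * real_of_int (y$k$j)\<bar> \<le> B * B'" for k
    unfolding abs_mult using assms(1)[of i k] assms(2)[of k j] by (intro mult_mono) auto
  from this[of 1] this[of 2] show ?thesis by simp
qed

text \<open>\<open>ff g - 2 * det g\<close> is a sum of two squares, so ff g = 2 makes g a rotation
  matrix, and only four of them are integral. The value ff g = -2 is excluded by positivity.\<close>

lemma card_rotations:
  shows "finite {g :: imat. det g = 1 \<and> (ff g)\<^sup>2 = 4}" "card {g :: imat. det g = 1 \<and> (ff g)\<^sup>2 = 4} \<le> 4"
proof -
  have sub: "{g :: imat. det g = 1 \<and> (ff g)\<^sup>2 = 4} \<subseteq> {mat2 1 0 0 1, mat2 (-1) 0 0 (-1), mat2 0 1 (-1) 0, mat2 0 (-1) 1 0}"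
  proof
    fix g :: imat assume "g \<in> {g. det g = 1 \<and> (ff g)\<^sup>2 = 4}"
    then have g: "det g = 1" "(ff g)\<^sup>2 = 2\<^sup>2" by auto
    then have f: "ff g = 2" using ff_nonneg[of g] by (simp only: power2_eq_iff_nonneg) 
    have "(g$1$1 - g$2$2)\<^sup>2 + (g$1$2 + g$2$1)\<^sup>2 = ff g - 2 * det g"
      by (simp add: ff_def det_2 power2_eq_square algebra_simps)
    then have "(g$1$1 - g$2$2)\<^sup>2 + (g$1$2 + g$2$1)\<^sup>2 = 0" using f g by simp
    then have e: "g$2$2 = g$1$1" "g$2$1 = - g$1$2" by (auto simp: sum_power2_eq_zero_iff)
    then have s: "(g$1$1)\<^sup>2 + (g$1$2)\<^sup>2 = 1" using g(1) by (simp add: det_2 power2_eq_square)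
    have "(g$1$1)\<^sup>2 \<le> 1" "(g$1$2)\<^sup>2 \<le> 1" using s by (metis le_add_same_cancel1 le_add_same_cancel2 zero_le_power2)+
    then have "\<bar>g$1$1\<bar> \<le> 1" "\<bar>g$1$2\<bar> \<le> 1" by (simp_all add: abs_square_le_1)
    then have "g$1$1 \<in> {-1, 0, 1}" "g$1$2 \<in> {-1, 0, 1}" by auto
    then show "g \<in> {mat2 1 0 0 1, mat2 (-1) 0 0 (-1), mat2 0 1 (-1) 0, mat2 0 (-1) 1 0}"
      using s e by (auto simp: imat_eq_iff)
  qed
  show "finite {g :: imat. det g = 1 \<and> (ff g)\<^sup>2 = 4}" by (rule finite_subset[OF sub]) simp
  have "card {g :: imat. det g = 1 \<and> (ff g)\<^sup>2 = 4} \<le> card (set [mat2 1 0 0 1, mat2 (-1) 0 0 (-1), mat2 0 1 (-1) 0, mat2 0 (-1) 1 0])"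
    using sub by (intro card_mono) simp_all
  also have "\<dots> \<le> 4" using card_length[of "[mat2 1 0 0 1, mat2 (-1) 0 0 (-1), mat2 0 1 (-1) 0, mat2 0 (-1) 1 0]"] by simp
  finally show "card {g :: imat. det g = 1 \<and> (ff g)\<^sup>2 = 4} \<le> 4" .
qed

text \<open>Given \<open>w\<close>, the partner is \<open>w\<close> times one of four rotations: the
  pairs without gain are essentially diagonal.\<close>

lemma card_rotation_pairs:
  assumes "finite W" "\<And>w. w \<in> W \<Longrightarrow> det w = 1"
  shows "card {(w, w') \<in> W \<times> W. (ff (adj w ** w'))\<^sup>2 = 4} \<le> 4 * card W"
proof -
  let ?O = "{g :: imat. det g = 1 \<and> (ff g)\<^sup>2 = 4}"
  have inv: "w ** (adj w ** w') = w'" if "w \<in> W" for w w'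
  proof -
    have "w ** adj w = mat 1" unfolding adj_mult using assms(2)[OF that] by (simp add: imat_eq_iff)
    then show ?thesis by (simp add: matrix_mul_assoc del: mm_entry)
  qed
  have dadj: "det (adj w) = det w" for w by (simp add: det_2 mult.commute)
  have "card {(w, w') \<in> W \<times> W. (ff (adj w ** w'))\<^sup>2 = 4} \<le> card (W \<times> ?O)"
  proof (rule card_inj_on_le[of "\<lambda>(w, w'). (w, adj w ** w')"])
    show "inj_on (\<lambda>(w, w'). (w, adj w ** w')) {(w, w') \<in> W \<times> W. (ff (adj w ** w'))\<^sup>2 = 4}"
    proof (rule inj_onI)
      fix p q assume p: "p \<in> {(w, w') \<in> W \<times> W. (ff (adj w ** w'))\<^sup>2 = 4}"
        and e: "(case p of (w, w') \<Rightarrow> (w, adj w ** w')) = (case q of (w, w') \<Rightarrow> (w, adj w ** w'))"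
      obtain w w' v v' where pq: "p = (w, w')" "q = (v, v')" by (cases p; cases q)
      have "w = v" "adj w ** w' = adj w ** v'" "w \<in> W" using e p unfolding pq by auto
      then show "p = q" using inv pq by metis
    qed
    show "(\<lambda>(w, w'). (w, adj w ** w')) ` {(w, w') \<in> W \<times> W. (ff (adj w ** w'))\<^sup>2 = 4} \<subseteq> W \<times> ?O"
      using assms(2) by (auto simp: det_mul dadj simp del: mm_entry)
    show "finite (W \<times> ?O)" using assms(1) card_rotations by simp
  qed
  also have "\<dots> \<le> card W * 4" unfolding card_cartesian_product using card_rotations by (intro mult_left_mono) auto
  finally show ?thesis by simp
qed

text \<open>Collects what the analytic part needs about the product set: with W the products of the
  last two factors, every element is x w in exactly one way, sums over the product set become double
  sums, and the integers whose divisors are counted are bounded by a power of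
  \<open>N\<close>.\<close>

lemma product_structure:
  assumes X: "1 \<le> X" "1 \<le> Y" "1 \<le> Z" and N: "X * Y * Z = N"
    and AL: "AL \<noteq> {}" "AL \<subseteq> Gamma_sg B \<inter> norm_ball Y"
    and \<Omega>X: "\<Omega>X \<subseteq> Gamma_sg A \<inter> norm_ball X" "same_word_length A \<Omega>X" "\<Omega>X \<noteq> {}"
    and \<Omega>Z: "\<Omega>Z \<subseteq> Gamma_sg A \<inter> norm_ball Z" "same_word_length A \<Omega>Z"
  obtains W where "finite \<Omega>X" "finite W" "card (prod3 \<Omega>X AL \<Omega>Z) = card \<Omega>X * card W" "card \<Omega>Z \<le> card W"
    "\<And>w. w \<in> W \<Longrightarrow> det w = 1"
    "\<And>q t. expsum (prod3 \<Omega>X AL \<Omega>Z) q t = (\<Sum>x\<in>\<Omega>X. \<Sum>w\<in>W. Xi q (ff (x ** w) - t))"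
    "\<And>\<phi>. \<phi> \<in> prod3 \<Omega>X AL \<Omega>Z \<Longrightarrow> (ff \<phi>)\<^sup>2 - 4 \<noteq> 0"
    "\<And>\<phi>. \<phi> \<in> prod3 \<Omega>X AL \<Omega>Z \<Longrightarrow> real_of_int \<bar>(ff \<phi>)\<^sup>2 - 4\<bar> \<le> 10 ^ 5 * N ^ 8"
    "\<And>w w'. w \<in> W \<Longrightarrow> w' \<in> W \<Longrightarrow> real_of_int \<bar>(ff (adj w ** w'))\<^sup>2 - 4\<bar> \<le> 10 ^ 5 * N ^ 8"
proof -
  define P where "P = prod3 \<Omega>X AL \<Omega>Z"
  define W where "W = (\<lambda>(y, z). y ** z) ` (AL \<times> \<Omega>Z)"
  have finA: "finite AL" "finite \<Omega>X" "finite \<Omega>Z" using AL \<Omega>X \<Omega>Z finite_norm_ball finite_subset by blast+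
  have inj3: "inj_on (\<lambda>(x, y, z). x ** y ** z) (\<Omega>X \<times> AL \<times> \<Omega>Z)"
    using AL by (intro word_product_inj[OF \<Omega>X(2) \<Omega>Z(2), of AL B]) auto
  have injW: "inj_on (\<lambda>(y, z). y ** z) (AL \<times> \<Omega>Z)"
  proof (rule inj_onI)
    fix p p' assume p: "p \<in> AL \<times> \<Omega>Z" "p' \<in> AL \<times> \<Omega>Z" and e: "(case p of (y, z) \<Rightarrow> y ** z) = (case p' of (y, z) \<Rightarrow> y ** z)"
    \<comment> \<open>Any fixed left factor turns an equality of products of two into one of
      products of three.\<close>
    obtain x where x: "x \<in> \<Omega>X" using \<Omega>X by blast
    have "(case (x, p) of (x, y, z) \<Rightarrow> x ** y ** z) = (case (x, p') of (x, y, z) \<Rightarrow> x ** y ** z)"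
      using e by (auto simp: case_prod_unfold matrix_mul_assoc[symmetric] simp del: mm_entry)
    then have "(x, p) = (x, p')" using inj3 x p by (intro inj_onD[OF inj3]) auto
    then show "p = p'" by simp
  qed
  have injP: "inj_on (\<lambda>(x, w). x ** w) (\<Omega>X \<times> W)"
  proof (rule inj_onI)
    fix p p' assume "p \<in> \<Omega>X \<times> W" "p' \<in> \<Omega>X \<times> W" and e: "(case p of (x, w) \<Rightarrow> x ** w) = (case p' of (x, w) \<Rightarrow> x ** w)"
    then obtain x y z x' y' z' where p: "p = (x, y ** z)" "p' = (x', y' ** z')"
      and m: "(x, y, z) \<in> \<Omega>X \<times> AL \<times> \<Omega>Z" "(x', y', z') \<in> \<Omega>X \<times> AL \<times> \<Omega>Z" by (auto simp: W_def)
    have "(x, y, z) = (x', y', z')"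
      by (rule inj_onD[OF inj3 _ m]) (use e in \<open>simp add: p matrix_mul_assoc del: mm_entry\<close>)
    then show "p = p'" using p by simp
  qed
  have PW: "P = (\<lambda>(x, w). x ** w) ` (\<Omega>X \<times> W)"
  proof
    show "P \<subseteq> (\<lambda>(x, w). x ** w) ` (\<Omega>X \<times> W)"
    proof
      fix v assume "v \<in> P"
      then obtain x y z where "v = x ** y ** z" "x \<in> \<Omega>X" "y \<in> AL" "z \<in> \<Omega>Z" by (auto simp: P_def prod3_def)
      moreover from this have "y ** z \<in> W" by (force simp: W_def)
      ultimately show "v \<in> (\<lambda>(x, w). x ** w) ` (\<Omega>X \<times> W)"
        by (intro image_eqI[of _ _ "(x, y ** z)"]) (simp_all add: matrix_mul_assoc)
    qed
    show "(\<lambda>(x, w). x ** w) ` (\<Omega>X \<times> W) \<subseteq> P"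
    proof
      fix v assume "v \<in> (\<lambda>(x, w). x ** w) ` (\<Omega>X \<times> W)"
      then obtain x y z where "v = x ** (y ** z)" and m: "x \<in> \<Omega>X" "y \<in> AL" "z \<in> \<Omega>Z"
        unfolding W_def by auto
      then have "v = x ** y ** z" by (simp only: matrix_mul_assoc)
      then show "v \<in> P" unfolding P_def prod3_def using m by blast
    qed
  qed
  have cW: "card W = card AL * card \<Omega>Z" unfolding W_def card_image[OF injW] by (simp add: card_cartesian_product)
  have N1: "Y * Z \<le> N" "1 \<le> N" "1 \<le> Y * Z"
  proof -
    show YZ: "1 \<le> Y * Z" using X mult_mono[of 1 Y 1 Z] by simp
    have "1 * (Y * Z) \<le> X * (Y * Z)" using X YZ by (intro mult_right_mono) auto
    then show "Y * Z \<le> N" using N by (simp add: mult.assoc)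
    then show "1 \<le> N" using YZ by simp
  qed
  have ball: "\<bar>real_of_int (x$i$j)\<bar> \<le> V" if "x \<in> norm_ball V" for x V i j
    using entry_le_mnorm[of x i j] that by (simp add: norm_ball_def)
  have Wb: "\<bar>real_of_int (w$i$j)\<bar> \<le> 2 * (Y * Z)" if wW: "w \<in> W" for w i j
  proof -
    obtain y z where w: "w = y ** z" "y \<in> AL" "z \<in> \<Omega>Z" using wW by (auto simp: W_def)
    then have "y \<in> norm_ball Y" "z \<in> norm_ball Z" using AL \<Omega>Z by auto
    then show ?thesis unfolding w(1) by (intro mm_entry_bound ball)
  qed
  have D8: "real_of_int \<bar>(ff g)\<^sup>2 - 4\<bar> \<le> 10 ^ 5 * N ^ 8" if "\<And>i j. \<bar>real_of_int (g$i$j)\<bar> \<le> 8 * N\<^sup>2" for g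
  proof -
    \<comment> \<open>Entries up to 8 N^2 give ff up to 256 N^4, whose square 65536 N^8 is rounded
      up to 10^5 N^8.\<close>
    have "real_of_int (ff g) \<le> 4 * (8 * N\<^sup>2)\<^sup>2" by (rule ff_bound) (rule that)
    then have "(real_of_int (ff g))\<^sup>2 \<le> (4 * (8 * N\<^sup>2)\<^sup>2)\<^sup>2" using ff_nonneg[of g] by (intro power_mono) auto
    also have "\<dots> = 65536 * N ^ 8" by (simp add: power_mult_distrib flip: power_mult)
    finally have "(real_of_int (ff g))\<^sup>2 \<le> 65536 * N ^ 8" .
    moreover have "1 \<le> N ^ 8" using N1 by (intro one_le_power) auto
    moreover have "0 \<le> (real_of_int (ff g))\<^sup>2" by simp
    ultimately have "\<bar>(real_of_int (ff g))\<^sup>2 - 4\<bar> \<le> 100000 * N ^ 8" by linarith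
    then show ?thesis by simp
  qed
  show ?thesis
  proof (rule that[of W])
    show "finite \<Omega>X" "finite W" using finA by (auto simp: W_def)
    show "card (prod3 \<Omega>X AL \<Omega>Z) = card \<Omega>X * card W"
      unfolding P_def[symmetric] PW card_image[OF injP] by (simp add: card_cartesian_product)
    have "card AL \<ge> 1" using AL(1) finA(1) by (simp add: Suc_le_eq card_gt_0_iff)
    then show "card \<Omega>Z \<le> card W" unfolding cW by simp
    show "det w = 1" if "w \<in> W" for w
    proof -
      from that obtain y z where w: "w = y ** z" "y \<in> AL" "z \<in> \<Omega>Z" by (auto simp: W_def)
      then have "y \<in> Gamma_sg B" "z \<in> Gamma_sg A" using AL \<Omega>Z by auto
      with w show ?thesis by (simp add: det_mul det_Gamma_sg)
    qed
    show "expsum (prod3 \<Omega>X AL \<Omega>Z) q t = (\<Sum>x\<in>\<Omega>X. \<Sum>w\<in>W. Xi q (ff (x ** w) - t))" for q t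
      unfolding expsum_def P_def[symmetric] PW sum.reindex[OF injP]
      by (simp add: sum.cartesian_product case_prod_unfold del: mm_entry)
  next
    fix w w' assume w: "w \<in> W" "w' \<in> W"
    have a: "\<bar>real_of_int (adj w$i$j)\<bar> \<le> 2 * (Y * Z)" for i j
      using Wb[OF w(1)] exhaust_2[of i] exhaust_2[of j] by auto
    have "\<bar>real_of_int ((adj w ** w')$i$j)\<bar> \<le> 2 * ((2 * (Y * Z)) * (2 * (Y * Z)))" for i j
      by (rule mm_entry_bound[OF a Wb[OF w(2)]])
    also have "2 * ((2 * (Y * Z)) * (2 * (Y * Z))) \<le> 2 * ((2 * N) * (2 * N))"
      using N1 by (intro mult_left_mono mult_mono) auto
    finally show "real_of_int \<bar>(ff (adj w ** w'))\<^sup>2 - 4\<bar> \<le> 10 ^ 5 * N ^ 8"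
      by (intro D8) (simp add: power2_eq_square)
  next
    fix \<phi> assume "\<phi> \<in> prod3 \<Omega>X AL \<Omega>Z"
    then obtain x w where x: "x \<in> \<Omega>X" "w \<in> W" and \<phi>: "\<phi> = x ** w" unfolding P_def[symmetric] PW by auto
    obtain y z where w: "w = y ** z" "y \<in> AL" "z \<in> \<Omega>Z" using x by (auto simp: W_def)
    have "\<bar>real_of_int (\<phi>$i$j)\<bar> \<le> 2 * (X * (2 * (Y * Z)))" for i j
      unfolding \<phi> by (rule mm_entry_bound[OF ball Wb[OF x(2)]]) (use x \<Omega>X in auto)
    also have "2 * (X * (2 * (Y * Z))) = 4 * N * 1" using N by simp
    also have "\<dots> \<le> 4 * N * (2 * N)" using N1 by (intro mult_left_mono) auto
    finally show "real_of_int \<bar>(ff \<phi>)\<^sup>2 - 4\<bar> \<le> 10 ^ 5 * N ^ 8"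
      by (intro D8) (simp add: power2_eq_square)
    obtain a where a: "x = word_mat a" "set a \<subseteq> {1..A}" "a \<noteq> []" using x \<Omega>X by (meson Gamma_sgE IntD1 subsetD)
    obtain b where b: "y = word_mat b" "set b \<subseteq> {1..B}" using w AL by (meson Gamma_sgE IntD1 subsetD)
    obtain c where c: "z = word_mat c" "set c \<subseteq> {1..A}" using w \<Omega>Z by (meson Gamma_sgE IntD1 subsetD)
    have "\<phi> = word_mat (a @ b @ c)" by (simp add: \<phi> w(1) a(1) b(1) c(1) word_mat_append matrix_mul_assoc del: mm_entry)
    moreover have "set (a @ b @ c) \<subseteq> {1..}" using a b c by auto
    \<comment> \<open>Three positive entries force ff \<phi> \<ge> 3, so (ff \<phi>)^2 never equals
      4.\<close>
    ultimately have "1 \<le> \<phi>$1$1" "1 \<le> \<phi>$1$2" "1 \<le> \<phi>$2$1"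
      using word_mat_shape[of "a @ b @ c"] a(3) by (auto simp del: word_mat_Cons)
    then have "1 \<le> (\<phi>$1$1)\<^sup>2" "1 \<le> (\<phi>$1$2)\<^sup>2" "1 \<le> (\<phi>$2$1)\<^sup>2" "0 \<le> (\<phi>$2$2)\<^sup>2" by (auto intro: one_le_power)
    then have "3 \<le> ff \<phi>" unfolding ff_def by linarith
    then have "3 * 3 \<le> ff \<phi> * ff \<phi>" by (intro mult_mono) auto
    then show "(ff \<phi>)\<^sup>2 - 4 \<noteq> 0" by (simp add: power2_eq_square)
  qed
qed

section \<open>The final estimate\<close>

text \<open>Makes \<open>ln X\<close> positive as soon as the set of words is nonempty. At X = 1 the
  lower bound for its cardinality is a division by zero, hence 0, and would carry no
  information.\<close>

lemma Gamma_norm_ball_gt_1: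
  assumes "x \<in> Gamma_sg A" "x \<in> norm_ball X"
  shows "1 < X"
proof -
  obtain u where u: "x = word_mat u" "set u \<subseteq> {1..A}" using Gamma_sgE[OF assms(1)] by metis
  then have "set u \<subseteq> {1..}" by auto
  then have "1 \<le> x$1$1" using word_mat_nonneg(1) u by simp
  then show ?thesis using entry_le_mnorm[of x 1 1] assms(2) by (simp add: norm_ball_def)
qed

lemma sum_divcount_squared_le:
  assumes "\<And>k. k \<in> nat_below Q \<Longrightarrow> real (divcount k) \<le> n"
  shows "(\<Sum>k\<in>nat_below Q. (real (divcount k))\<^sup>2 / real k) \<le> n\<^sup>2 * harm_below Q"
proof -
  have "(\<Sum>k\<in>nat_below Q. (real (divcount k))\<^sup>2 / real k) \<le> (\<Sum>k\<in>nat_below Q. n\<^sup>2 * (1 / real k))"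
  proof (rule sum_mono)
    fix k assume "k \<in> nat_below Q"
    then have "(real (divcount k))\<^sup>2 \<le> n\<^sup>2" using assms by (intro power_mono) auto
    then show "(real (divcount k))\<^sup>2 / real k \<le> n\<^sup>2 * (1 / real k)" by (simp add: divide_right_mono)
  qed
  then show ?thesis by (simp add: harm_below_def sum_distrib_left)
qed

lemma ln_le_powr:
  assumes "e > 0" "x \<ge> (1::real)"
  shows "ln x \<le> x powr e / e"
proof -
  have "e * ln x \<le> exp (e * ln x)" using exp_ge_add_one_self[of "e * ln x"] by linarith
  then show ?thesis using assms by (simp add: powr_def field_simps)
qed

lemma err_total_empty: "err_total {} Q0 Q = 0" by (simp add: err_total_def err_r_def)

lemma powr_power_eq: "x > 0 \<Longrightarrow> (x powr a) ^ n = x powr (real n * a)" for x :: real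
  by (simp add: powr_powr mult.commute flip: powr_realpow)

lemma power_powr_eq: "x > 0 \<Longrightarrow> (x ^ n) powr a = x powr (real n * a)" for x :: real
  by (simp only: powr_realpow[symmetric] powr_powr)

text \<open>The condition X \<le> Q^16 says that Q^4 / X^(1/4) is at least 1, so only powers with
  exponent O(e) have to be absorbed: N^(8 e) from the divisors of (ff \<phi>)^2 - 4, and Q^(6 e)
  from four divisor functions and two harmonic sums.\<close>

lemma trivial_case:
  fixes N X Q Q0 e C1 C2 Cd :: real
  assumes e: "0 < e" "e \<le> 1 / 2" and N: "1 \<le> N" "X \<le> N" "1 \<le> X" and Q: "1 \<le> Q" "X \<le> Q ^ 16"
    and C: "0 \<le> C1" "0 \<le> C2" "0 \<le> Cd"
    and nd: "\<And>k. k > 0 \<Longrightarrow> real (divcount k) \<le> C1 * real k powr e"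
    and H: "harm_below Q \<le> C2 * Q powr e"
    and P: "\<And>\<phi>. \<phi> \<in> P \<Longrightarrow> (ff \<phi>)\<^sup>2 - 4 \<noteq> 0 \<and> real (divcount (nat \<bar>(ff \<phi>)\<^sup>2 - 4\<bar>)) \<le> Cd * N powr (8 * e)"
  shows "err_total P Q0 Q \<le> C1 ^ 4 * C2\<^sup>2 * Cd * real (card P) * N powr (14 * e) * (Q ^ 4 / X powr (1 / 4))"
proof -
  define n where "n = C1 * Q powr e"
  define d where "d = Cd * N powr (8 * e)"
  have n: "real (divcount k) \<le> n" if "k \<in> nat_below Q" for k
  proof -
    have "real (divcount k) \<le> C1 * real k powr e" using that by (intro nd) (auto simp: nat_below_def)
    also have "\<dots> \<le> C1 * Q powr e" using that C e by (intro mult_left_mono powr_mono2) (auto simp: nat_below_def)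
    finally show ?thesis by (simp add: n_def)
  qed
  have n0: "0 \<le> n" using C by (simp add: n_def)
  have d0: "0 \<le> d" using C by (simp add: d_def)
  have "err_total P Q0 Q \<le> (\<Sum>k\<in>nat_below Q. (real (divcount k))\<^sup>2 / real k) * (\<Sum>q\<in>sqfree_range Q0 Q. \<Sum>t\<in>sqrt4_mod q. \<bar>expsum P q t\<bar>)"
    by (rule err_total_le)
  also have "\<dots> \<le> (n\<^sup>2 * harm_below Q) * (real (card P) * (n\<^sup>2 * (d * harm_below Q)))"
    using P by (intro mult_mono sum_divcount_squared_le expsum_trivial n n0) (auto intro!: sum_nonneg mult_nonneg_nonneg harm_below_nonneg simp: d_def)
  also have "\<dots> = n ^ 4 * (harm_below Q)\<^sup>2 * d * real (card P)" by (simp add: power2_eq_square eval_nat_numeral mult_ac)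
  also have "\<dots> \<le> n ^ 4 * (C2 * Q powr e)\<^sup>2 * d * real (card P)"
    using H harm_below_nonneg[of Q] n0 d0 by (intro mult_right_mono mult_left_mono power_mono) auto
  also have "\<dots> = C1 ^ 4 * C2\<^sup>2 * Cd * real (card P) * N powr (8 * e) * ((Q powr e) ^ 4 * (Q powr e)\<^sup>2)"
    by (simp add: n_def d_def power_mult_distrib mult_ac)
  also have "(Q powr e) ^ 4 * (Q powr e)\<^sup>2 = Q powr (6 * e)"
    using Q by (simp add: powr_power_eq flip: powr_add)
  also have "C1 ^ 4 * C2\<^sup>2 * Cd * real (card P) * N powr (8 * e) * Q powr (6 * e)
     \<le> C1 ^ 4 * C2\<^sup>2 * Cd * real (card P) * N powr (8 * e) * (N powr (6 * e) * (Q ^ 4 / X powr (1 / 4)))"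
  proof (rule mult_left_mono)
    show "Q powr (6 * e) \<le> N powr (6 * e) * (Q ^ 4 / X powr (1 / 4))"
    proof (cases "Q \<le> N")
      case True
      have "X powr (1 / 4) \<le> (Q ^ 16) powr (1 / 4)" using Q N by (intro powr_mono2) auto
      also have "\<dots> = Q ^ 4" using Q by (simp add: power_powr_eq)
      finally have "1 \<le> Q ^ 4 / X powr (1 / 4)" using N by simp
      moreover have "Q powr (6 * e) \<le> N powr (6 * e)" using True Q e by (intro powr_mono2) auto
      ultimately have "Q powr (6 * e) * 1 \<le> N powr (6 * e) * (Q ^ 4 / X powr (1 / 4))" by (intro mult_mono) auto
      then show ?thesis by simp
    next
      case False
      \<comment> \<open>For Q beyond N a power of Q cannot be absorbed by one of N. Here e \<le> 1/2
        gives Q^(6 e) \<le> Q^3, and Q^3 is below Q^4 / X^(1/4) because X \<le> Q.\<close>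
      have "Q powr (6 * e) \<le> Q powr 3" using Q e by (intro powr_mono) auto
      also have "\<dots> = Q ^ 4 / Q powr 1" using Q by (simp add: eval_nat_numeral)
      also have "\<dots> \<le> Q ^ 4 / X powr (1 / 4)"
      proof (intro divide_left_mono)
        have "X powr (1 / 4) \<le> X powr 1" using N by (intro powr_mono) auto
        also have "\<dots> \<le> Q powr 1" using False N by simp
        finally show "X powr (1 / 4) \<le> Q powr 1" .
      qed (use Q N in auto)
      also have "\<dots> \<le> N powr (6 * e) * (Q ^ 4 / X powr (1 / 4))"
      proof -
        have "1 \<le> N powr (6 * e)" using N e by (intro ge_one_powr_ge_zero) auto
        then have "1 * (Q ^ 4 / X powr (1 / 4)) \<le> N powr (6 * e) * (Q ^ 4 / X powr (1 / 4))"
          using Q by (intro mult_right_mono) auto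
        then show ?thesis by simp
      qed
      finally show ?thesis .
    qed
  qed (use C in simp)
  also have "\<dots> = C1 ^ 4 * C2\<^sup>2 * Cd * real (card P) * (N powr (8 * e) * N powr (6 * e)) * (Q ^ 4 / X powr (1 / 4))"
    by (simp add: mult_ac)
  also have "N powr (8 * e) * N powr (6 * e) = N powr (14 * e)" by (simp flip: powr_add)
  finally show ?thesis .
qed

text \<open>In the square of the large sieve bound, \<open>X\<^sup>2\<close> is traded for \<open>X\<^bsup>2(1-\<delta>)\<^esup>\<close> using the size of \<open>\<Omega>\<^sub>X\<close>,
  and \<open>1 / |W|\<close> is bounded using the size of \<open>\<Omega>\<^sub>Z\<close>.\<close>

lemma main_case_numeric:
  fixes N X Z Q Q0 e K \<kappa>X \<kappa>Z \<delta> \<omega> W \<omega>Z E :: real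
  assumes e: "0 < e" and N: "X \<le> N" "Z \<le> N" and X: "1 < X" and Z: "1 < Z" and Q: "1 \<le> Q0" "1 \<le> Q"
    and \<kappa>: "0 < \<kappa>X" "0 < \<kappa>Z" and \<delta>: "\<delta> \<le> 1" and K: "0 \<le> K"
    and \<omega>: "\<kappa>X * X powr (2 * \<delta>) / ln X \<le> \<omega>" and \<omega>Z: "\<kappa>Z * Z powr (2 * \<delta>) / ln Z \<le> \<omega>Z" "\<omega>Z \<le> W" and E0: "0 \<le> E"
    and E: "E\<^sup>2 \<le> \<omega> * (K * X\<^sup>2 * N powr (26 * e) * (W\<^sup>2 / Q0 + 4 * W))"
  shows "E \<le> sqrt (K / (\<kappa>X * e) * max 1 (4 / (e * \<kappa>Z))) * N powr (14 * e) * (\<omega> * W) * (X * Z) powr (1 - \<delta>) *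
    (1 / Q0 powr (1 / 2) + Q powr (1 / 2) / Z powr (1 / 4))"
proof -
  define K4 where "K4 = max 1 (4 / (e * \<kappa>Z))"
  have lnX: "0 < ln X" "ln X \<le> N powr e / e"
  proof -
    show "0 < ln X" using X by simp
    have "ln X \<le> X powr e / e" using X e by (intro ln_le_powr) auto
    also have "\<dots> \<le> N powr e / e" using X e N by (intro divide_right_mono powr_mono2) auto
    finally show "ln X \<le> N powr e / e" .
  qed
  have lnZ: "0 < ln Z" "ln Z \<le> N powr e / e"
  proof -
    show "0 < ln Z" using Z by simp
    have "ln Z \<le> Z powr e / e" using Z e by (intro ln_le_powr) auto
    also have "\<dots> \<le> N powr e / e" using Z e N by (intro divide_right_mono powr_mono2) auto
    finally show "ln Z \<le> N powr e / e" .
  qed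
  have "0 < \<kappa>X * X powr (2 * \<delta>) / ln X" using \<kappa> X lnX by simp
  then have \<omega>0: "0 < \<omega>" using \<omega> by linarith
  have "0 < \<kappa>Z * Z powr (2 * \<delta>) / ln Z" using \<kappa> Z lnZ by simp
  then have W0: "0 < \<omega>Z" "0 < W" using \<omega>Z by linarith+
  have N1: "1 < N" using N X by linarith
  have X2: "X\<^sup>2 \<le> \<omega> * (X powr (2 * (1 - \<delta>)) * (N powr e / (\<kappa>X * e)))"
  proof -
    have "X\<^sup>2 = X powr (2 * \<delta>) * X powr (2 * (1 - \<delta>))" using X by (simp add: algebra_simps flip: powr_add powr_numeral)
    also have "X powr (2 * \<delta>) \<le> \<omega> * ln X / \<kappa>X" using \<omega> \<kappa> lnX by (simp add: field_simps)
    also have "\<dots> \<le> \<omega> * (N powr e / e) / \<kappa>X" using lnX \<omega>0 \<kappa> by (intro divide_right_mono mult_left_mono) auto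
    finally show ?thesis using X by (simp add: mult_right_mono field_simps)
  qed
  have iW: "4 / W \<le> K4 * (N powr e * Z powr (2 * (1 - \<delta>)) * (Q / Z powr (1 / 2)))"
  proof -
    have "4 / W \<le> 4 / (\<kappa>Z * Z powr (2 * \<delta>) / ln Z)" using \<omega>Z W0 \<kappa> Z lnZ by (intro divide_left_mono) auto
    also have "\<dots> = 4 / \<kappa>Z * (ln Z * Z powr (- (2 * \<delta>)))" using \<kappa> Z by (simp add: powr_minus field_simps)
    also have "\<dots> \<le> 4 / \<kappa>Z * ((N powr e / e) * Z powr (- (2 * \<delta>)))" using lnZ \<kappa> by (intro mult_left_mono mult_right_mono) auto
    also have "Z powr (- (2 * \<delta>)) = Z powr (2 * (1 - \<delta>)) * Z powr (- 2)" by (simp add: algebra_simps flip: powr_add)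
    also have "4 / \<kappa>Z * ((N powr e / e) * (Z powr (2 * (1 - \<delta>)) * Z powr (- 2)))
      \<le> 4 / \<kappa>Z * ((N powr e / e) * (Z powr (2 * (1 - \<delta>)) * (Q / Z powr (1 / 2))))"
    proof (intro mult_left_mono)
      \<comment> \<open>A deliberate loss, down to the shape of the square of the third term in the
        bracket.\<close>
      have "Z powr (- 2) \<le> Z powr (- (1 / 2))" using Z by (intro powr_mono) auto
      also have "\<dots> = 1 / Z powr (1 / 2)" by (simp add: powr_minus field_simps)
      also have "\<dots> \<le> Q / Z powr (1 / 2)" using Q by (intro divide_right_mono) auto
      finally show "Z powr (- 2) \<le> Q / Z powr (1 / 2)" .
    qed (use \<kappa> e in auto)
    also have "\<dots> = 4 / (e * \<kappa>Z) * (N powr e * Z powr (2 * (1 - \<delta>)) * (Q / Z powr (1 / 2)))" by (simp add: field_simps)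
    also have "\<dots> \<le> K4 * (N powr e * Z powr (2 * (1 - \<delta>)) * (Q / Z powr (1 / 2)))"
      using Q by (intro mult_right_mono) (auto simp: K4_def)
    finally show ?thesis .
  qed
  have iQ: "1 / Q0 \<le> K4 * (N powr e * Z powr (2 * (1 - \<delta>)) * (1 / Q0))"
  proof -
    have "1 * (1 * 1 * (1 / Q0)) \<le> K4 * (N powr e * Z powr (2 * (1 - \<delta>)) * (1 / Q0))"
      using N1 e Z \<delta> Q by (intro mult_mono ge_one_powr_ge_zero) (auto simp: K4_def)
    then show ?thesis by simp
  qed
  define V where "V = 1 / Q0 powr (1 / 2) + Q powr (1 / 2) / Z powr (1 / 4)"
  \<comment> \<open>The cross term in the square of the sum is nonnegative and is dropped.\<close>
  have V: "1 / Q0 + Q / Z powr (1 / 2) \<le> V\<^sup>2"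
  proof -
    have "V\<^sup>2 = (1 / Q0 powr (1 / 2))\<^sup>2 + (Q powr (1 / 2) / Z powr (1 / 4))\<^sup>2 + 2 * (1 / Q0 powr (1 / 2)) * (Q powr (1 / 2) / Z powr (1 / 4))"
      unfolding V_def by (rule power2_sum)
    moreover have "(1 / Q0 powr (1 / 2))\<^sup>2 = 1 / Q0" using Q by (simp add: power_divide powr_power_eq)
    moreover have "(Q powr (1 / 2) / Z powr (1 / 4))\<^sup>2 = Q / Z powr (1 / 2)" using Q Z by (simp add: power_divide powr_power_eq)
    moreover have "0 \<le> 2 * (1 / Q0 powr (1 / 2)) * (Q powr (1 / 2) / Z powr (1 / 4))" by simp
    ultimately show ?thesis by linarith
  qed
  define K5 where "K5 = K / (\<kappa>X * e) * K4"
  have K5: "0 \<le> K5" using K \<kappa> e by (simp add: K5_def K4_def)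
  have "W\<^sup>2 / Q0 + 4 * W = W\<^sup>2 * (1 / Q0 + 4 / W)" using W0 by (simp add: power2_eq_square field_simps)
  also have "\<dots> \<le> W\<^sup>2 * (K4 * (N powr e * Z powr (2 * (1 - \<delta>)) * (1 / Q0)) + K4 * (N powr e * Z powr (2 * (1 - \<delta>)) * (Q / Z powr (1 / 2))))"
    using iW iQ by (intro mult_left_mono add_mono) auto
  also have "\<dots> = W\<^sup>2 * K4 * N powr e * Z powr (2 * (1 - \<delta>)) * (1 / Q0 + Q / Z powr (1 / 2))" by (simp add: algebra_simps)
  also have "\<dots> \<le> W\<^sup>2 * K4 * N powr e * Z powr (2 * (1 - \<delta>)) * V\<^sup>2" using V by (intro mult_left_mono) (auto simp: K4_def)
  finally have WV: "W\<^sup>2 / Q0 + 4 * W \<le> W\<^sup>2 * K4 * N powr e * Z powr (2 * (1 - \<delta>)) * V\<^sup>2" .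
  have "E\<^sup>2 \<le> \<omega> * (K * X\<^sup>2 * N powr (26 * e) * (W\<^sup>2 / Q0 + 4 * W))" by (rule E)
  also have "\<dots> \<le> \<omega> * (K * (\<omega> * (X powr (2 * (1 - \<delta>)) * (N powr e / (\<kappa>X * e)))) * N powr (26 * e) *
      (W\<^sup>2 * K4 * N powr e * Z powr (2 * (1 - \<delta>)) * V\<^sup>2))"
    using X2 WV \<omega>0 K W0 Q \<kappa> e by (intro mult_left_mono mult_mono) (auto intro!: mult_nonneg_nonneg divide_nonneg_nonneg)
  also have "\<dots> = K5 * (N powr e * N powr (26 * e) * N powr e) * (\<omega> * W)\<^sup>2 * (X powr (2 * (1 - \<delta>)) * Z powr (2 * (1 - \<delta>))) * V\<^sup>2"
    by (simp add: K5_def power_mult_distrib power2_eq_square mult_ac)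
  \<comment> \<open>One N^e each for the logarithms of X and Z: 1 + 26 + 1 = 2 * 14.\<close>
  also have "N powr e * N powr (26 * e) * N powr e = (N powr (14 * e))\<^sup>2"
    using N1 by (simp add: powr_power_eq flip: powr_add)
  also have "X powr (2 * (1 - \<delta>)) * Z powr (2 * (1 - \<delta>)) = ((X * Z) powr (1 - \<delta>))\<^sup>2"
    using X Z by (simp add: powr_power_eq powr_mult power_mult_distrib)
  also have "K5 = (sqrt K5)\<^sup>2" using K5 by simp
  finally have "E\<^sup>2 \<le> (sqrt K5 * N powr (14 * e) * (\<omega> * W) * (X * Z) powr (1 - \<delta>) * V)\<^sup>2"
    by (simp only: power_mult_distrib)
  then have "E \<le> sqrt K5 * N powr (14 * e) * (\<omega> * W) * (X * Z) powr (1 - \<delta>) * V"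
    by (rule power2_le_imp_le) (use K5 \<omega>0 W0 in \<open>auto simp: V_def intro!: mult_nonneg_nonneg add_nonneg_nonneg\<close>)
  then show ?thesis by (simp add: K5_def K4_def V_def)
qed

theorem theorem5p1:
  fixes A :: nat and \<epsilon> c\<^sub>1 c\<^sub>2 \<kappa>\<^sub>X \<kappa>\<^sub>Z :: real
  assumes "1 \<le> A"
    and "0 < \<epsilon>"
    and "0 < c\<^sub>1" and "0 < c\<^sub>2"
    and "0 < \<kappa>\<^sub>X" and "0 < \<kappa>\<^sub>Z"
  shows "\<exists>C>0. \<exists>N\<^sub>0. \<forall>N X Y Z T Q\<^sub>0 Q :: real. \<forall>AL \<Omega>\<^sub>X \<Omega>\<^sub>Z :: imat set.
     N \<ge> N\<^sub>0 \<longrightarrow>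
     1 \<le> X \<longrightarrow> 1 \<le> Y \<longrightarrow> 1 \<le> Z \<longrightarrow> X * Y * Z = N \<longrightarrow>
     c\<^sub>1 * N ^ 4 \<le> T \<longrightarrow> T \<le> c\<^sub>2 * N ^ 4 \<longrightarrow>
     1 \<le> Q\<^sub>0 \<longrightarrow> Q\<^sub>0 < Q \<longrightarrow>
     AL \<noteq> {} \<longrightarrow> AL \<subseteq> Gamma_sg 2 \<inter> norm_ball Y \<longrightarrow>
     \<Omega>\<^sub>X \<subseteq> Gamma_sg A \<inter> norm_ball X \<longrightarrow> same_word_length A \<Omega>\<^sub>X \<longrightarrow>
     real (card \<Omega>\<^sub>X) \<ge> \<kappa>\<^sub>X * X powr (2 * delta A) / ln X \<longrightarrow>
     \<Omega>\<^sub>Z \<subseteq> Gamma_sg A \<inter> norm_ball Z \<longrightarrow> same_word_length A \<Omega>\<^sub>Z \<longrightarrow>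
     real (card \<Omega>\<^sub>Z) \<ge> \<kappa>\<^sub>Z * Z powr (2 * delta A) / ln Z \<longrightarrow>
     (let P = prod3 \<Omega>\<^sub>X AL \<Omega>\<^sub>Z in
      err_total P Q\<^sub>0 Q \<le>
        C * T powr \<epsilon> * real (card P) * (X * Z) powr (1 - delta A) *
        (Q ^ 4 / X powr (1/4) + 1 / Q\<^sub>0 powr (1/2) + Q powr (1/2) / Z powr (1/4)))"
proof -
  \<comment> \<open>The proof loses at most N^(19 e), and \<open>19 * e \<le> 4 * \<epsilon>\<close>
    while T is at least a multiple of N^4. The bound 1/2 serves the case Q > N of
    \<open>trivial_case\<close>.\<close>
  define e where "e = min (\<epsilon> / 5) (1 / 2)"
  have e: "0 < e" "e \<le> 1 / 2" "5 * e \<le> \<epsilon>" using assms(2) by (auto simp: e_def)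
  obtain C1 where C1: "C1 \<ge> 1" "\<And>n. n > 0 \<Longrightarrow> real (divcount n) \<le> C1 * real n powr e" using divcount_bound[OF e(1)] by blast
  obtain C2 where C2: "C2 \<ge> 1" "\<And>Q. Q \<ge> 1 \<Longrightarrow> harm_below Q \<le> C2 * Q powr e"
    using sum_inverse_bound[OF e(1)] unfolding harm_below_def nat_below_def by blast
  obtain C3 where C3: "C3 \<ge> 1" and LS: "\<forall>R\<ge>1. \<forall>Q0\<ge>1. \<forall>Q n d \<Omega> W. finite \<Omega> \<longrightarrow> finite W \<longrightarrow>
     (\<forall>x\<in>\<Omega>. \<exists>a\<in>Ybox R. \<exists>b\<in>Ybox R. \<exists>c\<in>Ybox R. x = a ** b ** c) \<longrightarrow> (\<forall>w\<in>W. det w = 1) \<longrightarrow>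
     Q ^ 6 \<le> R\<^sup>2 \<longrightarrow> 1 \<le> n \<longrightarrow> 1 \<le> d \<longrightarrow> (\<forall>k\<in>nat_below (Q\<^sup>2). real (divcount k) \<le> n) \<longrightarrow>
     (\<forall>w\<in>W. \<forall>w'\<in>W. (ff (adj w ** w'))\<^sup>2 - 4 \<noteq> 0 \<longrightarrow> real (divcount (nat \<bar>(ff (adj w ** w'))\<^sup>2 - 4\<bar>)) \<le> d) \<longrightarrow>
     (\<Sum>q\<in>sqfree_range Q0 Q. \<Sum>t\<in>sqrt4_mod q. \<bar>\<Sum>x\<in>\<Omega>. \<Sum>w\<in>W. Xi q (ff (x ** w) - t)\<bar>)\<^sup>2
       \<le> real (card \<Omega>) * (C3 * R powr (6 + e) * n ^ 7 * harm_below Q ^ 3 * d *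
          ((real (card W))\<^sup>2 / Q0 + real (card {(w, w') \<in> W \<times> W. (ff (adj w ** w'))\<^sup>2 = 4})))"
    using bilinear_large_sieve[OF e(1)] by (elim exE conjE) (rule that)
  define B where "B = (real A + 1) ^ 4"
  define Cd where "Cd = C1 * (10 ^ 5) powr e"
  define K where "K = C3 * B powr 7 * C1 ^ 7 * C2 ^ 3 * Cd"
  define K5 where "K5 = K / (\<kappa>\<^sub>X * e) * max 1 (4 / (e * \<kappa>\<^sub>Z))"
  \<comment> \<open>The constants of the two regimes added; the power of \<open>c\<^sub>1\<close>
    converts N^(4 \<epsilon>) into T^\<epsilon>.\<close>
  define Cf where "Cf = c\<^sub>1 powr (- \<epsilon>) * (C1 ^ 4 * C2\<^sup>2 * Cd + C1\<^sup>2 * C2 * sqrt K5)"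
  have B1: "B \<ge> 1" unfolding B_def by (rule one_le_power) simp
  have Cd1: "Cd \<ge> 1"
  proof -
    have "1 * 1 \<le> C1 * (10 ^ 5) powr e" using C1 e by (intro mult_mono ge_one_powr_ge_zero) auto
    then show ?thesis by (simp add: Cd_def)
  qed
  have K0: "0 \<le> K" using C3 C1 C2 Cd1 by (simp add: K_def)
  have K50: "0 \<le> K5" using K0 e assms by (simp add: K5_def)
  have a0: "0 < C1 ^ 4 * C2\<^sup>2 * Cd" "0 \<le> C1\<^sup>2 * C2 * sqrt K5" using C1 C2 Cd1 K50 by auto
  have Cf0: "Cf > 0" unfolding Cf_def using assms(3) a0 by (intro mult_pos_pos[OF _ add_pos_nonneg[OF a0]]) simp
  show ?thesis
  proof (rule exI[of _ Cf], rule conjI[OF Cf0], rule exI[of _ 1], intro allI impI)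
    fix N X Y Z T Q0 Q :: real and AL \<Omega>X \<Omega>Z :: "imat set"
    assume N1: "1 \<le> N" and XYZ: "1 \<le> X" "1 \<le> Y" "1 \<le> Z" "X * Y * Z = N"
      and T: "c\<^sub>1 * N ^ 4 \<le> T" and Q: "1 \<le> Q0" "Q0 < Q"
      and AL: "AL \<noteq> {}" "AL \<subseteq> Gamma_sg 2 \<inter> norm_ball Y"
      and \<Omega>X: "\<Omega>X \<subseteq> Gamma_sg A \<inter> norm_ball X" "same_word_length A \<Omega>X" "\<kappa>\<^sub>X * X powr (2 * delta A) / ln X \<le> real (card \<Omega>X)"
      and \<Omega>Z: "\<Omega>Z \<subseteq> Gamma_sg A \<inter> norm_ball Z" "same_word_length A \<Omega>Z" "\<kappa>\<^sub>Z * Z powr (2 * delta A) / ln Z \<le> real (card \<Omega>Z)"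
    define P where "P = prod3 \<Omega>X AL \<Omega>Z"
    define \<delta> where "\<delta> = delta A"
    define XZ where "XZ = (X * Z) powr (1 - \<delta>)"
    define b1 b2 where "b1 = Q ^ 4 / X powr (1 / 4)" and "b2 = 1 / Q0 powr (1 / 2) + Q powr (1 / 2) / Z powr (1 / 4)"
    have Q1: "1 \<le> Q" using Q by linarith
    have \<delta>: "\<delta> \<le> 1" by (simp add: \<delta>_def delta_le_1)
    have XZ1: "1 \<le> XZ" unfolding XZ_def using XYZ \<delta> mult_mono[of 1 X 1 Z] by (intro ge_one_powr_ge_zero) auto
    have b0: "0 \<le> b1" "0 \<le> b2" using Q1 by (auto simp: b1_def b2_def)
    have TN: "N powr (19 * e) \<le> c\<^sub>1 powr (- \<epsilon>) * T powr \<epsilon>"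
    proof -
      have "N powr (19 * e) \<le> N powr (4 * \<epsilon>)" using N1 e by (intro powr_mono) auto
      also have "\<dots> = c\<^sub>1 powr (- \<epsilon>) * (c\<^sub>1 * N ^ 4) powr \<epsilon>"
        using N1 assms by (simp add: powr_mult power_powr_eq powr_minus)
      also have "\<dots> \<le> c\<^sub>1 powr (- \<epsilon>) * T powr \<epsilon>"
        using T assms N1 by (intro mult_left_mono powr_mono2) auto
      finally show ?thesis .
    qed
    have final: "err_total P Q0 Q \<le> Cf * T powr \<epsilon> * real (card P) * XZ * (b1 + b2)"
      if k: "err_total P Q0 Q \<le> k * real (card P) * N powr (19 * e) * XZ * (b1 + b2)" "0 \<le> k"
        "k \<le> C1 ^ 4 * C2\<^sup>2 * Cd + C1\<^sup>2 * C2 * sqrt K5" for k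
    proof -
      have "k * N powr (19 * e) \<le> (C1 ^ 4 * C2\<^sup>2 * Cd + C1\<^sup>2 * C2 * sqrt K5) * (c\<^sub>1 powr (- \<epsilon>) * T powr \<epsilon>)"
        using k TN by (intro mult_mono) auto
      also have "\<dots> = Cf * T powr \<epsilon>" by (simp add: Cf_def)
      finally have "(k * N powr (19 * e)) * (real (card P) * XZ * (b1 + b2)) \<le> (Cf * T powr \<epsilon>) * (real (card P) * XZ * (b1 + b2))"
        using b0 XZ1 by (intro mult_right_mono) auto
      then show ?thesis using k(1) by (simp add: mult_ac)
    qed
    have "err_total P Q0 Q \<le> Cf * T powr \<epsilon> * real (card P) * XZ * (b1 + b2)"
    \<comment> \<open>If either set is empty then so is the product set, and both sides vanish.
      Otherwise X and Z exceed 1 and the logarithms are positive.\<close>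
    proof (cases "\<Omega>X = {} \<or> \<Omega>Z = {}")
      case True
      then have "P = {}" by (auto simp: P_def prod3_def)
      then show ?thesis by (simp add: err_total_empty)
    next
      case False
      then have ne: "\<Omega>X \<noteq> {}" "\<Omega>Z \<noteq> {}" by auto
      have X1: "1 < X" using ne \<Omega>X Gamma_norm_ball_gt_1 by blast
      have Z1: "1 < Z" using ne \<Omega>Z Gamma_norm_ball_gt_1 by blast
      have XN: "X \<le> N"
      proof -
        have "X * (1 * 1) \<le> X * (Y * Z)" using XYZ by (intro mult_left_mono mult_mono) auto
        also have "X * (Y * Z) = N" using XYZ(4) by (simp only: mult.assoc)
        finally show ?thesis by simp
      qed
      have ZN: "Z \<le> N"
      proof -
        have "1 * 1 * Z \<le> X * Y * Z" using XYZ by (intro mult_right_mono mult_mono) auto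
        also have "X * Y * Z = N" by (rule XYZ(4))
        finally show ?thesis by simp
      qed
      obtain W where W: "finite \<Omega>X" "finite W" "card P = card \<Omega>X * card W" "card \<Omega>Z \<le> card W"
        "\<And>w. w \<in> W \<Longrightarrow> det w = 1"
        "\<And>q t. expsum P q t = (\<Sum>x\<in>\<Omega>X. \<Sum>w\<in>W. Xi q (ff (x ** w) - t))"
        "\<And>\<phi>. \<phi> \<in> P \<Longrightarrow> (ff \<phi>)\<^sup>2 - 4 \<noteq> 0"
        "\<And>\<phi>. \<phi> \<in> P \<Longrightarrow> real_of_int \<bar>(ff \<phi>)\<^sup>2 - 4\<bar> \<le> 10 ^ 5 * N ^ 8"
        "\<And>w w'. w \<in> W \<Longrightarrow> w' \<in> W \<Longrightarrow> real_of_int \<bar>(ff (adj w ** w'))\<^sup>2 - 4\<bar> \<le> 10 ^ 5 * N ^ 8"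
        unfolding P_def using product_structure[OF XYZ AL \<Omega>X(1,2) ne(1) \<Omega>Z(1,2)] by metis
      have ndD: "real (divcount (nat \<bar>D\<bar>)) \<le> Cd * N powr (8 * e)" if "D \<noteq> 0" "real_of_int \<bar>D\<bar> \<le> 10 ^ 5 * N ^ 8" for D :: int
      proof -
        have "real (divcount (nat \<bar>D\<bar>)) \<le> C1 * real (nat \<bar>D\<bar>) powr e" using that by (intro C1) auto
        also have "\<dots> \<le> C1 * (10 ^ 5 * N ^ 8) powr e" using that C1 e by (intro mult_left_mono powr_mono2) auto
        also have "\<dots> = Cd * N powr (8 * e)" using N1 by (simp add: Cd_def powr_mult power_powr_eq)
        finally show ?thesis .
      qed
      show ?thesis
      proof (cases "X \<le> Q ^ 16")
        case True
        have "err_total P Q0 Q \<le> C1 ^ 4 * C2\<^sup>2 * Cd * real (card P) * N powr (14 * e) * (Q ^ 4 / X powr (1 / 4))"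
        proof (rule trivial_case[OF e(1,2) N1 XN XYZ(1) Q1 True])
          show "harm_below Q \<le> C2 * Q powr e" by (rule C2(2)[OF Q1])
          show "(ff \<phi>)\<^sup>2 - 4 \<noteq> 0 \<and> real (divcount (nat \<bar>(ff \<phi>)\<^sup>2 - 4\<bar>)) \<le> Cd * N powr (8 * e)" if "\<phi> \<in> P" for \<phi>
            using W(7)[OF that] W(8)[OF that] ndD by blast
        qed (use C1 C2 Cd1 in auto)
        also have "\<dots> \<le> C1 ^ 4 * C2\<^sup>2 * Cd * real (card P) * N powr (19 * e) * (XZ * (b1 + b2))"
        proof (rule mult_mono)
          show "C1 ^ 4 * C2\<^sup>2 * Cd * real (card P) * N powr (14 * e) \<le> C1 ^ 4 * C2\<^sup>2 * Cd * real (card P) * N powr (19 * e)"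
            using a0 N1 e by (intro mult_left_mono powr_mono) auto
          have "1 * b1 \<le> XZ * (b1 + b2)" using XZ1 b0 by (intro mult_mono) auto
          then show "Q ^ 4 / X powr (1 / 4) \<le> XZ * (b1 + b2)" by (simp add: b1_def)
        qed (use a0 Q1 in auto)
        finally show ?thesis by (intro final[of "C1 ^ 4 * C2\<^sup>2 * Cd"]) (use a0 in \<open>auto simp: mult.assoc\<close>)
      next
        case False
        then have QX: "Q ^ 16 < X" by simp
        have QN: "Q \<le> N"
        proof -
          have "Q ^ 1 \<le> Q ^ 16" using Q1 by (intro power_increasing) auto
          then show ?thesis using QX XN by simp
        qed
        define R where "R = B * X powr (1 / 3)"
        \<comment> \<open>The divisor functions are evaluated at lcm(q, q') < Q^2 \<le> N^2, hence
          the exponent 2 e.\<close>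
        define n where "n = C1 * N powr (2 * e)"
        define d where "d = Cd * N powr (8 * e)"
        define E where "E = (\<Sum>q\<in>sqfree_range Q0 Q. \<Sum>t\<in>sqrt4_mod q. \<bar>expsum P q t\<bar>)"
        have X13: "1 \<le> X powr (1 / 3)" using X1 by (intro ge_one_powr_ge_zero) auto
        have XR: "X powr (1 / 3) \<le> R" unfolding R_def using B1 X13 mult_right_mono[of 1 B "X powr (1 / 3)"] by simp
        have R1: "1 \<le> R" using X13 XR by linarith
        have n1: "1 \<le> n"
        proof -
          have "1 * 1 \<le> C1 * N powr (2 * e)" using C1 N1 e by (intro mult_mono ge_one_powr_ge_zero) auto
          then show ?thesis by (simp add: n_def)
        qed
        have d1: "1 \<le> d"
        proof -
          have "1 * 1 \<le> Cd * N powr (8 * e)" using Cd1 N1 e by (intro mult_mono ge_one_powr_ge_zero) auto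
          then show ?thesis by (simp add: d_def)
        qed
        have nn: "real (divcount k) \<le> n" if "k \<in> nat_below (Q\<^sup>2)" for k
        proof -
          have "real (divcount k) \<le> C1 * real k powr e" using that by (intro C1) (auto simp: nat_below_def)
          also have "\<dots> \<le> C1 * (N\<^sup>2) powr e"
          proof (intro mult_left_mono powr_mono2)
            have "Q\<^sup>2 \<le> N\<^sup>2" using QN Q1 by (intro power_mono) auto
            then show "real k \<le> N\<^sup>2" using that by (simp add: nat_below_def)
          qed (use C1 e in auto)
          also have "(N\<^sup>2) powr e = N powr (2 * e)" using N1 by (simp add: power_powr_eq)
          finally show ?thesis by (simp add: n_def)
        qed
        have nn1: "real (divcount k) \<le> n" if "k \<in> nat_below Q" for k
        proof (rule nn)
          have "Q ^ 1 \<le> Q ^ 2" using Q1 by (intro power_increasing) auto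
          then show "k \<in> nat_below (Q\<^sup>2)" using that by (simp add: nat_below_def)
        qed
        have QR: "Q ^ 6 \<le> R\<^sup>2"
        proof -
          \<comment> \<open>Q^16 < X gives Q^6 \<le> X^(3/8), well within R^2, which is at least
            X^(2/3).\<close>
          have "Q ^ 6 = (Q ^ 16) powr (3 / 8)" using Q1 by (simp add: power_powr_eq)
          also have "\<dots> \<le> X powr (3 / 8)" using QX Q1 by (intro powr_mono2) auto
          also have "\<dots> \<le> X powr (2 / 3)" using X1 by (intro powr_mono) auto
          also have "\<dots> = (X powr (1 / 3))\<^sup>2" using X1 by (simp add: powr_power_eq)
          also have "\<dots> \<le> R\<^sup>2" using XR X13 by (intro power_mono) auto
          finally show ?thesis .
        qed
        have HN: "harm_below Q \<le> C2 * N powr e"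
        proof -
          have "C2 * Q powr e \<le> C2 * N powr e" using QN Q1 C2 e by (intro mult_left_mono powr_mono2) auto
          then show ?thesis using C2(2)[OF Q1] by linarith
        qed
        have Wdet: "\<forall>w\<in>W. det w = 1" and nnQ: "\<forall>k\<in>nat_below (Q\<^sup>2). real (divcount k) \<le> n"
          using W(5) nn by blast+
        have sp: "\<forall>x\<in>\<Omega>X. \<exists>a\<in>Ybox R. \<exists>b\<in>Ybox R. \<exists>c\<in>Ybox R. x = a ** b ** c"
          using \<Omega>X(1) Gamma_split3[of _ A X] XYZ(1) unfolding R_def B_def by blast
        have wd: "\<forall>w\<in>W. \<forall>w'\<in>W. (ff (adj w ** w'))\<^sup>2 - 4 \<noteq> 0 \<longrightarrow> real (divcount (nat \<bar>(ff (adj w ** w'))\<^sup>2 - 4\<bar>)) \<le> d"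
          using W(9) ndD unfolding d_def by blast
        have "E\<^sup>2 \<le> real (card \<Omega>X) * (C3 * R powr (6 + e) * n ^ 7 * harm_below Q ^ 3 * d *
          ((real (card W))\<^sup>2 / Q0 + real (card {(w, w') \<in> W \<times> W. (ff (adj w ** w'))\<^sup>2 = 4})))"
          unfolding E_def W(6)
          by (rule LS[THEN spec, THEN mp, OF R1, THEN spec, THEN mp, OF Q(1), THEN spec, THEN spec, THEN spec, THEN spec, THEN spec,
                THEN mp, OF W(1), THEN mp, OF W(2), THEN mp, OF sp, THEN mp, OF Wdet, THEN mp, OF QR,
                THEN mp, OF n1, THEN mp, OF d1, THEN mp, OF nnQ, THEN mp, OF wd])
        also have "\<dots> \<le> real (card \<Omega>X) * (K * X\<^sup>2 * N powr (26 * e) * ((real (card W))\<^sup>2 / Q0 + 4 * real (card W)))"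
        proof (rule mult_left_mono, rule mult_mono)
          \<comment> \<open>R^6 is X^2 up to a constant, the number of elements of norm up to X in
            SL_2(Z) in order of magnitude: the majorant has the size of the full ball. The exponent
            7 bounds 6 + e.\<close>
          have "R powr (6 + e) \<le> B powr 7 * (X\<^sup>2 * N powr e)"
          proof -
            have "R powr (6 + e) = B powr (6 + e) * X powr (2 + e / 3)"
              using B1 X1 by (simp add: R_def powr_mult powr_powr add_divide_distrib)
            also have "X powr (2 + e / 3) = X powr 2 * X powr (e / 3)" by (rule powr_add)
            also have "B powr (6 + e) * (X powr 2 * X powr (e / 3)) \<le> B powr 7 * (X powr 2 * N powr e)"
            proof (intro mult_mono powr_mono)
              have "X powr (e / 3) \<le> X powr e" using X1 e by (intro powr_mono) auto
              also have "\<dots> \<le> N powr e" using X1 XN e by (intro powr_mono2) auto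
              finally show "X powr (e / 3) \<le> N powr e" .
            qed (use B1 e X1 in auto)
            finally show ?thesis using X1 by simp
          qed
          moreover have "harm_below Q ^ 3 \<le> (C2 * N powr e) ^ 3" using HN harm_below_nonneg by (intro power_mono) auto
          ultimately have "C3 * R powr (6 + e) * n ^ 7 * harm_below Q ^ 3 * d
              \<le> C3 * (B powr 7 * (X\<^sup>2 * N powr e)) * n ^ 7 * (C2 * N powr e) ^ 3 * d"
            using C3 n1 d1 harm_below_nonneg by (intro mult_right_mono mult_mono) auto
          also have "\<dots> = K * X\<^sup>2 * (N powr e * (N powr (2 * e)) ^ 7 * (N powr e) ^ 3 * N powr (8 * e))"
            by (simp add: K_def n_def d_def power_mult_distrib mult_ac)
          \<comment> \<open>26 = 1 + 14 + 3 + 8, from R^e, n^7, the three harmonic sums and the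
            divisor bound \<open>d\<close>.\<close>
          also have "N powr e * (N powr (2 * e)) ^ 7 * (N powr e) ^ 3 * N powr (8 * e) = N powr (26 * e)"
            using N1 by (simp add: powr_power_eq flip: powr_add)
          finally show "C3 * R powr (6 + e) * n ^ 7 * harm_below Q ^ 3 * d \<le> K * X\<^sup>2 * N powr (26 * e)" .
          show "(real (card W))\<^sup>2 / Q0 + real (card {(w, w') \<in> W \<times> W. (ff (adj w ** w'))\<^sup>2 = 4}) \<le> (real (card W))\<^sup>2 / Q0 + 4 * real (card W)"
            using card_rotation_pairs[OF W(2,5)] by (simp flip: of_nat_le_iff)
        qed (use K0 Q in auto)
        finally have E2: "E\<^sup>2 \<le> real (card \<Omega>X) * (K * X\<^sup>2 * N powr (26 * e) * ((real (card W))\<^sup>2 / Q0 + 4 * real (card W)))" .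
        have E0: "0 \<le> E" by (simp add: E_def sum_nonneg)
        have "E \<le> sqrt (K / (\<kappa>\<^sub>X * e) * max 1 (4 / (e * \<kappa>\<^sub>Z))) * N powr (14 * e) * (real (card \<Omega>X) * real (card W)) * (X * Z) powr (1 - \<delta>) *
            (1 / Q0 powr (1 / 2) + Q powr (1 / 2) / Z powr (1 / 4))"
          by (rule main_case_numeric[OF e(1) XN ZN X1 Z1 Q(1) Q1 assms(5,6) \<delta> K0 \<Omega>X(3)[folded \<delta>_def] \<Omega>Z(3)[folded \<delta>_def] _ E0 E2])
            (use W(4) in simp)
        then have E: "E \<le> sqrt K5 * N powr (14 * e) * real (card P) * XZ * b2"
          by (simp add: K5_def XZ_def b2_def W(3))
        have "err_total P Q0 Q \<le> (\<Sum>k\<in>nat_below Q. (real (divcount k))\<^sup>2 / real k) * E"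
          unfolding E_def by (rule err_total_le)
        also have "\<dots> \<le> (n\<^sup>2 * harm_below Q) * E"
          using E0 by (intro mult_right_mono sum_divcount_squared_le nn1)
        also have "\<dots> \<le> (n\<^sup>2 * (C2 * N powr e)) * (sqrt K5 * N powr (14 * e) * real (card P) * XZ * b2)"
          using HN E E0 C2 harm_below_nonneg by (intro mult_mono) auto
        also have "\<dots> = C1\<^sup>2 * C2 * sqrt K5 * real (card P) * ((N powr (2 * e))\<^sup>2 * N powr e * N powr (14 * e)) * XZ * b2"
          by (simp add: n_def power_mult_distrib mult_ac)
        \<comment> \<open>19 = 4 + 1 + 14, from the sum over k (n^2 and one harmonic sum) and from
          the bound for \<open>E\<close>.\<close>
        also have "(N powr (2 * e))\<^sup>2 * N powr e * N powr (14 * e) = N powr (19 * e)"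
          using N1 by (simp add: powr_power_eq flip: powr_add)
        also have "C1\<^sup>2 * C2 * sqrt K5 * real (card P) * N powr (19 * e) * XZ * b2
          \<le> C1\<^sup>2 * C2 * sqrt K5 * real (card P) * N powr (19 * e) * XZ * (b1 + b2)"
          using a0 XZ1 b0 by (intro mult_left_mono) auto
        finally show ?thesis by (intro final[of "C1\<^sup>2 * C2 * sqrt K5"]) (use a0 in auto)
      qed
    qed
    then show "let P = prod3 \<Omega>X AL \<Omega>Z in err_total P Q0 Q \<le> Cf * T powr \<epsilon> * real (card P) * (X * Z) powr (1 - delta A) *
        (Q ^ 4 / X powr (1/4) + 1 / Q0 powr (1/2) + Q powr (1/2) / Z powr (1/4))"
      by (simp add: Let_def P_def XZ_def \<delta>_def b1_def b2_def add.assoc)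
  qed
qed

end
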